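(* Let $X$ be a Banach space with a basis $(e_i)$. If $X$ contains no subspace isomorphic to $\ell_1$ or $c_0$, then there exists a normalized block basis of $(e_i)$ having a spreading model $(s_i)$ which satisfies $$1<\|s_1+s_2\|<2.$$
   Context: Banach spaces are real and infinite dimensional; "basis" means Schauder basis. A block basis of $(e_i)$ is a sequence of nonzero vectors $x_k=\sum_{i=p_{k-1}+1}^{p_k} a_i e_i$ with $0\le p_0<p_1<\cdots$ and arbitrary real scalars $a_i$; it is normalized if $\|x_k\|=1$ for all $k$. Spreading model: let $(x_i)$ be a normalized basic sequence. A basic sequence $(s_i)$ (in some Banach space, whose norm is also denoted $\|\cdot\|$) is a spreading model of $(x_i)$ if for some sequence $\varepsilon_n\downarrow 0$, for all $n$ and all $(a_i)_1^n\in[-1,1]^n$, $$\left|\Big\|\sum_{i=1}^n a_i x_{k_i}\Big\|-\Big\|\sum_{i=1}^n a_i s_i\Big\|\right|<\varepsilon_n\quad\text{whenever } n\le k_1<\cdots<k_n.$$ *)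

theory Defs
  imports "HOL-Analysis.Analysis"
begin

text \<open>All sequences are indexed from 0: the term \<open>e\<^sub>i\<close> of the usual 1-based notation is
  \<open>e (i - 1)\<close>.\<close>

definition schauder_basis_of :: "(nat \<Rightarrow> 'a::banach) \<Rightarrow> 'a set \<Rightarrow> bool" where
  "schauder_basis_of e Y \<longleftrightarrow>
     range e \<subseteq> Y \<and> (\<forall>x\<in>Y. \<exists>!a :: nat \<Rightarrow> real. (\<lambda>n. a n *\<^sub>R e n) sums x)"

definition schauder_basis :: "(nat \<Rightarrow> 'a::banach) \<Rightarrow> bool" where
  "schauder_basis e \<longleftrightarrow> schauder_basis_of e UNIV"

definition basic_sequence :: "(nat \<Rightarrow> 'a::banach) \<Rightarrow> bool" where
  "basic_sequence x \<longleftrightarrow> schauder_basis_of x (closure (span (range x)))"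

definition normalized :: "(nat \<Rightarrow> 'a::real_normed_vector) \<Rightarrow> bool" where
  "normalized x \<longleftrightarrow> (\<forall>k. norm (x k) = 1)"

text \<open>With 0-based indices, the index set \<open>{p\<^sub>k\<^sub>-\<^sub>1 + 1, \<dots>, p\<^sub>k}\<close> of the \<open>k\<close>-th block becomes
  \<open>{p k ..< p (Suc k)}\<close>.\<close>

definition block_basis :: "(nat \<Rightarrow> 'a::real_normed_vector) \<Rightarrow> (nat \<Rightarrow> 'a) \<Rightarrow> bool" where
  "block_basis e x \<longleftrightarrow>
     (\<exists>(p :: nat \<Rightarrow> nat) (a :: nat \<Rightarrow> real). strict_mono p \<and>
        (\<forall>k. x k = (\<Sum>i\<in>{p k..<p (Suc k)}. a i *\<^sub>R e i) \<and> x k \<noteq> 0))"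

text \<open>The condition \<open>n \<le> k\<^sub>1\<close> on 1-based indices reads \<open>n \<le> Suc (k 0)\<close>.\<close>

definition spreading_model :: "(nat \<Rightarrow> 'a::banach) \<Rightarrow> (nat \<Rightarrow> 'b::banach) \<Rightarrow> bool" where
  "spreading_model x s \<longleftrightarrow>
     normalized x \<and> basic_sequence x \<and> basic_sequence s \<and>
     (\<exists>\<epsilon> :: nat \<Rightarrow> real. decseq \<epsilon> \<and> \<epsilon> \<longlonglongrightarrow> 0 \<and>
        (\<forall>n\<ge>1. \<forall>(a :: nat \<Rightarrow> real) (k :: nat \<Rightarrow> nat).
           (\<forall>i<n. a i \<in> {-1..1}) \<longrightarrow> n \<le> Suc (k 0) \<longrightarrow> strict_mono_on {..<n} k \<longrightarrow>
           \<bar>norm (\<Sum>i<n. a i *\<^sub>R x (k i)) - norm (\<Sum>i<n. a i *\<^sub>R s i)\<bar> < \<epsilon> n))"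

text \<open>The sequence spaces \<open>\<ell>\<^sub>1\<close> and \<open>c\<^sub>0\<close>, as sets of real sequences with pointwise operations and
  a separate norm.\<close>

definition ell1 :: "(nat \<Rightarrow> real) set" where
  "ell1 = {a. summable (\<lambda>n. \<bar>a n\<bar>)}"

definition ell1_norm :: "(nat \<Rightarrow> real) \<Rightarrow> real" where
  "ell1_norm a = (\<Sum>n. \<bar>a n\<bar>)"

definition c0 :: "(nat \<Rightarrow> real) set" where
  "c0 = {a. a \<longlonglongrightarrow> 0}"

definition c0_norm :: "(nat \<Rightarrow> real) \<Rightarrow> real" where
  "c0_norm a = (SUP n. \<bar>a n\<bar>)"

text \<open>\<open>Y\<close> is isomorphic to the sequence space \<open>V\<close> with norm \<open>N\<close>: there is a linear bijection of
  \<open>V\<close> onto \<open>Y\<close> that is bounded and has a bounded inverse.  If \<open>V\<close> is complete under \<open>N\<close>, such a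
  \<open>Y\<close> is automatically a closed subspace.\<close>

definition isomorphic_to_seq_space ::
    "'a::real_normed_vector set \<Rightarrow> (nat \<Rightarrow> real) set \<Rightarrow> ((nat \<Rightarrow> real) \<Rightarrow> real) \<Rightarrow> bool" where
  "isomorphic_to_seq_space Y V N \<longleftrightarrow>
     (\<exists>T :: (nat \<Rightarrow> real) \<Rightarrow> 'a.
        (\<forall>a\<in>V. \<forall>b\<in>V. T (\<lambda>n. a n + b n) = T a + T b) \<and>
        (\<forall>r. \<forall>a\<in>V. T (\<lambda>n. r * a n) = r *\<^sub>R T a) \<and>
        bij_betw T V Y \<and>
        (\<exists>C>0. \<forall>a\<in>V. norm (T a) \<le> C * N a) \<and>
        (\<exists>D>0. \<forall>a\<in>V. N a \<le> D * norm (T a)))"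

text \<open>The space \<open>\<ell>\<^sub>\<infinity>\<close> of bounded real sequences with the supremum norm (all functions on the
  discrete space of naturals are continuous).  HOL cannot quantify over types inside a formula, so
  ``in some Banach space'' is rendered as ``in \<open>\<ell>\<^sub>\<infinity>\<close>'': the closed span of a sequence is separable,
  and every separable real Banach space embeds linearly and isometrically into \<open>\<ell>\<^sub>\<infinity>\<close>, so nothing
  is lost.\<close>

text \<open>The library has the following completeness instance only for a metric domain, which excludes
  the type of naturals.\<close>

instance bcontfun :: (topological_space, complete_space) complete_space
proof
  fix f :: "nat \<Rightarrow> ('a, 'b) bcontfun"
  assume "Cauchy f"
  then obtain g where "uniform_limit UNIV f g sequentially"
    using uniformly_convergent_eq_cauchy[of "\<lambda>_. True" f]
    unfolding Cauchy_def uniform_limit_sequentially_iff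
    by (metis dist_fun_lt_imp_dist_val_lt)
  from uniform_limit_bcontfunE[OF this sequentially_bot]
  obtain l' where "g = apply_bcontfun l'" "(f \<longlonglongrightarrow> l')" by metis
  then show "convergent f"
    by (intro convergentI)
qed

instance bcontfun :: (topological_space, banach) banach ..

type_synonym ell_infinity = "nat \<Rightarrow>\<^sub>C real"

end

theory Submission
  imports Defs "HOL-Library.Ramsey" "HOL-Library.Diagonal_Subsequence"
begin

text \<open>
  Suppose that no spreading model of a normalized block basis satisfies \<open>1 < \<parallel>s\<^sub>0 + s\<^sub>1\<parallel> < 2\<close>.  Every
  normalized block basis has a subsequence with a spreading model, so along it \<open>\<parallel>x\<^sub>i + x\<^sub>j\<parallel>\<close> tends to 2
  or to a number at most 1.  The two kinds of behaviour cannot coexist, by following the path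
  \<open>(1 - t) x + t y\<close>; hence all block bases behave alike.

  If all limits are at most 1, then suitable sums of two members of a sequence of blocks with norms
  tending to at most 1 again form such a sequence.  By Galvin's lemma either some subsequence has
  uniformly bounded finite sums, which gives \<open>c\<^sub>0\<close>, or in some subsequence every infinite subset has
  an initial segment with a large sum; in the latter case a bar induction over finite sets
  produces sums that extend such initial segments but have norm about 1, contradicting the basis
  inequality.

  If all limits are 2, a bar induction of the same kind with averages in place of sums (a repeated
  averaging proof of Ptak's lemma) shows that every normalized block basis has a subsequence whose
  convex combinations have norm close to 1.  Applied to differences of vectors at distance almost 2,
  this and Galvin's lemma for alternating signs give a subsequence with arbitrary signs, that is, \<open>\<ell>\<^sub>1\<close>.
\<close>

section \<open>Schauder bases and their basis constant\<close>

text \<open>The negated conclusion is hereditary: sums, averages and differences of blocks are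
  blocks again, so the alternative "limit at most 1 or limit 2" can be used again at every stage.
  Each use doubles the number of summands at the price of a subsequence and a small error, which
  yields vectors of norm about 1 built from \<open>2^n\<close> members for each fixed
  \<open>n\<close>. What is needed, however, concerns finite sets of unbounded size: bounded sums
  over all of them for \<open>c0\<close>, small weight on all sets with a lower estimate for
  \<open>ell1\<close>. The finite sets that have not met a bar form a well-founded tree of possibly
  infinite rank; bar induction carries the doubling along this tree, with a diagonal sequence at
  each node. Galvin's lemma then passes from the initial segments of one infinite set to all finite
  subsets of an infinite set. For \<open>ell1\<close> the estimate for differences must have a
  constant close to 2: making the two coefficients of a difference unequal can cost almost 2, and
  something has to remain.\<close>

definition basic_with :: "real \<Rightarrow> (nat \<Rightarrow> 'a::real_normed_vector) \<Rightarrow> bool" where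
  "basic_with K x \<longleftrightarrow> (\<forall>i. x i \<noteq> 0) \<and>
     (\<forall>(a :: nat \<Rightarrow> real) m n. m \<le> n \<longrightarrow>
        norm (\<Sum>i<m. a i *\<^sub>R x i) \<le> K * norm (\<Sum>i<n. a i *\<^sub>R x i))"

lemma Baire_closed_cover:
  fixes F :: "nat \<Rightarrow> 'a::banach set"
  assumes "\<And>m. closed (F m)" "(\<Union>m. F m) = UNIV"
  shows "\<exists>m. interior (F m) \<noteq> {}"
proof (rule ccontr)
  assume "\<nexists>m. interior (F m) \<noteq> {}"
  then have "(euclidean :: 'a topology) interior_of \<Union>(range F) = {}"
    using assms(1) Met_TC.completely_metrizable_space_mtopology[where ?'a = 'a]
    by (intro Baire_category_alt disjI1) auto
  then show False
    using assms(2) by simp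
qed

context
  fixes e :: "nat \<Rightarrow> 'a::banach"
  assumes e: "schauder_basis e"
begin

definition basis_coeff :: "'a \<Rightarrow> nat \<Rightarrow> real" where
  "basis_coeff x = (THE a. (\<lambda>n. a n *\<^sub>R e n) sums x)"

lemma basis_coeff_ex1: "\<exists>!a :: nat \<Rightarrow> real. (\<lambda>n. a n *\<^sub>R e n) sums x"
  using e unfolding schauder_basis_def schauder_basis_of_def by auto

lemma basis_coeff_sums: "(\<lambda>n. basis_coeff x n *\<^sub>R e n) sums x"
  unfolding basis_coeff_def by (rule theI'[OF basis_coeff_ex1])

lemma basis_coeff_eqI: "(\<lambda>n. a n *\<^sub>R e n) sums x \<Longrightarrow> basis_coeff x = a"
  using basis_coeff_ex1 basis_coeff_sums by blast

lemma basis_nonzero: "e i \<noteq> 0"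
proof
  assume "e i = 0"
  then have "(\<lambda>n. (if n = i then 1 else 0 :: real) *\<^sub>R e n) = (\<lambda>n. 0)" by auto
  then have "basis_coeff 0 = (\<lambda>n. if n = i then 1 else 0)"
    by (intro basis_coeff_eqI) simp
  moreover have "basis_coeff 0 = (\<lambda>n. 0)"
    by (intro basis_coeff_eqI) simp
  ultimately show False
    by (metis zero_neq_one)
qed

lemma basis_coeff_diff: "basis_coeff (x - y) = (\<lambda>n. basis_coeff x n - basis_coeff y n)"
  using sums_diff[OF basis_coeff_sums basis_coeff_sums]
  by (intro basis_coeff_eqI) (simp add: algebra_simps)

lemma basis_coeff_scale: "basis_coeff (c *\<^sub>R x) = (\<lambda>n. c * basis_coeff x n)"
  using sums_scaleR_right[OF basis_coeff_sums, of c]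
  by (intro basis_coeff_eqI) simp

definition basis_proj :: "nat \<Rightarrow> 'a \<Rightarrow> 'a" where
  "basis_proj n x = (\<Sum>i<n. basis_coeff x i *\<^sub>R e i)"

lemma basis_proj_diff: "basis_proj n (x - y) = basis_proj n x - basis_proj n y"
  by (simp add: basis_proj_def basis_coeff_diff algebra_simps sum_subtractf)

lemma basis_proj_scale: "basis_proj n (c *\<^sub>R x) = c *\<^sub>R basis_proj n x"
  by (simp add: basis_proj_def basis_coeff_scale scaleR_sum_right)

lemma basis_proj_tendsto: "(\<lambda>n. basis_proj n x) \<longlonglongrightarrow> x"
  using basis_coeff_sums unfolding sums_def basis_proj_def .

text \<open>Baire category for the closures of the sets \<open>A m\<close> on which all projections
  are bounded by \<open>m\<close>: one closure contains a ball, and differences of elements of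
  \<open>A m\<close> move this ball to the origin. Only approximants \<open>z\<close> of
  \<open>y\<close> are controlled, because \<open>A m\<close> is not known to be closed before the
  projections are known to be continuous.\<close>

lemma basis_approx:
  "\<exists>C>0. \<forall>y. \<forall>\<delta>>0. \<exists>z. norm (y - z) < \<delta> \<and> (\<forall>n. norm (basis_proj n z) \<le> C * norm y)"
proof -
  define A where "A = (\<lambda>m::nat. {x. \<forall>n. norm (basis_proj n x) \<le> real m})"
  have "(\<Union>m. closure (A m)) = UNIV"
  proof -
    have "\<exists>m. x \<in> A m" for x
    proof -
      have "Bseq (\<lambda>n. basis_proj n x)"
        using basis_proj_tendsto by (intro convergent_imp_Bseq convergentI)
      then obtain B where "\<And>n. norm (basis_proj n x) \<le> B" unfolding Bseq_def by auto
      moreover obtain m :: nat where "B \<le> real m" using real_arch_simple by blast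
      ultimately show ?thesis unfolding A_def by (auto intro: order_trans)
    qed
    then have "x \<in> (\<Union>m. closure (A m))" for x
      using subsetD[OF closure_subset] by (metis UN_I UNIV_I)
    then show ?thesis by auto
  qed
  then obtain m where "interior (closure (A m)) \<noteq> {}"
    using Baire_closed_cover[of "\<lambda>m. closure (A m)"] by auto
  then obtain x0 r where r: "r > 0" "ball x0 r \<subseteq> closure (A m)"
    by (metis all_not_in_conv mem_interior)
  have approx: "\<exists>z. norm (y - z) < \<delta> \<and> (\<forall>n. norm (basis_proj n z) \<le> 2 * real m)"
    if y: "norm y < r" and \<delta>: "\<delta> > 0" for y \<delta>
  proof -
    have "x0 + y \<in> closure (A m)" "x0 \<in> closure (A m)"
      using r y by (auto simp: dist_norm subset_iff)
    then obtain u v where uv: "u \<in> A m" "dist u (x0 + y) < \<delta>/2" "v \<in> A m" "dist v x0 < \<delta>/2"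
      unfolding closure_approachable using \<delta> half_gt_zero by metis
    have "y - (u - v) = (v - x0) - (u - (x0 + y))" by simp
    then have "norm (y - (u - v)) \<le> norm (v - x0) + norm (u - (x0 + y))"
      by (metis norm_triangle_ineq4)
    also have "\<dots> < \<delta>" using uv by (simp add: dist_norm)
    finally have "norm (y - (u - v)) < \<delta>" .
    moreover have "norm (basis_proj n (u - v)) \<le> 2 * real m" for n
    proof -
      have "norm (basis_proj n u) \<le> real m" "norm (basis_proj n v) \<le> real m"
        using uv unfolding A_def by auto
      then show ?thesis
        using norm_triangle_ineq4[of "basis_proj n u" "basis_proj n v"]
        unfolding basis_proj_diff by linarith
    qed
    ultimately show ?thesis by blast
  qed
  \<comment> \<open>A vector is rescaled to norm \<open>r / 2\<close>, which accounts for
    \<open>2 / r\<close>; \<open>m + 1\<close> in place of \<open>m\<close> makes \<open>C\<close>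
    positive also when \<open>m = 0\<close>.\<close>
  define C where "C = 2 * (real m + 1) * (2 / r)"
  have "\<exists>z. norm (y - z) < \<delta> \<and> (\<forall>n. norm (basis_proj n z) \<le> C * norm y)"
    if \<delta>: "\<delta> > 0" for y \<delta>
  proof (cases "y = 0")
    case True
    then show ?thesis using \<delta> basis_proj_diff[of _ 0 0] by (intro exI[of _ 0]) auto
  next
    case False
    define t where "t = r / (2 * norm y)"
    have t: "t > 0" using r False unfolding t_def by simp
    have "norm (t *\<^sub>R y) = r / 2" unfolding t_def using r False by simp
    then obtain z where z: "norm (t *\<^sub>R y - z) < t * \<delta>" "\<And>n. norm (basis_proj n z) \<le> 2 * real m"
      using approx[of "t *\<^sub>R y" "t * \<delta>"] r t \<delta> by auto
    have "norm (y - (1/t) *\<^sub>R z) = norm ((1/t) *\<^sub>R (t *\<^sub>R y - z))"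
      using t by (simp add: algebra_simps)
    also have "\<dots> = (1/t) * norm (t *\<^sub>R y - z)" using t by simp
    also have "\<dots> < \<delta>" using z t by (simp add: field_simps)
    finally have 1: "norm (y - (1/t) *\<^sub>R z) < \<delta>" .
    have "norm (basis_proj n ((1/t) *\<^sub>R z)) \<le> C * norm y" for n
    proof -
      have "norm (basis_proj n ((1/t) *\<^sub>R z)) = (1/t) * norm (basis_proj n z)"
        using t by (simp add: basis_proj_scale)
      also have "\<dots> \<le> (1/t) * (2 * (real m + 1))"
        using z(2)[of n] t by (intro mult_left_mono) auto
      also have "\<dots> = C * norm y" unfolding C_def t_def using r False by simp
      finally show ?thesis .
    qed
    with 1 show ?thesis by blast
  qed
  moreover have "C > 0" unfolding C_def using r by simp
  ultimately show ?thesis by blast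
qed

text \<open>The successive-approximation step of the open mapping theorem: the given vector is a series
  of vectors whose basis projections are geometrically small, so its expansion is the sum of
  theirs.\<close>

lemma basis_proj_bounded: "\<exists>C>0. \<forall>n x. norm (basis_proj n x) \<le> C * norm x"
proof -
  obtain C where C: "C > 0"
    "\<And>y \<delta>. \<delta> > 0 \<Longrightarrow> \<exists>z. norm (y - z) < \<delta> \<and> (\<forall>n. norm (basis_proj n z) \<le> C * norm y)"
    using basis_approx by metis
  have unit: "norm (basis_proj n x) \<le> 2 * C" if x: "norm x = 1" for n x
  proof -
    define f where "f = (\<lambda>k y. SOME z. norm (y - z) < (1/2)^Suc k \<and>
      (\<forall>n. norm (basis_proj n z) \<le> C * norm y))"
    have f: "norm (y - f k y) < (1/2)^Suc k" "norm (basis_proj n (f k y)) \<le> C * norm y" for k y n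
      using someI_ex[OF C(2)[of "(1/2)^Suc k" y]] unfolding f_def by auto
    define R where "R = rec_nat x (\<lambda>k y. y - f k y)"
    have R0: "R 0 = x" and RS: "R (Suc k) = R k - f k (R k)" for k
      unfolding R_def by auto
    have Rn: "norm (R k) \<le> (1/2)^k" for k
      using x f(1)[of "R (k-1)" "k-1"] by (cases k) (auto simp: R0 RS less_imp_le)
    define z where "z k = f k (R k)" for k
    have zP: "norm (basis_proj n (z k)) \<le> C * (1/2)^k" for n k
      using f(2)[where n=n and k=k and y="R k"] Rn[of k] C(1)
      unfolding z_def by (meson mult_left_mono order_trans less_imp_le)
    have geo: "(\<lambda>k. C * (1/2)^k) sums (2 * C)"
      using sums_mult[OF geometric_sums[of "1/2::real"], of C] by (simp add: mult.commute[of 2 C])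
    have Pz_summable: "summable (\<lambda>k. basis_proj n (z k))" for n
      using zP by (intro summable_comparison_test[OF _ sums_summable[OF geo]]) blast
    have "(\<lambda>k. R k - R (Suc k)) sums (R 0 - 0)"
    proof (rule telescope_sums')
      show "R \<longlonglongrightarrow> 0"
        by (rule Lim_null_comparison[OF always_eventually[OF allI[OF Rn]]])
           (intro LIMSEQ_power_zero, simp)
    qed
    moreover have "z = (\<lambda>k. R k - R (Suc k))" by (simp add: RS z_def fun_eq_iff)
    ultimately have z_sums: "z sums x" by (simp add: R0)
    define b where "b i = (\<Sum>k. basis_coeff (z k) i)" for i
    have coeff_summable: "summable (\<lambda>k. basis_coeff (z k) i)" for i
    proof (rule summable_comparison_test[of _ "\<lambda>k. 2 * C * (1/2)^k / norm (e i)"])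
      have "norm (basis_coeff (z k) i) \<le> 2 * C * (1/2)^k / norm (e i)" for k
      proof -
        have "norm (basis_coeff (z k) i) * norm (e i) = norm (basis_coeff (z k) i *\<^sub>R e i)" by simp
        also have "basis_coeff (z k) i *\<^sub>R e i = basis_proj (Suc i) (z k) - basis_proj i (z k)"
          unfolding basis_proj_def by simp
        also have "norm \<dots> \<le> 2 * (C * (1/2)^k)"
          using norm_triangle_ineq4[of "basis_proj (Suc i) (z k)" "basis_proj i (z k)"]
            zP[of "Suc i" k] zP[of i k] by linarith
        finally show ?thesis using basis_nonzero[of i] by (simp add: field_simps)
      qed
      then show "\<exists>N. \<forall>k\<ge>N. norm (basis_coeff (z k) i) \<le> 2 * C * (1/2)^k / norm (e i)" by blast
      show "summable (\<lambda>k. 2 * C * (1/2)^k / norm (e i))"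
        by (intro summable_divide summable_mult summable_geometric) simp
    qed
    have bP: "(\<Sum>i<n. b i *\<^sub>R e i) = (\<Sum>k. basis_proj n (z k))" for n
    proof -
      have "(\<Sum>k. basis_proj n (z k)) = (\<Sum>i<n. \<Sum>k. basis_coeff (z k) i *\<^sub>R e i)"
        unfolding basis_proj_def
        by (intro suminf_sum summable_scaleR_left coeff_summable)
      also have "\<dots> = (\<Sum>i<n. b i *\<^sub>R e i)"
        unfolding b_def by (simp add: suminf_scaleR_left[OF coeff_summable])
      finally show ?thesis by simp
    qed
    \<comment> \<open>The geometric bound does not depend on \<open>n\<close>, so the limits over
      \<open>N\<close> and \<open>n\<close> may be exchanged. Hence the coefficients
      \<open>b\<close> expand \<open>x\<close>, and uniqueness of the expansion identifies them with
      \<open>basis_coeff x\<close>.\<close>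
    have "uniform_limit UNIV (\<lambda>N n. \<Sum>k<N. basis_proj n (z k)) (\<lambda>n. \<Sum>k. basis_proj n (z k)) sequentially"
      by (rule Weierstrass_m_test[OF zP sums_summable[OF geo]])
    then have "(\<lambda>n. \<Sum>k. basis_proj n (z k)) \<longlonglongrightarrow> x"
      using z_sums unfolding sums_def
      by (rule_tac swap_uniform_limit'[where f = "\<lambda>N n. \<Sum>k<N. basis_proj n (z k)"])
        (auto intro!: tendsto_sum basis_proj_tendsto always_eventually)
    then have "(\<lambda>n. b n *\<^sub>R e n) sums x"
      using z_sums unfolding sums_def[of "\<lambda>n. b n *\<^sub>R e n"] bP by simp
    then have "basis_proj n x = (\<Sum>k. basis_proj n (z k))"
      unfolding bP[symmetric] by (simp add: basis_proj_def[of n x] basis_coeff_eqI)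
    also have "norm \<dots> \<le> (\<Sum>k. C * (1/2)^k)"
      by (rule norm_suminf_le[OF zP sums_summable[OF geo]])
    also have "\<dots> = 2 * C" using geo by (simp add: sums_iff)
    finally show ?thesis .
  qed
  have "norm (basis_proj n x) \<le> (2 * C) * norm x" for n x
  proof (cases "x = 0")
    case True
    then show ?thesis using basis_proj_diff[of n 0 0] by simp
  next
    case False
    then have "norm (basis_proj n ((1 / norm x) *\<^sub>R x)) \<le> 2 * C" by (intro unit) simp
    then show ?thesis using False by (simp add: basis_proj_scale field_simps)
  qed
  then show ?thesis using C(1) by (intro exI[of _ "2*C"]) simp
qed

lemma schauder_basis_basic_with: "\<exists>K>0. basic_with K e"
proof -
  obtain C where C: "C > 0" "\<And>n x. norm (basis_proj n x) \<le> C * norm x"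
    using basis_proj_bounded by blast
  have "norm (\<Sum>i<m. a i *\<^sub>R e i) \<le> C * norm (\<Sum>i<n. a i *\<^sub>R e i)" if "m \<le> n"
    for a :: "nat \<Rightarrow> real" and m n
  proof -
    let ?b = "\<lambda>i. if i < n then a i else 0"
    have "(\<lambda>i. ?b i *\<^sub>R e i) sums (\<Sum>i<n. ?b i *\<^sub>R e i)"
      by (rule sums_finite) auto
    then have "basis_coeff (\<Sum>i<n. a i *\<^sub>R e i) = ?b"
      by (intro basis_coeff_eqI) simp
    then have "basis_proj m (\<Sum>i<n. a i *\<^sub>R e i) = (\<Sum>i<m. a i *\<^sub>R e i)"
      unfolding basis_proj_def using that by (intro sum.cong) auto
    then show ?thesis using C(2)[of m] by metis
  qed
  then show ?thesis using C(1) basis_nonzero unfolding basic_with_def by blast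
qed

end

section \<open>The basis inequality and expansions in the closed span\<close>

lemma basic_with_nonzero: "basic_with K x \<Longrightarrow> x i \<noteq> 0"
  unfolding basic_with_def by blast

lemma basic_with_le:
  "basic_with K x \<Longrightarrow> m \<le> n \<Longrightarrow> norm (\<Sum>i<m. a i *\<^sub>R x i) \<le> K * norm (\<Sum>i<n. a i *\<^sub>R x i)"
  unfolding basic_with_def by blast

lemma basic_with_ge_1:
  assumes "basic_with K x" shows "K \<ge> 1"
proof -
  have "norm (x 0) \<le> K * norm (x 0)"
    using basic_with_le[OF assms, of 1 1 "\<lambda>_. 1"] by simp
  then show ?thesis using basic_with_nonzero[OF assms, of 0] by simp
qed

lemma norm_scaleR_term_le:
  "\<bar>a i\<bar> * norm (x i) \<le> norm (\<Sum>j<Suc i. a j *\<^sub>R x j) + norm (\<Sum>j<i. a j *\<^sub>R x j)"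
  using norm_triangle_ineq4[of "\<Sum>j<Suc i. a j *\<^sub>R x j" "\<Sum>j<i. a j *\<^sub>R x j"] by simp

lemma basic_with_coeff_le:
  assumes "basic_with K x" "i < n"
  shows "\<bar>a i\<bar> * norm (x i) \<le> 2 * K * norm (\<Sum>j<n. a j *\<^sub>R x j)"
proof -
  have "\<bar>a i\<bar> * norm (x i) \<le> norm (\<Sum>j<Suc i. a j *\<^sub>R x j) + norm (\<Sum>j<i. a j *\<^sub>R x j)"
    by (rule norm_scaleR_term_le)
  also have "\<dots> \<le> 2 * K * norm (\<Sum>j<n. a j *\<^sub>R x j)"
    using basic_with_le[OF assms(1), of "Suc i" n a] basic_with_le[OF assms(1), of i n a] assms(2)
    by simp
  finally show ?thesis .
qed

text \<open>Demanding the value \<open>z\<close> for all \<open>m \<ge> n\<close>, and not for one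
  length only, lets two representations of different lengths be added or compared at a common
  length.\<close>

lemma span_range_seq_subset:
  fixes x :: "nat \<Rightarrow> 'a::real_vector"
  shows "span (range x) \<subseteq> {z. \<exists>c n. \<forall>m\<ge>n. (\<Sum>i<m. c i *\<^sub>R x i) = z}"
proof (rule span_minimal)
  show "range x \<subseteq> {z. \<exists>c n. \<forall>m\<ge>n. (\<Sum>i<m. c i *\<^sub>R x i) = z}"
  proof clarify
    fix k
    have "(\<Sum>i<m. (if i = k then 1 else 0 :: real) *\<^sub>R x i) = x k" if "m \<ge> Suc k" for m
      using that by (simp add: if_distrib[of "\<lambda>c. c *\<^sub>R _"] sum.delta cong: if_cong)
    then show "\<exists>c n. \<forall>m\<ge>n. (\<Sum>i<m. c i *\<^sub>R x i) = x k" by metis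
  qed
  show "subspace {z. \<exists>c n. \<forall>m\<ge>n. (\<Sum>i<m. c i *\<^sub>R x i) = z}"
  proof (rule subspaceI; clarify)
    show "\<exists>c n. \<forall>m\<ge>n. (\<Sum>i<m. c i *\<^sub>R x i) = 0"
      by (rule exI[of _ "\<lambda>_. 0"]) simp
  next
    fix y z c n d k
    assume "\<forall>m\<ge>n. (\<Sum>i<m. c i *\<^sub>R x i) = y" "\<forall>m\<ge>k. (\<Sum>i<m. d i *\<^sub>R x i) = z"
    then have "\<forall>m\<ge>max n k. (\<Sum>i<m. (c i + d i) *\<^sub>R x i) = y + z"
      by (simp add: scaleR_add_left sum.distrib)
    then show "\<exists>c n. \<forall>m\<ge>n. (\<Sum>i<m. c i *\<^sub>R x i) = y + z"
      by (intro exI[of _ "\<lambda>i. c i + d i"] exI[of _ "max n k"])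
  next
    fix r y c n
    assume "\<forall>m\<ge>n. (\<Sum>i<m. c i *\<^sub>R x i) = y"
    then have "\<forall>m\<ge>n. (\<Sum>i<m. (r * c i) *\<^sub>R x i) = r *\<^sub>R y"
      by (auto simp: scaleR_sum_right)
    then show "\<exists>c n. \<forall>m\<ge>n. (\<Sum>i<m. c i *\<^sub>R x i) = r *\<^sub>R y" by metis
  qed
qed

lemma basic_with_sums_unique:
  fixes x :: "nat \<Rightarrow> 'a::real_normed_vector"
  assumes x: "basic_with K x" and a: "(\<lambda>n. a n *\<^sub>R x n) sums y" and b: "(\<lambda>n. b n *\<^sub>R x n) sums y"
  shows "a = b"
proof
  fix i
  let ?d = "\<lambda>i. a i - b i"
  have "(\<lambda>n. ?d n *\<^sub>R x n) sums 0"
    using sums_diff[OF a b] by (simp add: scaleR_diff_left)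
  then have "(\<lambda>n. 2 * K * norm (\<Sum>j<n. ?d j *\<^sub>R x j)) \<longlonglongrightarrow> 2 * K * norm (0::'a)"
    unfolding sums_def by (intro tendsto_intros)
  moreover have "\<forall>n\<ge>Suc i. \<bar>?d i\<bar> * norm (x i) \<le> 2 * K * norm (\<Sum>j<n. ?d j *\<^sub>R x j)"
    using basic_with_coeff_le[OF x, of i _ ?d] by auto
  ultimately have "\<bar>?d i\<bar> * norm (x i) \<le> 0"
    using LIMSEQ_le_const by (metis (no_types, lifting) mult_zero_right norm_zero)
  then show "a i = b i"
    using basic_with_nonzero[OF x, of i] by (simp add: mult_le_0_iff)
qed

text \<open>By the basis inequality the coefficients of approximants \<open>Y k\<close> from the
  span form Cauchy sequences. The resulting estimate for partial sums,
  \<open>K * norm (Y k - y)\<close>, is uniform in their length, so the limit coefficients expand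
  \<open>y\<close>.\<close>

lemma basic_with_expansion_exists:
  fixes x :: "nat \<Rightarrow> 'a::banach"
  assumes x: "basic_with K x" and y: "y \<in> closure (span (range x))"
  shows "\<exists>a :: nat \<Rightarrow> real. (\<lambda>n. a n *\<^sub>R x n) sums y"
proof -
  have "\<exists>c n. dist (\<Sum>i<n. c i *\<^sub>R x i) y < 1 / real (Suc k) \<and>
      (\<forall>m\<ge>n. (\<Sum>i<m. c i *\<^sub>R x i) = (\<Sum>i<n. c i *\<^sub>R x i))" for k
  proof -
    have "1 / real (Suc k) > 0" by simp
    then obtain z where z: "z \<in> span (range x)" "dist z y < 1 / real (Suc k)"
      using y unfolding closure_approachable by blast
    then obtain c n where "\<forall>m\<ge>n. (\<Sum>i<m. c i *\<^sub>R x i) = z"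
      using span_range_seq_subset[of x] by blast
    with z(2) show ?thesis by (intro exI[of _ c] exI[of _ n]) auto
  qed
  then obtain c N where c: "\<And>k. dist (\<Sum>i<N k. c k i *\<^sub>R x i) y < 1 / real (Suc k)"
    "\<And>k m. m \<ge> N k \<Longrightarrow> (\<Sum>i<m. c k i *\<^sub>R x i) = (\<Sum>i<N k. c k i *\<^sub>R x i)"
    by metis
  define Y where "Y k = (\<Sum>i<N k. c k i *\<^sub>R x i)" for k
  have Y: "Y \<longlonglongrightarrow> y"
  proof (rule LIMSEQ_I)
    fix r :: real assume "r > 0"
    then obtain n where "1 / real (Suc n) < r" using nat_approx_posE by blast
    moreover have "norm (Y k - y) < 1 / real (Suc n)" if "k \<ge> n" for k
      using c(1)[of k] that unfolding Y_def dist_norm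
      by (smt (verit) frac_le of_nat_0_less_iff of_nat_le_iff zero_less_Suc Suc_le_mono)
    ultimately show "\<exists>n. \<forall>k\<ge>n. norm (Y k - y) < r" by (meson order_less_trans)
  qed
  have diff: "norm (\<Sum>i<n. (c k i - c l i) *\<^sub>R x i) \<le> K * norm (Y k - Y l)" for n k l
  proof -
    let ?m = "max n (max (N k) (N l))"
    have "norm (\<Sum>i<n. (c k i - c l i) *\<^sub>R x i) \<le> K * norm (\<Sum>i<?m. (c k i - c l i) *\<^sub>R x i)"
      by (rule basic_with_le[OF x]) simp
    also have "(\<Sum>i<?m. (c k i - c l i) *\<^sub>R x i) = Y k - Y l"
      using c(2)[of k ?m] c(2)[of l ?m] unfolding Y_def
      by (simp add: scaleR_diff_left sum_subtractf)
    finally show ?thesis .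
  qed
  have "Cauchy (\<lambda>k. c k i)" for i
  proof (rule CauchyI)
    fix r :: real assume r: "r > 0"
    have K: "K > 0" using basic_with_ge_1[OF x] by simp
    have xi: "norm (x i) > 0" using basic_with_nonzero[OF x] by simp
    have "Cauchy Y" using Y by (rule LIMSEQ_imp_Cauchy)
    then obtain M where M: "\<forall>m\<ge>M. \<forall>n\<ge>M. norm (Y m - Y n) < r * norm (x i) / (2 * K)"
      using r K xi by (meson CauchyD divide_pos_pos mult_pos_pos zero_less_numeral)
    have "norm (c m i - c n i) < r" if "m \<ge> M" "n \<ge> M" for m n
    proof -
      have "norm (c m i - c n i) * norm (x i) \<le>
          norm (\<Sum>j<Suc i. (c m j - c n j) *\<^sub>R x j) + norm (\<Sum>j<i. (c m j - c n j) *\<^sub>R x j)"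
        using norm_scaleR_term_le[of "\<lambda>j. c m j - c n j" i x] by simp
      also have "\<dots> \<le> 2 * K * norm (Y m - Y n)"
        using diff[of m n "Suc i"] diff[of m n i] by simp
      also have "\<dots> < r * norm (x i)"
        using M that K by (simp add: field_simps)
      finally show ?thesis using xi by simp
    qed
    then show "\<exists>M. \<forall>m\<ge>M. \<forall>n\<ge>M. norm (c m i - c n i) < r" by blast
  qed
  then have "\<exists>l. (\<lambda>k. c k i) \<longlonglongrightarrow> l" for i
    unfolding convergent_def[symmetric] by (rule Cauchy_convergent)
  then obtain a where a: "\<And>i. (\<lambda>k. c k i) \<longlonglongrightarrow> a i"
    by metis
  have bound: "norm ((\<Sum>i<n. c k i *\<^sub>R x i) - (\<Sum>i<n. a i *\<^sub>R x i)) \<le> K * norm (Y k - y)" for k n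
  proof (rule tendsto_le[OF sequentially_bot])
    show "(\<lambda>l. K * norm (Y k - Y l)) \<longlonglongrightarrow> K * norm (Y k - y)"
      by (intro tendsto_intros Y)
    show "(\<lambda>l. norm ((\<Sum>i<n. c k i *\<^sub>R x i) - (\<Sum>i<n. c l i *\<^sub>R x i))) \<longlonglongrightarrow>
        norm ((\<Sum>i<n. c k i *\<^sub>R x i) - (\<Sum>i<n. a i *\<^sub>R x i))"
      by (intro tendsto_intros a)
    show "\<forall>\<^sub>F l in sequentially. norm ((\<Sum>i<n. c k i *\<^sub>R x i) - (\<Sum>i<n. c l i *\<^sub>R x i)) \<le> K * norm (Y k - Y l)"
      using diff[of k _ n] by (intro always_eventually allI) (simp add: scaleR_diff_left sum_subtractf)
  qed
  have "uniform_limit UNIV (\<lambda>k n. \<Sum>i<n. c k i *\<^sub>R x i) (\<lambda>n. \<Sum>i<n. a i *\<^sub>R x i) sequentially"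
  proof (rule uniform_limitI)
    fix r :: real assume "r > 0"
    have "(\<lambda>k. K * norm (Y k - y)) \<longlonglongrightarrow> K * norm (y - y)"
      by (intro tendsto_intros Y)
    then have "\<forall>\<^sub>F k in sequentially. K * norm (Y k - y) < r"
      using \<open>r > 0\<close> by (intro order_tendstoD) simp
    then show "\<forall>\<^sub>F k in sequentially. \<forall>n\<in>UNIV. dist (\<Sum>i<n. c k i *\<^sub>R x i) (\<Sum>i<n. a i *\<^sub>R x i) < r"
    proof eventually_elim
      case (elim k)
      then show ?case using order_le_less_trans[OF bound] by (simp add: dist_norm)
    qed
  qed
  moreover have "(\<lambda>n. \<Sum>i<n. c k i *\<^sub>R x i) \<longlonglongrightarrow> Y k" for k
    unfolding Y_def
    by (rule tendsto_eventually[OF eventually_sequentiallyI[of "N k"]]) (rule c(2))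
  ultimately have "(\<lambda>n. \<Sum>i<n. a i *\<^sub>R x i) \<longlonglongrightarrow> y"
    by (intro swap_uniform_limit'[OF _ Y, of "\<lambda>k n. \<Sum>i<n. c k i *\<^sub>R x i" sequentially UNIV])
      (simp_all add: always_eventually)
  then show ?thesis unfolding sums_def by blast
qed

text \<open>Grunblum's criterion. With \<open>schauder_basis_basic_with\<close> for the given basis,
  it replaces expansions by an inequality between finite sums, which passes to block bases and to
  limits of norms.\<close>

lemma basic_with_imp_basic_sequence:
  fixes x :: "nat \<Rightarrow> 'a::banach"
  assumes "basic_with K x"
  shows "basic_sequence x"
proof -
  have "range x \<subseteq> closure (span (range x))"
    using closure_subset span_superset by (rule order_trans[rotated])
  then show ?thesis
    unfolding basic_sequence_def schauder_basis_of_def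
    using basic_with_expansion_exists[OF assms] basic_with_sums_unique[OF assms] by blast
qed

section \<open>Successive finite supports and block bases\<close>

definition successive :: "(nat \<Rightarrow> nat set) \<Rightarrow> bool" where
  "successive S \<longleftrightarrow> (\<forall>k. finite (S k)) \<and> (\<forall>k l. k < l \<longrightarrow> (\<forall>i\<in>S k. \<forall>j\<in>S l. i < j))"

lemma successive_finite: "successive S \<Longrightarrow> finite (S k)"
  unfolding successive_def by blast

lemma successive_less: "successive S \<Longrightarrow> k < l \<Longrightarrow> i \<in> S k \<Longrightarrow> j \<in> S l \<Longrightarrow> i < j"
  unfolding successive_def by blast

lemma successive_disjoint: "successive S \<Longrightarrow> k \<noteq> l \<Longrightarrow> S k \<inter> S l = {}"
  using successive_less by (metis disjoint_iff linorder_neqE_nat order_less_irrefl)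

lemma successive_subseq: "successive S \<Longrightarrow> strict_mono r \<Longrightarrow> successive (S \<circ> r)"
  unfolding successive_def strict_mono_def comp_def by blast

lemma successive_UN:
  assumes "successive S" "successive T"
  shows "successive (\<lambda>k. \<Union>j\<in>T k. S j)"
  unfolding successive_def
proof (intro conjI allI impI ballI)
  show "finite (\<Union>j\<in>T k. S j)" for k
    using assms successive_finite by blast
  fix k l i j assume "k < l" "i \<in> (\<Union>j\<in>T k. S j)" "j \<in> (\<Union>j\<in>T l. S j)"
  then show "i < j"
    using successive_less[OF assms(1)] successive_less[OF assms(2)] by blast
qed

text \<open>A block basis has adjacent index intervals, while supports arising in constructions
  leave gaps. The intervals run from the least element of one support to that of the next, with
  scalar 0 in the gaps.\<close>

lemma block_basisI:
  fixes e :: "nat \<Rightarrow> 'a::real_normed_vector"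
  assumes S: "successive S" and x: "\<And>k. x k = (\<Sum>i\<in>S k. c k i *\<^sub>R e i)" and nz: "\<And>k. x k \<noteq> 0"
  shows "block_basis e x"
proof -
  have ne: "S k \<noteq> {}" for k using nz[of k] x[of k] by auto
  note fin = successive_finite[OF S]
  define p where "p k = Min (S k)" for k
  have pin: "p k \<in> S k" for k unfolding p_def using fin ne by simp
  have p: "strict_mono p"
    by (rule strict_monoI) (use successive_less[OF S] pin in blast)
  have sub: "S k \<subseteq> {p k..<p (Suc k)}" for k
    using successive_less[OF S, of k "Suc k"] pin[of "Suc k"] fin[of k] by (auto simp: p_def)
  define a where "a i = (if \<exists>k. i \<in> S k then c (THE k. i \<in> S k) i else 0)" for i
  have a: "a i = c k i" if "i \<in> S k" for i k
  proof -
    have "(THE k. i \<in> S k) = k"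
      using that successive_disjoint[OF S] by (intro the_equality) blast+
    then show ?thesis unfolding a_def using that by auto
  qed
  have a0: "a i = 0" if "i \<in> {p k..<p (Suc k)} - S k" for i k
  proof -
    have "i \<notin> S l" for l
    proof
      assume i: "i \<in> S l"
      consider "l < k" | "l = k" | "l \<ge> Suc k" by linarith
      then show False
      proof cases
        case 1
        then show ?thesis using successive_less[OF S 1 i pin] that by auto
      next
        case 2
        then show ?thesis using that i by blast
      next
        case 3
        then have "p (Suc k) \<le> p l" using p by (simp add: strict_mono_less_eq)
        also have "p l \<le> i" unfolding p_def using fin i by simp
        finally show ?thesis using that by simp
      qed
    qed
    then show ?thesis unfolding a_def by auto
  qed
  have "x k = (\<Sum>i\<in>{p k..<p (Suc k)}. a i *\<^sub>R e i)" for k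
  proof -
    have "x k = (\<Sum>i\<in>S k. a i *\<^sub>R e i)" unfolding x by (intro sum.cong) (auto simp: a)
    also have "\<dots> = (\<Sum>i\<in>{p k..<p (Suc k)}. a i *\<^sub>R e i)"
      using sub a0 by (intro sum.mono_neutral_left) auto
    finally show ?thesis .
  qed
  then show ?thesis unfolding block_basis_def using p nz by blast
qed

text \<open>The source of heredity: hypotheses on all normalized block bases of \<open>e\<close> can
  be applied to sequences formed from blocks of a block basis.\<close>

lemma block_basis_blocks:
  assumes ex: "block_basis e x" and S: "successive S" and y: "\<And>k. y k = (\<Sum>j\<in>S k. d k j *\<^sub>R x j)"
    and nz: "\<And>k. y k \<noteq> 0"
  shows "block_basis e y"
proof -
  obtain p a where p: "strict_mono p" and x: "\<And>k. x k = (\<Sum>i\<in>{p k..<p (Suc k)}. a i *\<^sub>R e i)"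
    using ex unfolding block_basis_def by blast
  define T where "T k = {p k..<p (Suc k)}" for k
  have T: "successive T"
    unfolding successive_def
  proof (intro conjI allI impI ballI)
    fix k l i j assume "k < l" "i \<in> T k" "j \<in> T l"
    moreover from \<open>k < l\<close> have "p (Suc k) \<le> p l" using p by (simp add: strict_mono_less_eq)
    ultimately show "i < j" by (simp add: T_def)
  qed (simp add: T_def)
  define c where "c k i = d k (THE j. i \<in> T j) * a i" for k i
  have The: "(THE j. i \<in> T j) = j" if "i \<in> T j" for i j
    using that successive_disjoint[OF T] by (intro the_equality) blast+
  have "y k = (\<Sum>i\<in>(\<Union>j\<in>S k. T j). c k i *\<^sub>R e i)" for k
  proof -
    have "(\<Sum>i\<in>(\<Union>j\<in>S k. T j). c k i *\<^sub>R e i) = (\<Sum>j\<in>S k. \<Sum>i\<in>T j. c k i *\<^sub>R e i)"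
    proof (rule sum.UNION_disjoint)
      show "\<forall>j\<in>S k. \<forall>l\<in>S k. j \<noteq> l \<longrightarrow> T j \<inter> T l = {}"
        using successive_disjoint[OF T] by blast
    qed (simp_all add: T_def successive_finite[OF S])
    also have "\<dots> = (\<Sum>j\<in>S k. d k j *\<^sub>R x j)"
    proof (rule sum.cong[OF refl])
      fix j
      have "(\<Sum>i\<in>T j. c k i *\<^sub>R e i) = (\<Sum>i\<in>T j. d k j *\<^sub>R a i *\<^sub>R e i)"
        by (intro sum.cong refl) (simp add: c_def The)
      then show "(\<Sum>i\<in>T j. c k i *\<^sub>R e i) = d k j *\<^sub>R x j"
        unfolding x T_def by (simp add: scaleR_sum_right)
    qed
    finally show ?thesis using y by simp
  qed
  with nz show ?thesis
    by (intro block_basisI[OF successive_UN[OF T S]]) auto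
qed

lemma block_basis_subseq:
  assumes "block_basis e x" "strict_mono r"
  shows "block_basis e (x \<circ> r)"
proof (rule block_basis_blocks[OF assms(1), where S = "\<lambda>k. {r k}" and d = "\<lambda>_ _. 1"])
  show "successive (\<lambda>k. {r k})"
    using assms(2) unfolding successive_def strict_mono_def by simp
  show "(x \<circ> r) k \<noteq> 0" for k
    using assms(1) unfolding block_basis_def by auto
qed simp

lemma block_basis_nonzero: "block_basis e x \<Longrightarrow> x k \<noteq> 0"
  unfolding block_basis_def by blast

lemma block_basis_self:
  assumes "\<And>i. e i \<noteq> 0" shows "block_basis e e"
  using assms by (intro block_basisI[where S = "\<lambda>k. {k}" and c = "\<lambda>_ _. 1"]) (auto simp: successive_def)

text \<open>An initial part of a combination of blocks is an initial part of the corresponding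
  combination of \<open>e\<close>. Thus one constant \<open>K\<close> serves for all block
  bases.\<close>

lemma basic_with_block_basis:
  assumes e: "basic_with K e" and x: "block_basis e x"
  shows "basic_with K x"
  unfolding basic_with_def
proof (intro conjI allI impI)
  show "x i \<noteq> 0" for i using x by (rule block_basis_nonzero)
  fix b :: "nat \<Rightarrow> real" and m n :: nat
  assume "m \<le> n"
  obtain p a where p: "strict_mono p" and x: "\<And>k. x k = (\<Sum>i\<in>{p k..<p (Suc k)}. a i *\<^sub>R e i)"
    using x unfolding block_basis_def by blast
  define T where "T k = {p k..<p (Suc k)}" for k
  have pm: "p i \<le> p j" if "i \<le> j" for i j using p that by (simp add: strict_mono_less_eq)
  have disj: "T k \<inter> T l = {}" if "k \<noteq> l" for k l
    using that pm[of "Suc k" l] pm[of "Suc l" k] unfolding T_def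
    by (cases k l rule: linorder_cases) (fastforce simp: disjoint_iff)+
  define c where "c i = (if \<exists>k. i \<in> T k then b (THE k. i \<in> T k) * a i else 0)" for i
  have c: "c i = b k * a i" if "i \<in> T k" for i k
  proof -
    have "(THE k. i \<in> T k) = k" using that disj by (intro the_equality) blast+
    then show ?thesis unfolding c_def using that by auto
  qed
  have "(\<Sum>k<n. b k *\<^sub>R x k) = (\<Sum>i<p n. c i *\<^sub>R e i)" for n
  proof -
    have "(\<Sum>k<n. b k *\<^sub>R x k) = (\<Sum>k<n. \<Sum>i\<in>T k. c i *\<^sub>R e i)"
      unfolding x T_def[symmetric] scaleR_sum_right
      by (intro sum.cong refl) (simp add: c)
    also have "\<dots> = (\<Sum>i\<in>(\<Union>k<n. T k). c i *\<^sub>R e i)"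
    proof (rule sum.UNION_disjoint[symmetric])
      show "\<forall>k\<in>{..<n}. \<forall>l\<in>{..<n}. k \<noteq> l \<longrightarrow> T k \<inter> T l = {}" using disj by blast
    qed (simp_all add: T_def)
    also have "\<dots> = (\<Sum>i<p n. c i *\<^sub>R e i)"
    proof (rule sum.mono_neutral_left)
      show "(\<Union>k<n. T k) \<subseteq> {..<p n}"
        using pm by (force simp: T_def dest: Suc_leI)
      have "i \<notin> T k" if "i < p n" "i \<notin> (\<Union>k<n. T k)" for i k
        using that pm[of n k] unfolding T_def by (cases "k < n") auto
      then show "\<forall>i\<in>{..<p n} - (\<Union>k<n. T k). c i *\<^sub>R e i = 0"
        unfolding c_def by auto
    qed simp
    finally show ?thesis .
  qed
  then show "norm (\<Sum>i<m. b i *\<^sub>R x i) \<le> K * norm (\<Sum>i<n. b i *\<^sub>R x i)"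
    using basic_with_le[OF e pm[OF \<open>m \<le> n\<close>]] by simp
qed

section \<open>The Hahn--Banach theorem for finitely supported sequences\<close>

definition fin_supp :: "(nat \<Rightarrow> real) \<Rightarrow> bool" where
  "fin_supp v \<longleftrightarrow> finite {i. v i \<noteq> 0}"

lemma fin_supp_add: "fin_supp u \<Longrightarrow> fin_supp v \<Longrightarrow> fin_supp (\<lambda>i. u i + v i)"
  unfolding fin_supp_def
  by (rule finite_subset[of _ "{i. u i \<noteq> 0} \<union> {i. v i \<noteq> 0}"]) auto

lemma fin_supp_scale: "fin_supp v \<Longrightarrow> fin_supp (\<lambda>i. c * v i)"
  unfolding fin_supp_def by (rule finite_subset[of _ "{i. v i \<noteq> 0}"]) auto

lemma fin_supp_uminus: "fin_supp v \<Longrightarrow> fin_supp (\<lambda>i. - v i)"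
  using fin_supp_scale[of v "-1"] by simp

lemma fin_supp_zero [simp]: "fin_supp (\<lambda>_. 0)"
  by (simp add: fin_supp_def)

lemma fin_supp_restrict [simp]: "fin_supp (\<lambda>i. if i < n then v i else 0)"
  unfolding fin_supp_def by (rule finite_subset[of _ "{..<n}"]) auto

lemma fin_supp_delta [simp]: "fin_supp (\<lambda>i. if i = n then c else 0)"
  unfolding fin_supp_def by (rule finite_subset[of _ "{n}"]) auto

text \<open>Restricted to finitely supported vectors, since the functional of interest is a limit of
  norms of finite combinations and has no meaning elsewhere.\<close>

definition sublinear :: "((nat \<Rightarrow> real) \<Rightarrow> real) \<Rightarrow> bool" where
  "sublinear p \<longleftrightarrow>
     (\<forall>u v. fin_supp u \<longrightarrow> fin_supp v \<longrightarrow> p (\<lambda>i. u i + v i) \<le> p u + p v) \<and>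
     (\<forall>c\<ge>0. \<forall>v. fin_supp v \<longrightarrow> p (\<lambda>i. c * v i) = c * p v)"

lemma sublinear_add:
  "sublinear p \<Longrightarrow> fin_supp u \<Longrightarrow> fin_supp v \<Longrightarrow> p (\<lambda>i. u i + v i) \<le> p u + p v"
  unfolding sublinear_def by blast

lemma sublinear_scale: "sublinear p \<Longrightarrow> c \<ge> 0 \<Longrightarrow> fin_supp v \<Longrightarrow> p (\<lambda>i. c * v i) = c * p v"
  unfolding sublinear_def by blast

lemma sublinear_zero: "sublinear p \<Longrightarrow> p (\<lambda>_. 0) = 0"
  using sublinear_scale[of p 0 "\<lambda>_. 0"] by simp

lemma sublinear_uminus:
  assumes "sublinear p" "fin_supp v" shows "- p (\<lambda>i. - v i) \<le> p v"
  using sublinear_add[OF assms(1,2) fin_supp_uminus[OF assms(2)]] sublinear_zero[OF assms(1)] by simp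

text \<open>The largest sublinear functional below \<open>p\<close> that is linear on the line through \<open>w\<close> and takes
  the value \<open>p w\<close> at \<open>w\<close>; doing this for one vector after the other replaces the transfinite
  part of the Hahn--Banach theorem.\<close>

definition linearize :: "((nat \<Rightarrow> real) \<Rightarrow> real) \<Rightarrow> (nat \<Rightarrow> real) \<Rightarrow> (nat \<Rightarrow> real) \<Rightarrow> real" where
  "linearize p w v = (INF t\<in>{0..}. p (\<lambda>i. v i + t * w i) - t * p w)"

lemma linearize_bound:
  assumes p: "sublinear p" and w: "fin_supp w" and v: "fin_supp v" and t: "t \<ge> 0"
  shows "- p (\<lambda>i. - v i) \<le> p (\<lambda>i. v i + t * w i) - t * p w"
proof -
  have "t * p w = p (\<lambda>i. t * w i)" using sublinear_scale[OF p t w] by simp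
  also have "\<dots> \<le> p (\<lambda>i. v i + t * w i) + p (\<lambda>i. - v i)"
    using sublinear_add[OF p fin_supp_add[OF v fin_supp_scale[OF w, of t]] fin_supp_uminus[OF v]]
    by simp
  finally show ?thesis by simp
qed

lemma linearize_le:
  assumes "sublinear p" "fin_supp w" "fin_supp v" "t \<ge> 0"
  shows "linearize p w v \<le> p (\<lambda>i. v i + t * w i) - t * p w"
  unfolding linearize_def
proof (rule cINF_lower)
  show "bdd_below ((\<lambda>t. p (\<lambda>i. v i + t * w i) - t * p w) ` {0..})"
    using linearize_bound[OF assms(1-3)] by (intro bdd_belowI) auto
qed (use assms(4) in simp)

lemma linearize_le_self: "sublinear p \<Longrightarrow> fin_supp w \<Longrightarrow> fin_supp v \<Longrightarrow> linearize p w v \<le> p v"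
  using linearize_le[of p w v 0] by simp

lemma linearize_approx:
  assumes "\<epsilon> > 0"
  shows "\<exists>t\<ge>0. p (\<lambda>i. v i + t * w i) - t * p w < linearize p w v + \<epsilon>"
proof (rule ccontr)
  assume "\<not> ?thesis"
  then have "linearize p w v + \<epsilon> \<le> linearize p w v"
    unfolding linearize_def by (intro cINF_greatest) (auto simp: not_less)
  then show False using assms by simp
qed

lemma linearize_neg:
  assumes "sublinear p" "fin_supp w"
  shows "linearize p w (\<lambda>i. - w i) \<le> - p w"
  using linearize_le[OF assms fin_supp_uminus[OF assms(2)], of 1] sublinear_zero[OF assms(1)] by simp

lemma sublinear_linearize:
  assumes p: "sublinear p" and w: "fin_supp w"
  shows "sublinear (linearize p w)"
  unfolding sublinear_def
proof (intro conjI allI impI)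
  fix u v assume u: "fin_supp u" and v: "fin_supp v"
  show "linearize p w (\<lambda>i. u i + v i) \<le> linearize p w u + linearize p w v"
  proof (rule field_le_epsilon)
    fix \<epsilon> :: real assume "\<epsilon> > 0"
    then obtain s where s: "s \<ge> 0" "p (\<lambda>i. u i + s * w i) - s * p w < linearize p w u + \<epsilon> / 2"
      using linearize_approx[of "\<epsilon>/2" p u w] by auto
    obtain t where t: "t \<ge> 0" "p (\<lambda>i. v i + t * w i) - t * p w < linearize p w v + \<epsilon> / 2"
      using linearize_approx[of "\<epsilon>/2" p v w] \<open>\<epsilon> > 0\<close> by auto
    note st = s t
    have "linearize p w (\<lambda>i. u i + v i) \<le> p (\<lambda>i. (u i + v i) + (s + t) * w i) - (s + t) * p w"
      using st by (intro linearize_le p w fin_supp_add u v) simp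
    also have "(\<lambda>i. (u i + v i) + (s + t) * w i) = (\<lambda>i. (u i + s * w i) + (v i + t * w i))"
      by (simp add: algebra_simps)
    also have "p \<dots> \<le> p (\<lambda>i. u i + s * w i) + p (\<lambda>i. v i + t * w i)"
      by (intro sublinear_add p fin_supp_add fin_supp_scale u v w)
    finally show "linearize p w (\<lambda>i. u i + v i) \<le> linearize p w u + linearize p w v + \<epsilon>"
      using st by (simp add: algebra_simps)
  qed
next
  fix c :: real and v assume c: "c \<ge> 0" and v: "fin_supp v"
  show "linearize p w (\<lambda>i. c * v i) = c * linearize p w v"
  proof (cases "c = 0")
    case True
    have "linearize p w (\<lambda>_. 0) \<le> 0"
      using linearize_le_self[OF p w fin_supp_zero] sublinear_zero[OF p] by simp
    moreover have "linearize p w (\<lambda>_. 0) \<ge> 0"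
      unfolding linearize_def
      using linearize_bound[OF p w fin_supp_zero] sublinear_zero[OF p]
      by (intro cINF_greatest) auto
    ultimately show ?thesis using True by simp
  next
    case False
    have le: "linearize p w (\<lambda>i. c * v i) \<le> c * linearize p w v" if c: "c > 0" and v: "fin_supp v" for c v
    proof (rule field_le_epsilon)
      fix \<epsilon> :: real assume "\<epsilon> > 0"
      then obtain t where t: "t \<ge> 0" "p (\<lambda>i. v i + t * w i) - t * p w < linearize p w v + \<epsilon> / c"
        using linearize_approx[of "\<epsilon>/c" p v w] c by auto
      have "linearize p w (\<lambda>i. c * v i) \<le> p (\<lambda>i. c * v i + (c * t) * w i) - (c * t) * p w"
        using t c by (intro linearize_le p w fin_supp_scale v) simp
      also have "(\<lambda>i. c * v i + (c * t) * w i) = (\<lambda>i. c * (v i + t * w i))"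
        by (simp add: algebra_simps)
      also have "p \<dots> = c * p (\<lambda>i. v i + t * w i)"
        using c by (intro sublinear_scale p fin_supp_add fin_supp_scale v w) simp
      also have "c * p (\<lambda>i. v i + t * w i) - c * t * p w = c * (p (\<lambda>i. v i + t * w i) - t * p w)"
        by (simp add: algebra_simps)
      also have "\<dots> \<le> c * (linearize p w v + \<epsilon> / c)"
        using t c by (intro mult_left_mono) simp_all
      finally show "linearize p w (\<lambda>i. c * v i) \<le> c * linearize p w v + \<epsilon>"
        using c by (simp add: algebra_simps)
    qed
    have c: "c > 0" using False c by simp
    have "linearize p w (\<lambda>i. (1/c) * (c * v i)) \<le> (1/c) * linearize p w (\<lambda>i. c * v i)"
      using c by (intro le fin_supp_scale v) simp
    then have "c * linearize p w v \<le> linearize p w (\<lambda>i. c * v i)"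
      using c by (simp add: field_simps)
    with le[OF c v] show ?thesis by simp
  qed
qed

text \<open>Linearizing at \<open>a\<close> and after that at each unit vector gives a decreasing
  chain \<open>q\<close>, where \<open>q n\<close> is linear on vectors supported below
  \<open>n\<close>. Starting with \<open>a\<close> secures the value at \<open>a\<close>; the bound
  by \<open>\<Phi>\<close> holds for every \<open>n\<close> because each \<open>q n\<close> stays
  below \<open>\<Phi>\<close>.\<close>

lemma norming_functional:
  assumes \<Phi>: "sublinear \<Phi>" and a: "\<And>i. i \<ge> N \<Longrightarrow> a i = 0"
  shows "\<exists>f :: nat \<Rightarrow> real. (\<forall>n v. (\<Sum>i<n. f i * v i) \<le> \<Phi> (\<lambda>i. if i < n then v i else 0)) \<and>
    (\<Sum>i<N. f i * a i) = \<Phi> a"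
proof -
  let ?d = "\<lambda>k i. if i = k then 1 else 0 :: real"
  have "{i. a i \<noteq> 0} \<subseteq> {..<N}" using a leI by blast
  then have afin: "fin_supp a" unfolding fin_supp_def by (rule finite_subset) simp
  define q where "q = rec_nat (linearize \<Phi> a) (\<lambda>k p. linearize p (?d k))"
  have q0: "q 0 = linearize \<Phi> a" and qS: "q (Suc k) = linearize (q k) (?d k)" for k
    unfolding q_def by simp_all
  have sub: "sublinear (q k)" for k
    by (induction k) (simp_all add: q0 qS sublinear_linearize \<Phi> afin)
  have anti: "q l v \<le> q k v" if "k \<le> l" "fin_supp v" for k l v
    using that(1)
  proof (induction l rule: dec_induct)
    case (step l)
    then show ?case using linearize_le_self[OF sub[of l] _ that(2), of "?d l"] by (simp add: qS)
  qed simp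
  define f where "f k = q k (?d k)" for k
  have neg: "q (Suc k) (\<lambda>i. - ?d k i) \<le> - f k" for k
    unfolding qS f_def by (rule linearize_neg[OF sub]) simp
  have line: "q n (\<lambda>i. if i = k then c else 0) \<le> f k * c" if "k < n" for n k c
  proof (cases "c \<ge> 0")
    case True
    have "q n (\<lambda>i. if i = k then c else 0) = q n (\<lambda>i. c * ?d k i)"
      by (rule arg_cong[where f = "q n"]) auto
    also have "\<dots> = c * q n (?d k)" by (rule sublinear_scale[OF sub True]) simp
    also have "\<dots> \<le> c * f k" unfolding f_def using anti[of k n "?d k"] that True by (intro mult_left_mono) simp_all
    finally show ?thesis by (simp add: mult.commute)
  next
    case False
    have "q n (\<lambda>i. if i = k then c else 0) = q n (\<lambda>i. (- c) * - ?d k i)"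
      by (rule arg_cong[where f = "q n"]) auto
    also have "\<dots> = (- c) * q n (\<lambda>i. - ?d k i)"
      using False by (intro sublinear_scale[OF sub] fin_supp_uminus) simp_all
    also have "\<dots> \<le> (- c) * - f k"
      using order_trans[OF anti[of "Suc k" n "\<lambda>i. - ?d k i"] neg[of k]] that False
        fin_supp_uminus[OF fin_supp_delta[of k 1]]
      by (intro mult_left_mono) simp_all
    finally show ?thesis by (simp add: mult.commute)
  qed
  have upper: "q n (\<lambda>i. if i < m then v i else 0) \<le> (\<Sum>i<m. f i * v i)" if "m \<le> n" for n m v
    using that
  proof (induction m)
    case 0
    then show ?case using sublinear_zero[OF sub] by simp
  next
    case (Suc m)
    have "q n (\<lambda>i. if i < Suc m then v i else 0) =
        q n (\<lambda>i. (if i < m then v i else 0) + (if i = m then v m else 0))"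
      by (rule arg_cong[where f = "q n"]) auto
    also have "\<dots> \<le> q n (\<lambda>i. if i < m then v i else 0) + q n (\<lambda>i. if i = m then v m else 0)"
      by (rule sublinear_add[OF sub]) simp_all
    also have "\<dots> \<le> (\<Sum>i<m. f i * v i) + f m * v m"
      using Suc line[of m n "v m"] by simp
    finally show ?case by simp
  qed
  \<comment> \<open>The upper estimate for \<open>q n\<close> at the negated vector becomes a lower
    estimate at the vector itself, and \<open>q n\<close> lies below \<open>\<Phi>\<close>.\<close>
  have 1: "(\<Sum>i<n. f i * v i) \<le> \<Phi> (\<lambda>i. if i < n then v i else 0)" for n v
  proof -
    let ?v = "\<lambda>i. if i < n then v i else 0"
    have "q n (\<lambda>i. - ?v i) = q n (\<lambda>i. if i < n then - v i else 0)"
      by (rule arg_cong[where f = "q n"]) auto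
    also have "\<dots> \<le> - (\<Sum>i<n. f i * v i)"
      using upper[of n n "\<lambda>i. - v i"] by (simp add: sum_negf)
    finally have "(\<Sum>i<n. f i * v i) \<le> - q n (\<lambda>i. - ?v i)" by simp
    also have "\<dots> \<le> q n ?v" by (rule sublinear_uminus[OF sub]) simp
    also have "\<dots> \<le> q 0 ?v" by (rule anti) simp_all
    also have "\<dots> \<le> \<Phi> ?v" unfolding q0 by (rule linearize_le_self[OF \<Phi> afin]) simp
    finally show ?thesis .
  qed
  have aN: "(\<lambda>i. if i < N then a i else 0) = a" using a by (auto simp: fun_eq_iff)
  have "\<Phi> a \<le> - linearize \<Phi> a (\<lambda>i. - a i)" using linearize_neg[OF \<Phi> afin] by simp
  also have "\<dots> \<le> - q N (\<lambda>i. - a i)"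
    using anti[of 0 N "\<lambda>i. - a i"] fin_supp_uminus[OF afin] by (simp add: q0)
  also have "\<dots> \<le> q N a"
    by (rule sublinear_uminus[OF sub afin])
  also have "q N a \<le> (\<Sum>i<N. f i * a i)" using upper[of N N a] aN by simp
  finally have "\<Phi> a \<le> (\<Sum>i<N. f i * a i)" .
  moreover have "(\<Sum>i<N. f i * a i) \<le> \<Phi> a"
    using 1[of a N] aN by simp
  ultimately show ?thesis using 1 by (intro exI[of _ f]) auto
qed

text \<open>A countable dense family of norming functionals embeds a seminorm isometrically into
  \<open>\<ell>\<^sub>\<infinity>\<close>; finite lists of rationals enumerate the vectors to be normed.\<close>

lemma seminorm_embeds_ell_infinity:
  assumes \<Phi>: "sublinear \<Phi>" and sym: "\<And>v. \<Phi> (\<lambda>i. - v i) = \<Phi> v"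
  shows "\<exists>s :: nat \<Rightarrow> ell_infinity. \<forall>n a.
    norm (\<Sum>i<n. a i *\<^sub>R s i) = \<Phi> (\<lambda>i. if i < n then a i else 0)"
proof -
  let ?vec = "\<lambda>(l :: rat list) i. if i < length l then real_of_rat (l ! i) else 0"
  have "\<forall>l. \<exists>f :: nat \<Rightarrow> real. (\<forall>n v. (\<Sum>i<n. f i * v i) \<le> \<Phi> (\<lambda>i. if i < n then v i else 0)) \<and>
    (\<Sum>i<length l. f i * ?vec l i) = \<Phi> (?vec l)"
    by (intro allI norming_functional[OF \<Phi>]) simp
  from choice[OF this] obtain F
    where F: "\<And>l n v. (\<Sum>i<n. F l i * v i) \<le> \<Phi> (\<lambda>i. if i < n then v i else 0)"
    "\<And>l. (\<Sum>i<length l. F l i * ?vec l i) = \<Phi> (?vec l)"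
    by blast
  let ?d = "\<lambda>k i. if i = k then 1 else 0 :: real"
  have F_abs: "\<bar>\<Sum>i<n. F l i * v i\<bar> \<le> \<Phi> (\<lambda>i. if i < n then v i else 0)" for l n v
  proof -
    have "(\<lambda>i. if i < n then - v i else 0) = (\<lambda>i. - (if i < n then v i else 0))" by auto
    then have "\<Phi> (\<lambda>i. if i < n then - v i else 0) = \<Phi> (\<lambda>i. if i < n then v i else 0)"
      using sym by simp
    then show ?thesis using F(1)[of l v n] F(1)[of l "\<lambda>i. - v i" n] by (simp add: sum_negf abs_le_iff)
  qed
  have F_le: "\<bar>F l k\<bar> \<le> \<Phi> (?d k)" for l k
  proof -
    have "(\<Sum>i<Suc k. F l i * ?d k i) = F l k" by simp
    moreover have "(\<lambda>i. if i < Suc k then ?d k i else 0) = ?d k" by auto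
    ultimately show ?thesis using F_abs[of l "?d k" "Suc k"] by simp
  qed
  \<comment> \<open>Coordinate \<open>m\<close> evaluates the functional of the rational list coded
    by \<open>m\<close> at the unit vector \<open>k\<close>; all these values are bounded by the
    value of \<open>\<Phi>\<close> there, so \<open>s k\<close> is a bounded function.\<close>
  define s where "s k = Bcontfun (\<lambda>m. F (from_nat m) k)" for k
  have s: "apply_bcontfun (s k) m = F (from_nat m) k" for k m
    unfolding s_def using F_le[of _ k]
    by (subst Bcontfun_inverse) (auto simp: bcontfun_def bounded_iff)
  have apply_sum: "apply_bcontfun (\<Sum>i<n. a i *\<^sub>R s i) m = (\<Sum>i<n. F (from_nat m) i * a i)" for n a m
    by (induction n) (simp_all add: s mult.commute)
  have \<Phi>_abs: "\<Phi> (\<lambda>i. if i < n then v i else 0) \<le> (\<Sum>i<n. \<bar>v i\<bar> * \<Phi> (?d i))" for n v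
  proof (induction n)
    case 0
    then show ?case using sublinear_zero[OF \<Phi>] by simp
  next
    case (Suc n)
    have "(\<lambda>i. if i < Suc n then v i else 0) =
        (\<lambda>i. (if i < n then v i else 0) + (if i = n then v n else 0))" by auto
    then have "\<Phi> (\<lambda>i. if i < Suc n then v i else 0) \<le>
        \<Phi> (\<lambda>i. if i < n then v i else 0) + \<Phi> (\<lambda>i. if i = n then v n else 0)"
      using sublinear_add[OF \<Phi>] by simp
    moreover have "\<Phi> (\<lambda>i. if i = n then v n else 0) = \<bar>v n\<bar> * \<Phi> (?d n)"
    proof -
      have "\<Phi> (\<lambda>i. \<bar>v n\<bar> * ?d n i) = \<bar>v n\<bar> * \<Phi> (?d n)"
        by (rule sublinear_scale[OF \<Phi>]) simp_all
      moreover have "(\<lambda>i. if i = n then v n else 0) = (\<lambda>i. \<bar>v n\<bar> * ?d n i) \<or>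
          (\<lambda>i. if i = n then v n else 0) = (\<lambda>i. - (\<bar>v n\<bar> * ?d n i))"
        by (cases "v n \<ge> 0") (auto simp: fun_eq_iff)
      ultimately show ?thesis using sym by metis
    qed
    ultimately show ?case using Suc by simp
  qed
  have "norm (\<Sum>i<n. a i *\<^sub>R s i) = \<Phi> (\<lambda>i. if i < n then a i else 0)" (is "norm ?S = \<Phi> ?a") for n a
  proof (rule antisym)
    show "norm ?S \<le> \<Phi> ?a"
      by (rule norm_bound) (simp add: apply_sum F_abs)
    show "\<Phi> ?a \<le> norm ?S"
    proof (rule field_le_epsilon)
      fix \<epsilon> :: real assume \<epsilon>: "\<epsilon> > 0"
      define D where "D = (\<Sum>i<n. \<Phi> (?d i))"
      have \<Phi>d: "\<Phi> (?d i) \<ge> 0" for i using F_le[of _ i] by (meson abs_ge_zero order_trans)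
      then have D: "D \<ge> 0" unfolding D_def by (intro sum_nonneg)
      \<comment> \<open>The rounding error enters twice, once through \<open>\<Phi>\<close> and once
        through the functional of the rounded vector, so each occurrence may cost
        \<open>\<epsilon> / 2\<close>. The \<open>+ 1\<close> covers \<open>D = 0\<close>.\<close>
      define \<delta> where "\<delta> = \<epsilon> / (2 * (D + 1))"
      have \<delta>: "\<delta> > 0" unfolding \<delta>_def using \<epsilon> D by simp
      have "\<exists>r. \<bar>a i - real_of_rat r\<bar> < \<delta>" for i
      proof -
        obtain r where "a i < real_of_rat r" "real_of_rat r < a i + \<delta>"
          using of_rat_dense[of "a i" "a i + \<delta>"] \<delta> by auto
        then show ?thesis by (intro exI[of _ r]) simp
      qed
      then obtain r where r: "\<And>i. \<bar>a i - real_of_rat (r i)\<bar> < \<delta>" by metis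
      define l where "l = map r [0..<n]"
      have l: "length l = n" "\<And>i. i < n \<Longrightarrow> l ! i = r i" unfolding l_def by simp_all
      let ?v = "\<lambda>i. a i - real_of_rat (r i)"
      have small: "\<Phi> (\<lambda>i. if i < n then ?v i else 0) \<le> \<epsilon> / 2"
      proof -
        have "\<Phi> (\<lambda>i. if i < n then ?v i else 0) \<le> (\<Sum>i<n. \<bar>?v i\<bar> * \<Phi> (?d i))" by (rule \<Phi>_abs)
        also have "\<dots> \<le> (\<Sum>i<n. \<delta> * \<Phi> (?d i))"
          using r \<Phi>d by (intro sum_mono mult_right_mono) (auto intro: less_imp_le)
        also have "\<dots> = \<delta> * D" unfolding D_def by (simp add: sum_distrib_left)
        also have "\<dots> \<le> \<delta> * (D + 1)" using \<delta> by simp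
        also have "\<dots> = \<epsilon> / 2" unfolding \<delta>_def using D by (simp add: field_simps)
        finally show ?thesis .
      qed
      have "?a = (\<lambda>i. ?vec l i + (if i < n then ?v i else 0))"
        by (auto simp: l fun_eq_iff)
      then have "\<Phi> ?a \<le> \<Phi> (?vec l) + \<Phi> (\<lambda>i. if i < n then ?v i else 0)"
        using sublinear_add[OF \<Phi>, of "?vec l" "\<lambda>i. if i < n then ?v i else 0"] by simp
      also have "\<Phi> (?vec l) = (\<Sum>i<n. F l i * real_of_rat (r i))"
        using F(2)[of l] l by simp
      also have "\<dots> = (\<Sum>i<n. F l i * a i) - (\<Sum>i<n. F l i * ?v i)"
        by (simp add: algebra_simps sum_subtractf)
      also have "\<dots> \<le> (\<Sum>i<n. F l i * a i) + \<epsilon> / 2"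
        using F_abs[of l ?v n] small by linarith
      also have "(\<Sum>i<n. F l i * a i) = apply_bcontfun ?S (to_nat l)"
        by (simp add: apply_sum)
      also have "\<dots> \<le> norm ?S"
        using norm_bounded[of ?S "to_nat l"] by simp
      finally show "\<Phi> ?a \<le> norm ?S + \<epsilon>" using small by simp
    qed
  qed
  then show ?thesis by blast
qed

section \<open>Existence of spreading models\<close>

text \<open>Colour an \<open>n\<close>-set by the integer part of \<open>f X / \<epsilon>\<close>.
  Boundedness makes the number of colours finite, and equal colours mean values at most
  \<open>\<epsilon>\<close> apart.\<close>

lemma Ramsey_oscillation:
  fixes f :: "nat set \<Rightarrow> real"
  assumes Z: "infinite Z" and B: "\<And>X. finite X \<Longrightarrow> card X = n \<Longrightarrow> 0 \<le> f X \<and> f X \<le> B" and \<epsilon>: "\<epsilon> > 0"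
  shows "\<exists>Y\<subseteq>Z. infinite Y \<and> (\<forall>X X'. X \<subseteq> Y \<and> finite X \<and> card X = n \<and> X' \<subseteq> Y \<and> finite X' \<and> card X' = n
    \<longrightarrow> \<bar>f X - f X'\<bar> \<le> \<epsilon>)"
proof -
  let ?c = "\<lambda>X. nat \<lfloor>f X / \<epsilon>\<rfloor>"
  have "?c X < Suc (nat \<lfloor>B / \<epsilon>\<rfloor>)" if "finite X" "card X = n" for X
    using B[OF that] \<epsilon> by (simp add: less_Suc_eq_le nat_mono floor_mono divide_right_mono)
  then obtain Y t where Y: "Y \<subseteq> Z" "infinite Y"
    "\<forall>X. X \<subseteq> Y \<and> finite X \<and> card X = n \<longrightarrow> ?c X = t"
    using Ramsey[OF Z, of n ?c "Suc (nat \<lfloor>B / \<epsilon>\<rfloor>)"] by blast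
  have c: "real t * \<epsilon> \<le> f X \<and> f X \<le> (real t + 1) * \<epsilon>" if "X \<subseteq> Y" "finite X" "card X = n" for X
  proof -
    have "?c X = t" using Y that by blast
    moreover have "\<lfloor>f X / \<epsilon>\<rfloor> \<ge> 0" using B that \<epsilon> by simp
    ultimately have "\<lfloor>f X / \<epsilon>\<rfloor> = int t" by linarith
    then have "real t \<le> f X / \<epsilon> \<and> f X / \<epsilon> \<le> real t + 1" by linarith
    then show ?thesis using \<epsilon> by (simp add: field_simps)
  qed
  have "\<bar>f X - f X'\<bar> \<le> \<epsilon>" if "X \<subseteq> Y" "finite X" "card X = n" "X' \<subseteq> Y" "finite X'" "card X' = n" for X X'
    using c[OF that(1-3)] c[OF that(4-6)] by (simp add: abs_le_iff algebra_simps)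
  then show ?thesis using Y by blast
qed

lemma Ramsey_oscillation_finite:
  fixes f :: "'g \<Rightarrow> nat set \<Rightarrow> real"
  assumes "finite G" "infinite Z"
    and "\<And>g X. g \<in> G \<Longrightarrow> finite X \<Longrightarrow> card X = n \<Longrightarrow> 0 \<le> f g X \<and> f g X \<le> B g" and \<epsilon>: "\<epsilon> > 0"
  shows "\<exists>Y\<subseteq>Z. infinite Y \<and> (\<forall>g\<in>G. \<forall>X X'. X \<subseteq> Y \<and> finite X \<and> card X = n \<and> X' \<subseteq> Y \<and> finite X' \<and> card X' = n
    \<longrightarrow> \<bar>f g X - f g X'\<bar> \<le> \<epsilon>)"
  using assms(1,3)
proof (induction G rule: finite_induct)
  case empty
  then show ?case using assms(2) by blast
next
  case (insert g G)
  then obtain Y where Y: "Y \<subseteq> Z" "infinite Y"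
    "\<forall>g\<in>G. \<forall>X X'. X \<subseteq> Y \<and> finite X \<and> card X = n \<and> X' \<subseteq> Y \<and> finite X' \<and> card X' = n
      \<longrightarrow> \<bar>f g X - f g X'\<bar> \<le> \<epsilon>"
    by (metis insertI2)
  obtain Y' where Y': "Y' \<subseteq> Y" "infinite Y'"
    "\<forall>X X'. X \<subseteq> Y' \<and> finite X \<and> card X = n \<and> X' \<subseteq> Y' \<and> finite X' \<and> card X' = n
      \<longrightarrow> \<bar>f g X - f g X'\<bar> \<le> \<epsilon>"
    using Ramsey_oscillation[OF Y(2), of n "f g" "B g" \<epsilon>] insert.prems[of g] \<epsilon> by auto
  have "Y' \<subseteq> Z" using Y Y' by blast
  moreover have "\<forall>h\<in>insert g G. \<forall>X X'. X \<subseteq> Y' \<and> finite X \<and> card X = n \<and> X' \<subseteq> Y' \<and> finite X' \<and> card X' = n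
      \<longrightarrow> \<bar>f h X - f h X'\<bar> \<le> \<epsilon>"
  proof (intro ballI allI impI)
    fix h X X'
    assume h: "h \<in> insert g G" and XX: "X \<subseteq> Y' \<and> finite X \<and> card X = n \<and> X' \<subseteq> Y' \<and> finite X' \<and> card X' = n"
    show "\<bar>f h X - f h X'\<bar> \<le> \<epsilon>"
    proof (cases "h = g")
      case True
      then show ?thesis using Y'(3)[rule_format, of X X'] XX by simp
    next
      case False
      then have "h \<in> G" using h by simp
      moreover have "X \<subseteq> Y" "X' \<subseteq> Y" using XX Y'(1) by auto
      ultimately show ?thesis using Y(3)[rule_format, of h X X'] XX by simp
    qed
  qed
  ultimately show ?case using Y'(2) by (intro exI[of _ Y'] conjI)
qed

definition stable_upto :: "nat \<Rightarrow> real \<Rightarrow> (nat \<Rightarrow> 'a::real_normed_vector) \<Rightarrow> bool" where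
  "stable_upto n \<epsilon> y \<longleftrightarrow> (\<forall>(a :: nat \<Rightarrow> real) k k'. (\<forall>i<n. \<bar>a i\<bar> \<le> 1) \<longrightarrow>
     strict_mono_on {..<n} k \<longrightarrow> strict_mono_on {..<n} k' \<longrightarrow>
     \<bar>norm (\<Sum>i<n. a i *\<^sub>R y (k i)) - norm (\<Sum>i<n. a i *\<^sub>R y (k' i))\<bar> \<le> \<epsilon>)"

lemma stable_upto_subseq:
  assumes "stable_upto n \<epsilon> y" "strict_mono r"
  shows "stable_upto n \<epsilon> (y \<circ> r)"
proof -
  have "strict_mono_on {..<n} (r \<circ> k)" if "strict_mono_on {..<n} k" for k
    using that assms(2) unfolding strict_mono_on_def strict_mono_def by simp
  then show ?thesis
    using assms(1)[unfolded stable_upto_def, THEN spec, THEN spec, THEN spec, of _ "r \<circ> k" "r \<circ> k'" for k k']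
    unfolding stable_upto_def by (simp add: comp_def)
qed

lemma norm_combination_diff_le:
  fixes y :: "nat \<Rightarrow> 'a::real_normed_vector"
  assumes "\<And>i. norm (y i) \<le> 1" "\<And>i. i < n \<Longrightarrow> \<bar>a i - b i\<bar> \<le> \<delta>"
  shows "\<bar>norm (\<Sum>i<n. a i *\<^sub>R y i) - norm (\<Sum>i<n. b i *\<^sub>R y i)\<bar> \<le> real n * \<delta>"
proof -
  have "\<bar>norm (\<Sum>i<n. a i *\<^sub>R y i) - norm (\<Sum>i<n. b i *\<^sub>R y i)\<bar>
      \<le> norm ((\<Sum>i<n. a i *\<^sub>R y i) - (\<Sum>i<n. b i *\<^sub>R y i))"
    by (rule norm_triangle_ineq3)
  also have "\<dots> = norm (\<Sum>i<n. (a i - b i) *\<^sub>R y i)"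
    by (simp add: scaleR_diff_left sum_subtractf)
  also have "\<dots> \<le> (\<Sum>i<n. \<delta>)"
  proof (rule sum_norm_le)
    fix i assume "i \<in> {..<n}"
    then show "norm ((a i - b i) *\<^sub>R y i) \<le> \<delta>"
      using assms mult_mono[of "\<bar>a i - b i\<bar>" \<delta> "norm (y i)" 1] by force
  qed
  finally show ?thesis by simp
qed

text \<open>Ramsey's theorem handles finitely many coefficient vectors, so coefficients are rounded
  to a grid of mesh \<open>1 / M\<close>. Rounding costs at most \<open>\<epsilon> / 4\<close> for
  each of the two tuples, which leaves \<open>\<epsilon> / 2\<close> for the oscillation over grid
  vectors.\<close>

lemma stable_upto_subseq_exists:
  fixes y :: "nat \<Rightarrow> 'a::real_normed_vector"
  assumes y: "normalized y" and \<epsilon>: "\<epsilon> > 0"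
  shows "\<exists>r. strict_mono r \<and> stable_upto n \<epsilon> (y \<circ> r)"
proof -
  have ny: "norm (y i) \<le> 1" for i using y unfolding normalized_def by simp
  define M :: nat where "M = Suc (nat \<lceil>4 * real n / \<epsilon>\<rceil>)"
  have M: "M > 0" "real n / real M \<le> \<epsilon> / 4"
  proof -
    show "M > 0" unfolding M_def by simp
    have "4 * real n / \<epsilon> \<le> real M" unfolding M_def by linarith
    then show "real n / real M \<le> \<epsilon> / 4"
      using \<epsilon> \<open>M > 0\<close> by (simp add: field_simps)
  qed
  define G where "G = ({..<n} \<rightarrow>\<^sub>E (\<lambda>j::int. real_of_int j / real M) ` {- int M..int M})"
  have finG: "finite G" unfolding G_def by (intro finite_PiE) auto
  have G1: "\<bar>g i\<bar> \<le> 1" if "g \<in> G" "i < n" for g i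
  proof -
    have "g i \<in> (\<lambda>j::int. real_of_int j / real M) ` {- int M..int M}"
      using PiE_mem[OF that(1)[unfolded G_def], of i] that(2) by simp
    then obtain j where j: "g i = real_of_int j / real M" "j \<in> {- int M..int M}" by blast
    from j(2) have "\<bar>real_of_int j\<bar> \<le> real M" by auto
    with j(1) show ?thesis using M(1) by simp
  qed
  \<comment> \<open>An index set is read as the increasing tuple of its elements, which matches the
    strictly increasing \<open>k\<close> of \<open>stable_upto\<close>.\<close>
  define f where "f g X = norm (\<Sum>i<n. g i *\<^sub>R y (sorted_list_of_set X ! i))" for g :: "nat \<Rightarrow> real" and X
  have fB: "0 \<le> f g X \<and> f g X \<le> real n" if "g \<in> G" for g X
  proof -
    have "f g X \<le> (\<Sum>i<n. 1)" unfolding f_def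
    proof (rule sum_norm_le)
      fix i assume "i \<in> {..<n}"
      then show "norm (g i *\<^sub>R y (sorted_list_of_set X ! i)) \<le> 1"
        using G1[OF that, of i] y unfolding normalized_def by simp
    qed
    then show ?thesis unfolding f_def by simp
  qed
  obtain Y where Y: "infinite Y" "\<forall>g\<in>G. \<forall>X X'. X \<subseteq> Y \<and> finite X \<and> card X = n \<and> X' \<subseteq> Y \<and> finite X' \<and> card X' = n
    \<longrightarrow> \<bar>f g X - f g X'\<bar> \<le> \<epsilon> / 2"
    using Ramsey_oscillation_finite[OF finG infinite_UNIV_nat, of n f "\<lambda>_. real n" "\<epsilon> / 2"] fB \<epsilon> by auto
  define r where "r = enumerate Y"
  have r: "strict_mono r" "\<And>i. r i \<in> Y"
    unfolding r_def using Y(1) by (auto simp: strict_mono_def enumerate_mono enumerate_in_set)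
  have tuple: "finite (k ` {..<n}) \<and> card (k ` {..<n}) = n \<and>
      f g (k ` {..<n}) = norm (\<Sum>i<n. g i *\<^sub>R y (k i))" if k: "strict_mono_on {..<n} k" for k g
  proof -
    have "inj_on k {..<n}" using k by (rule strict_mono_on_imp_inj_on)
    then have "card (k ` {..<n}) = n" by (simp add: card_image)
    have "sorted_wrt (<) (map k [0..<n])"
      using k by (auto simp: sorted_wrt_iff_nth_less strict_mono_on_def)
    then have "sorted_list_of_set (set (map k [0..<n])) = map k [0..<n]"
      by (intro sorted_list_of_set.idem_if_sorted_distinct) (auto simp: strict_sorted_iff)
    moreover have "set (map k [0..<n]) = k ` {..<n}" by auto
    ultimately have "sorted_list_of_set (k ` {..<n}) = map k [0..<n]" by simp
    then have "f g (k ` {..<n}) = norm (\<Sum>i<n. g i *\<^sub>R y (k i))"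
      unfolding f_def by (intro arg_cong[where f = norm] sum.cong) auto
    with \<open>card (k ` {..<n}) = n\<close> show ?thesis by simp
  qed
  have "stable_upto n \<epsilon> (y \<circ> r)"
    unfolding stable_upto_def
  proof (intro allI impI)
    fix a :: "nat \<Rightarrow> real" and k k' :: "nat \<Rightarrow> nat"
    assume a: "\<forall>i<n. \<bar>a i\<bar> \<le> 1" and k: "strict_mono_on {..<n} k" and k': "strict_mono_on {..<n} k'"
    define g where "g = (\<lambda>i\<in>{..<n}. real_of_int \<lfloor>a i * real M\<rfloor> / real M)"
    have "\<lfloor>a i * real M\<rfloor> \<in> {- int M..int M}" if "i < n" for i
    proof -
      have "\<bar>a i * real M\<bar> \<le> real M" using a that by (simp add: abs_mult mult_left_le_one_le)
      then show ?thesis by (simp add: abs_le_iff le_floor_iff floor_le_iff)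
    qed
    then have g: "g \<in> G" unfolding G_def g_def by auto
    have ag: "\<bar>a i - g i\<bar> \<le> 1 / real M" if "i < n" for i
    proof -
      have "\<bar>a i * real M - real_of_int \<lfloor>a i * real M\<rfloor>\<bar> \<le> 1" by linarith
      moreover have "(a i - g i) * real M = a i * real M - real_of_int \<lfloor>a i * real M\<rfloor>"
        using that M(1) unfolding g_def by (simp add: algebra_simps)
      ultimately have "\<bar>(a i - g i) * real M\<bar> \<le> 1" by simp
      then have "\<bar>a i - g i\<bar> * real M \<le> 1" by (simp add: abs_mult)
      then show ?thesis using M(1) by (simp add: pos_le_divide_eq)
    qed
    have near: "\<bar>norm (\<Sum>i<n. a i *\<^sub>R y (l i)) - norm (\<Sum>i<n. g i *\<^sub>R y (l i))\<bar> \<le> \<epsilon> / 4" for l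
    proof -
      have "\<bar>norm (\<Sum>i<n. a i *\<^sub>R y (l i)) - norm (\<Sum>i<n. g i *\<^sub>R y (l i))\<bar> \<le> real n * (1 / real M)"
        by (rule norm_combination_diff_le) (use ny ag in auto)
      also have "\<dots> = real n / real M" by simp
      finally show ?thesis using M(2) by linarith
    qed
    have rk: "strict_mono_on {..<n} (\<lambda>i. r (k i))" "strict_mono_on {..<n} (\<lambda>i. r (k' i))"
      using k k' r(1) unfolding strict_mono_on_def strict_mono_def by auto
    have "\<bar>f g ((\<lambda>i. r (k i)) ` {..<n}) - f g ((\<lambda>i. r (k' i)) ` {..<n})\<bar> \<le> \<epsilon> / 2"
      using Y(2) g tuple[OF rk(1)] tuple[OF rk(2)] r(2) by (metis image_subsetI)
    then have "\<bar>norm (\<Sum>i<n. g i *\<^sub>R y (r (k i))) - norm (\<Sum>i<n. g i *\<^sub>R y (r (k' i)))\<bar> \<le> \<epsilon> / 2"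
      using tuple[OF rk(1)] tuple[OF rk(2)] by simp
    with near[of "\<lambda>i. r (k i)"] near[of "\<lambda>i. r (k' i)"]
    show "\<bar>norm (\<Sum>i<n. a i *\<^sub>R (y \<circ> r) (k i)) - norm (\<Sum>i<n. a i *\<^sub>R (y \<circ> r) (k' i))\<bar> \<le> \<epsilon>"
      unfolding comp_def by linarith
  qed
  with r(1) show ?thesis by blast
qed

lemma stable_subseq_exists:
  fixes x :: "nat \<Rightarrow> 'a::real_normed_vector"
  assumes x: "normalized x"
  shows "\<exists>r. strict_mono r \<and> (\<forall>n. stable_upto n (1 / real (Suc n)) (\<lambda>i. x (r (i + n))))"
proof -
  interpret subseqs "\<lambda>n s. stable_upto n (1 / real (Suc n)) (x \<circ> s)"
  proof
    fix n and s :: "nat \<Rightarrow> nat"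
    have "normalized (x \<circ> s)" using x unfolding normalized_def by simp
    then show "\<exists>r'. strict_mono r' \<and> stable_upto n (1 / real (Suc n)) (x \<circ> (s \<circ> r'))"
      using stable_upto_subseq_exists[of "x \<circ> s" "1 / real (Suc n)" n] by (simp add: comp_assoc)
  qed
  \<comment> \<open>The diagonal sequence has the property of stage \<open>n\<close> from index
    \<open>Suc n\<close> on; the shift by one turns this into index \<open>n\<close>.\<close>
  define r where "r i = diagseq (Suc i)" for i
  have "strict_mono r"
    using subseq_diagseq unfolding r_def strict_mono_def by simp
  moreover have "stable_upto n (1 / real (Suc n)) (\<lambda>i. x (r (i + n)))" for n
  proof -
    have "stable_upto n (1 / real (Suc n)) (x \<circ> (diagseq \<circ> (+) (Suc n)))"
      by (rule diagseq_holds) (simp add: stable_upto_subseq flip: comp_assoc)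
    moreover have "x \<circ> (diagseq \<circ> (+) (Suc n)) = (\<lambda>i. x (r (i + n)))"
      by (auto simp: r_def fun_eq_iff add.commute)
    ultimately show ?thesis by simp
  qed
  ultimately show ?thesis by blast
qed

lemma stable_tail_diff:
  fixes y :: "nat \<Rightarrow> 'a::real_normed_vector"
  assumes st: "\<And>n. stable_upto n (1 / real (Suc n)) (\<lambda>i. y (i + n))"
    and a: "\<forall>i<n. \<bar>a i\<bar> \<le> 1" and k: "strict_mono_on {..<n} k" and k': "strict_mono_on {..<n} k'"
    and kn: "n \<le> k 0" "n \<le> k' 0"
  shows "\<bar>norm (\<Sum>i<n. a i *\<^sub>R y (k i)) - norm (\<Sum>i<n. a i *\<^sub>R y (k' i))\<bar> \<le> 1 / real (Suc n)"
proof -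
  have ge: "n \<le> l i" if l: "strict_mono_on {..<n} l" "n \<le> l 0" and i: "i < n" for l i
    using strict_mono_on_leD[OF l(1), of 0 i] l(2) i by simp
  have sm: "strict_mono_on {..<n} (\<lambda>i. l i - n)" if l: "strict_mono_on {..<n} l" "n \<le> l 0" for l
  proof (rule strict_mono_onI)
    fix r s assume "r \<in> {..<n}" "s \<in> {..<n}" "r < s"
    then show "l r - n < l s - n"
      using strict_mono_onD[OF l(1), of r s] ge[OF l, of r] by auto
  qed
  have eq: "(\<Sum>i<n. a i *\<^sub>R y (l i - n + n)) = (\<Sum>i<n. a i *\<^sub>R y (l i))"
    if l: "strict_mono_on {..<n} l" "n \<le> l 0" for l
    using ge[OF l] by (intro sum.cong) auto
  show ?thesis
    using st[of n, unfolded stable_upto_def, rule_format, of a "\<lambda>i. k i - n" "\<lambda>i. k' i - n"]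
      a sm[OF k kn(1)] sm[OF k' kn(2)] eq[OF k kn(1)] eq[OF k' kn(2)] by simp
qed

text \<open>For combinations of \<open>n\<close> terms the given error
  \<open>1 / real (Suc n)\<close> is fixed. Padding with zero coefficients to any greater length
  makes the error as small as desired; dividing by \<open>A\<close> brings the coefficients into the
  unit interval.\<close>

lemma stable_limit_exists:
  fixes y :: "nat \<Rightarrow> 'a::real_normed_vector"
  assumes st: "\<And>n. stable_upto n (1 / real (Suc n)) (\<lambda>i. y (i + n))"
  shows "convergent (\<lambda>m. norm (\<Sum>i<n. a i *\<^sub>R y (m + i)))"
proof -
  define A where "A = 1 + (\<Sum>i<n. \<bar>a i\<bar>)"
  have A: "A \<ge> 1" unfolding A_def by (simp add: sum_nonneg)
  have aA: "\<bar>a i / A\<bar> \<le> 1" if "i < n" for i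
  proof -
    have "\<bar>a i\<bar> \<le> (\<Sum>i<n. \<bar>a i\<bar>)" using that by (intro member_le_sum) auto
    then show ?thesis using A unfolding A_def by simp
  qed
  define b where "b i = (if i < n then a i / A else 0)" for i
  have b: "\<bar>b i\<bar> \<le> 1" for i using aA unfolding b_def by simp
  have ext: "(\<Sum>i<N. b i *\<^sub>R y (m + i)) = (\<Sum>i<n. (a i / A) *\<^sub>R y (m + i))" if "N \<ge> n" for N m
  proof -
    have "(\<Sum>i<N. b i *\<^sub>R y (m + i)) = (\<Sum>i<n. b i *\<^sub>R y (m + i))"
      using that by (intro sum.mono_neutral_right) (auto simp: b_def)
    then show ?thesis by (simp add: b_def)
  qed
  have "Cauchy (\<lambda>m. norm (\<Sum>i<n. (a i / A) *\<^sub>R y (m + i)))"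
  proof (rule CauchyI)
    fix \<epsilon> :: real assume "\<epsilon> > 0"
    then obtain M where M: "1 / real (Suc M) < \<epsilon>" using nat_approx_posE by blast
    let ?N = "max n M"
    have "1 / real (Suc ?N) \<le> 1 / real (Suc M)" by (simp add: frac_le)
    then have N: "1 / real (Suc ?N) < \<epsilon>" using M by linarith
    have "\<bar>norm (\<Sum>i<n. (a i / A) *\<^sub>R y (m + i)) - norm (\<Sum>i<n. (a i / A) *\<^sub>R y (m' + i))\<bar> < \<epsilon>"
      if "m \<ge> ?N" "m' \<ge> ?N" for m m'
    proof -
      have "\<bar>norm (\<Sum>i<?N. b i *\<^sub>R y (m + i)) - norm (\<Sum>i<?N. b i *\<^sub>R y (m' + i))\<bar> \<le> 1 / real (Suc ?N)"
        using that b by (intro stable_tail_diff[OF st]) (auto simp: strict_mono_on_def)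
      then show ?thesis using N unfolding ext[OF max.cobounded1] by linarith
    qed
    then show "\<exists>M. \<forall>m\<ge>M. \<forall>m'\<ge>M. norm (norm (\<Sum>i<n. (a i / A) *\<^sub>R y (m + i)) -
        norm (\<Sum>i<n. (a i / A) *\<^sub>R y (m' + i))) < \<epsilon>"
      unfolding real_norm_def by blast
  qed
  then have "convergent (\<lambda>m. norm (\<Sum>i<n. (a i / A) *\<^sub>R y (m + i)))"
    by (rule Cauchy_convergent)
  then obtain l where "(\<lambda>m. norm (\<Sum>i<n. (a i / A) *\<^sub>R y (m + i))) \<longlonglongrightarrow> l"
    unfolding convergent_def by blast
  then have "(\<lambda>m. A * norm (\<Sum>i<n. (a i / A) *\<^sub>R y (m + i))) \<longlonglongrightarrow> A * l"
    by (intro tendsto_intros)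
  moreover have "A * norm (\<Sum>i<n. (a i / A) *\<^sub>R y (m + i)) = norm (\<Sum>i<n. a i *\<^sub>R y (m + i))" for m
  proof -
    have "(\<Sum>i<n. a i *\<^sub>R y (m + i)) = A *\<^sub>R (\<Sum>i<n. (a i / A) *\<^sub>R y (m + i))"
      using A by (simp add: scaleR_sum_right)
    then show ?thesis using A by simp
  qed
  ultimately show ?thesis unfolding convergent_def by auto
qed

text \<open>The limits of norms of combinations moving to infinity define a seminorm on finitely
  supported sequences, which \<open>ell_infinity\<close> realizes. The basis inequality survives the
  limit, so \<open>s\<close> is basic with the same \<open>K\<close>, and in particular no
  combination degenerates.\<close>

lemma spreading_model_exists:
  fixes x :: "nat \<Rightarrow> 'a::banach"
  assumes x: "basic_with K x" "normalized x"
  shows "\<exists>r (s :: nat \<Rightarrow> ell_infinity). strict_mono r \<and> spreading_model (x \<circ> r) s"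
proof -
  obtain r where r: "strict_mono r" and st: "\<And>n. stable_upto n (1 / real (Suc n)) (\<lambda>i. x (r (i + n)))"
    using stable_subseq_exists[OF x(2)] by blast
  have shift: "basic_with K (\<lambda>i. x (r (m + i)))" for m
  proof -
    have "strict_mono (\<lambda>i. r (m + i))" using r unfolding strict_mono_def by simp
    then have "block_basis x (x \<circ> (\<lambda>i. r (m + i)))"
      using block_basis_self[of x] basic_with_nonzero[OF x(1)] by (intro block_basis_subseq) auto
    then show ?thesis using basic_with_block_basis[OF x(1)] by (simp add: comp_def)
  qed
  define g where "g n a m = norm (\<Sum>i<n. a i *\<^sub>R x (r (m + i)))" for n m and a :: "nat \<Rightarrow> real"
  have g_lim: "g n a \<longlonglongrightarrow> lim (g n a)" for n a
    using stable_limit_exists[where y = "\<lambda>i. x (r i)" and a = a and n = n, OF st]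
    unfolding g_def convergent_LIMSEQ_iff by simp
  define \<Phi> where "\<Phi> v = lim (\<lambda>m. norm (\<Sum>i\<in>{i. v i \<noteq> 0}. v i *\<^sub>R x (r (m + i))))" for v :: "nat \<Rightarrow> real"
  have \<Phi>_g: "\<Phi> v = lim (g n v)" if "\<And>i. i \<ge> n \<Longrightarrow> v i = 0" for n v
  proof -
    have "{i. v i \<noteq> 0} \<subseteq> {..<n}" using that leI by blast
    then have "(\<Sum>i\<in>{i. v i \<noteq> 0}. v i *\<^sub>R x (r (m + i))) = (\<Sum>i<n. v i *\<^sub>R x (r (m + i)))" for m
      by (intro sum.mono_neutral_left) auto
    then show ?thesis unfolding \<Phi>_def g_def by simp
  qed
  have \<Phi>_lim: "g n v \<longlonglongrightarrow> \<Phi> v" if "\<And>i. i \<ge> n \<Longrightarrow> v i = 0" for n v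
    using g_lim[of n v] \<Phi>_g[of n v, OF that] by simp
  have bound: "\<exists>n. \<forall>i\<ge>n. v i = 0" if "fin_supp v" for v
    using that unfolding fin_supp_def
    by (metis (mono_tags, lifting) finite_nat_set_iff_bounded mem_Collect_eq not_less)
  have sub: "sublinear \<Phi>"
    unfolding sublinear_def
  proof (intro conjI allI impI)
    fix u v assume "fin_supp u" "fin_supp v"
    then obtain n1 n2 where "\<forall>i\<ge>n1. u i = 0" "\<forall>i\<ge>n2. v i = 0" using bound by metis
    then have z: "i \<ge> max n1 n2 \<Longrightarrow> u i = 0" "i \<ge> max n1 n2 \<Longrightarrow> v i = 0" for i by auto
    let ?n = "max n1 n2"
    show "\<Phi> (\<lambda>i. u i + v i) \<le> \<Phi> u + \<Phi> v"
    proof (rule LIMSEQ_le)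
      show "g ?n (\<lambda>i. u i + v i) \<longlonglongrightarrow> \<Phi> (\<lambda>i. u i + v i)" by (rule \<Phi>_lim) (simp add: z)
      show "(\<lambda>m. g ?n u m + g ?n v m) \<longlonglongrightarrow> \<Phi> u + \<Phi> v"
        by (intro tendsto_add \<Phi>_lim z)
      show "\<exists>N. \<forall>m\<ge>N. g ?n (\<lambda>i. u i + v i) m \<le> g ?n u m + g ?n v m"
        unfolding g_def by (simp add: scaleR_add_left sum.distrib norm_triangle_ineq)
    qed
  next
    fix c :: real and v assume c: "c \<ge> 0" and "fin_supp v"
    then obtain n where z: "\<forall>i\<ge>n. v i = 0" using bound by metis
    have "g n (\<lambda>i. c * v i) = (\<lambda>m. c * g n v m)"
      using c unfolding g_def by (simp add: fun_eq_iff flip: scaleR_scaleR scaleR_sum_right)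
    moreover have "g n (\<lambda>i. c * v i) \<longlonglongrightarrow> \<Phi> (\<lambda>i. c * v i)" by (rule \<Phi>_lim) (simp add: z)
    moreover have "(\<lambda>m. c * g n v m) \<longlonglongrightarrow> c * \<Phi> v" by (intro tendsto_mult_left \<Phi>_lim) (simp add: z)
    ultimately show "\<Phi> (\<lambda>i. c * v i) = c * \<Phi> v" using LIMSEQ_unique by simp
  qed
  have "\<Phi> (\<lambda>i. - v i) = \<Phi> v" for v
    unfolding \<Phi>_def by (simp add: sum_negf)
  then obtain s :: "nat \<Rightarrow> ell_infinity" where s:
    "\<And>n a. norm (\<Sum>i<n. a i *\<^sub>R s i) = \<Phi> (\<lambda>i. if i < n then a i else 0)"
    using seminorm_embeds_ell_infinity[OF sub] by blast
  have s_lim: "g n a \<longlonglongrightarrow> norm (\<Sum>i<n. a i *\<^sub>R s i)" for n a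
  proof -
    have "g n a = g n (\<lambda>i. if i < n then a i else 0)" unfolding g_def by simp
    then show ?thesis using \<Phi>_lim[of n "\<lambda>i. if i < n then a i else 0"] s by simp
  qed
  have "basic_with K s"
    unfolding basic_with_def
  proof (intro conjI allI impI)
    fix i
    let ?d = "\<lambda>j::nat. if j = i then 1 else 0 :: real"
    have "(\<Sum>j<Suc i. ?d j *\<^sub>R x (r (m + j))) = x (r (m + i))" for m by simp
    then have "g (Suc i) ?d = (\<lambda>m. 1)"
      using x(2) unfolding g_def normalized_def by (simp add: fun_eq_iff)
    moreover have "(\<Sum>j<Suc i. ?d j *\<^sub>R s j) = s i" by simp
    ultimately have "(\<lambda>m::nat. 1) \<longlonglongrightarrow> norm (s i)" using s_lim[of "Suc i" ?d] by simp
    then have "norm (s i) = 1" using LIMSEQ_unique tendsto_const by metis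
    then show "s i \<noteq> 0" by auto
  next
    fix a :: "nat \<Rightarrow> real" and m n :: nat assume "m \<le> n"
    show "norm (\<Sum>i<m. a i *\<^sub>R s i) \<le> K * norm (\<Sum>i<n. a i *\<^sub>R s i)"
    proof (rule LIMSEQ_le[OF s_lim tendsto_mult_left[OF s_lim]])
      show "\<exists>N. \<forall>k\<ge>N. g m a k \<le> K * g n a k"
        unfolding g_def using basic_with_le[OF shift \<open>m \<le> n\<close>] by blast
    qed
  qed
  then have bs: "basic_sequence s" by (rule basic_with_imp_basic_sequence)
  \<comment> \<open>Stability of order \<open>n\<close> needs indices at least \<open>n\<close>,
    while only \<open>n \<le> Suc (k 0)\<close> is given; the shift by one compensates. The
    numerator 2 makes the final inequality strict.\<close>
  have "spreading_model (x \<circ> (\<lambda>i. r (i + 1))) s"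
    unfolding spreading_model_def
  proof (intro conjI exI[of _ "\<lambda>n. 2 / real (Suc n)"] allI impI)
    show "normalized (x \<circ> (\<lambda>i. r (i + 1)))" using x(2) unfolding normalized_def by simp
    show "basic_sequence (x \<circ> (\<lambda>i. r (i + 1)))"
      using basic_with_imp_basic_sequence[OF shift[of 1]] by (simp add: comp_def)
    show "basic_sequence s" by (rule bs)
    show "decseq (\<lambda>n. 2 / real (Suc n))"
      by (intro decseq_SucI divide_left_mono) simp_all
    show "(\<lambda>n. 2 / real (Suc n)) \<longlonglongrightarrow> 0"
      by (rule LIMSEQ_Suc[OF lim_const_over_n])
    fix n :: nat and a :: "nat \<Rightarrow> real" and k :: "nat \<Rightarrow> nat"
    assume a: "\<forall>i<n. a i \<in> {-1..1}" and kn: "n \<le> Suc (k 0)" and k: "strict_mono_on {..<n} k"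
    let ?L = "norm (\<Sum>i<n. a i *\<^sub>R (x \<circ> (\<lambda>i. r (i + 1))) (k i))"
    have a': "\<forall>i<n. \<bar>a i\<bar> \<le> 1" using a by auto
    have k': "strict_mono_on {..<n} (\<lambda>i. k i + 1)" using k unfolding strict_mono_on_def by simp
    have "\<bar>?L - g n a m\<bar> \<le> 1 / real (Suc n)" if "m \<ge> n" for m
    proof -
      have "strict_mono_on {..<n} (\<lambda>i. m + i)" unfolding strict_mono_on_def by simp
      from stable_tail_diff[where y = "\<lambda>i. x (r i)", OF st a' k' this] kn that
      show ?thesis unfolding g_def by simp
    qed
    then have "\<exists>N. \<forall>m\<ge>N. \<bar>?L - g n a m\<bar> \<le> 1 / real (Suc n)" by blast
    moreover have "(\<lambda>m. \<bar>?L - g n a m\<bar>) \<longlonglongrightarrow> \<bar>?L - norm (\<Sum>i<n. a i *\<^sub>R s i)\<bar>"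
      by (intro tendsto_intros s_lim)
    ultimately have "\<bar>?L - norm (\<Sum>i<n. a i *\<^sub>R s i)\<bar> \<le> 1 / real (Suc n)"
      using LIMSEQ_le_const2 by blast
    also have "\<dots> < 2 / real (Suc n)" by (simp add: divide_strict_right_mono)
    finally show "\<bar>?L - norm (\<Sum>i<n. a i *\<^sub>R s i)\<bar> < 2 / real (Suc n)" .
  qed
  moreover have "strict_mono (\<lambda>i. r (i + 1))" using r unfolding strict_mono_def by simp
  ultimately show ?thesis by blast
qed

section \<open>Norms of sums of two far apart vectors\<close>

text \<open>The error permitted for exactly \<open>n\<close> terms need not be small. Padding with
  zero coefficients to \<open>M\<close> terms replaces it by \<open>\<delta> M\<close>; the
  additional indices only have to increase.\<close>

lemma spreading_model_approx:
  fixes x :: "nat \<Rightarrow> 'a::banach" and s :: "nat \<Rightarrow> 'b::banach"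
  assumes sp: "spreading_model x s" and n: "n > 0" and \<epsilon>: "\<epsilon> > 0"
  shows "\<exists>N. \<forall>(a :: nat \<Rightarrow> real) k. (\<forall>i<n. \<bar>a i\<bar> \<le> 1) \<longrightarrow> strict_mono_on {..<n} k \<longrightarrow> N \<le> k 0 \<longrightarrow>
    \<bar>norm (\<Sum>i<n. a i *\<^sub>R x (k i)) - norm (\<Sum>i<n. a i *\<^sub>R s i)\<bar> < \<epsilon>"
proof -
  obtain \<delta> :: "nat \<Rightarrow> real" where \<delta>: "\<delta> \<longlonglongrightarrow> 0"
    and ap: "\<forall>n\<ge>1. \<forall>(a :: nat \<Rightarrow> real) (k :: nat \<Rightarrow> nat).
           (\<forall>i<n. a i \<in> {-1..1}) \<longrightarrow> n \<le> Suc (k 0) \<longrightarrow> strict_mono_on {..<n} k \<longrightarrow>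
           \<bar>norm (\<Sum>i<n. a i *\<^sub>R x (k i)) - norm (\<Sum>i<n. a i *\<^sub>R s i)\<bar> < \<delta> n"
    using sp unfolding spreading_model_def by blast
  obtain M0 where M0: "\<And>m. m \<ge> M0 \<Longrightarrow> \<delta> m < \<epsilon>"
    using order_tendstoD(2)[OF \<delta> \<epsilon>] unfolding eventually_sequentially by blast
  define M where "M = max n M0"
  have M: "M \<ge> 1" "n \<le> M" "\<delta> M < \<epsilon>" using n M0 unfolding M_def by auto
  have "\<bar>norm (\<Sum>i<n. a i *\<^sub>R x (k i)) - norm (\<Sum>i<n. a i *\<^sub>R s i)\<bar> < \<epsilon>"
    if a: "\<forall>i<n. \<bar>a i\<bar> \<le> 1" and k: "strict_mono_on {..<n} k" and Mk: "M \<le> k 0"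
    for a :: "nat \<Rightarrow> real" and k
  proof -
    define b where "b i = (if i < n then a i else 0)" for i
    define l where "l i = (if i < n then k i else k (n - 1) + i)" for i
    have "strict_mono_on {..<M} l"
    proof (rule strict_mono_onI)
      fix i j :: nat assume "i < j"
      moreover have "k i \<le> k (n - 1)" if "i < n"
        using strict_mono_on_leD[OF k, of i "n - 1"] that n by simp
      ultimately show "l i < l j"
        using strict_mono_onD[OF k, of i j] n unfolding l_def by auto
    qed
    moreover have "M \<le> Suc (l 0)" using Mk n unfolding l_def by simp
    moreover have "\<forall>i<M. b i \<in> {-1..1}" using a unfolding b_def by (auto simp: abs_le_iff)
    ultimately have "\<bar>norm (\<Sum>i<M. b i *\<^sub>R x (l i)) - norm (\<Sum>i<M. b i *\<^sub>R s i)\<bar> < \<delta> M"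
      using ap M(1) by blast
    moreover have "(\<Sum>i<M. b i *\<^sub>R x (l i)) = (\<Sum>i<n. b i *\<^sub>R x (l i))"
      using M(2) by (intro sum.mono_neutral_right) (auto simp: b_def)
    moreover have "(\<Sum>i<M. b i *\<^sub>R s i) = (\<Sum>i<n. b i *\<^sub>R s i)"
      using M(2) by (intro sum.mono_neutral_right) (auto simp: b_def)
    ultimately show ?thesis using M(3) by (simp add: b_def l_def)
  qed
  then show ?thesis by blast
qed

text \<open>Captures \<open>norm (s 0 + s 1)\<close> without reference to a spreading model, and
  also makes sense for sequences that are not normalized, such as sums of blocks.\<close>

definition pairlim :: "(nat \<Rightarrow> 'a::real_normed_vector) \<Rightarrow> real \<Rightarrow> bool" where
  "pairlim v L \<longleftrightarrow> (\<forall>\<epsilon>>0. \<exists>n. \<forall>i\<ge>n. \<forall>j>i. \<bar>norm (v i + v j) - L\<bar> < \<epsilon>)"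

lemma pairlimD: "pairlim v L \<Longrightarrow> \<epsilon> > 0 \<Longrightarrow> \<exists>n. \<forall>i\<ge>n. \<forall>j>i. \<bar>norm (v i + v j) - L\<bar> < \<epsilon>"
  unfolding pairlim_def by blast

lemma pairlim_subseq:
  assumes "pairlim v L" "strict_mono r"
  shows "pairlim (v \<circ> r) L"
  unfolding pairlim_def
proof (intro allI impI)
  fix \<epsilon> :: real assume "\<epsilon> > 0"
  then obtain n where n: "\<forall>i\<ge>n. \<forall>j>i. \<bar>norm (v i + v j) - L\<bar> < \<epsilon>" using pairlimD[OF assms(1)] by blast
  have "\<bar>norm ((v \<circ> r) i + (v \<circ> r) j) - L\<bar> < \<epsilon>" if "i \<ge> n" "j > i" for i j
    using n that seq_suble[OF assms(2), of i] strict_monoD[OF assms(2), of i j] by simp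
  then show "\<exists>n. \<forall>i\<ge>n. \<forall>j>i. \<bar>norm ((v \<circ> r) i + (v \<circ> r) j) - L\<bar> < \<epsilon>" by blast
qed

lemma pairlim_close:
  assumes v: "pairlim v L" and w: "pairlim w M"
    and d: "\<And>i j. i < j \<Longrightarrow> \<bar>norm (v i + v j) - norm (w i + w j)\<bar> \<le> \<delta>"
  shows "\<bar>L - M\<bar> \<le> \<delta>"
proof (rule field_le_epsilon)
  fix \<epsilon> :: real assume "\<epsilon> > 0"
  then have "\<epsilon>/2 > 0" by simp
  obtain n where n: "\<forall>i\<ge>n. \<forall>j>i. \<bar>norm (v i + v j) - L\<bar> < \<epsilon>/2" using pairlimD[OF v \<open>\<epsilon>/2 > 0\<close>] by blast
  obtain m where m: "\<forall>i\<ge>m. \<forall>j>i. \<bar>norm (w i + w j) - M\<bar> < \<epsilon>/2" using pairlimD[OF w \<open>\<epsilon>/2 > 0\<close>] by blast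
  let ?i = "max n m"
  have "\<bar>norm (v ?i + v (Suc ?i)) - L\<bar> < \<epsilon>/2" "\<bar>norm (w ?i + w (Suc ?i)) - M\<bar> < \<epsilon>/2"
    using n m by simp_all
  with d[of ?i "Suc ?i"] show "\<bar>L - M\<bar> \<le> \<delta> + \<epsilon>" by linarith
qed

lemma pairlim_unique: "pairlim v L \<Longrightarrow> pairlim v M \<Longrightarrow> L = M"
  using pairlim_close[of v L v M 0] by simp

lemma pairlim_spreading_model:
  fixes x :: "nat \<Rightarrow> 'a::banach" and s :: "nat \<Rightarrow> 'b::banach"
  assumes "spreading_model x s"
  shows "pairlim x (norm (s 0 + s 1))"
  unfolding pairlim_def
proof (intro allI impI)
  fix \<epsilon> :: real assume "\<epsilon> > 0"
  then obtain N where N: "\<forall>(a :: nat \<Rightarrow> real) k. (\<forall>i<2. \<bar>a i\<bar> \<le> 1) \<longrightarrow> strict_mono_on {..<2} k \<longrightarrow> N \<le> k 0 \<longrightarrow>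
      \<bar>norm (\<Sum>i<2. a i *\<^sub>R x (k i)) - norm (\<Sum>i<2. a i *\<^sub>R s i)\<bar> < \<epsilon>"
    using spreading_model_approx[OF assms, of 2 \<epsilon>] by auto
  have "\<bar>norm (x i + x j) - norm (s 0 + s 1)\<bar> < \<epsilon>" if "i \<ge> N" "j > i" for i j
  proof -
    have "strict_mono_on {..<2} (\<lambda>m::nat. if m = 0 then i else j)"
      using that by (auto simp: strict_mono_on_def)
    then show ?thesis
      using N[rule_format, of "\<lambda>_. 1" "\<lambda>m. if m = 0 then i else j"] that
      by (simp add: numeral_2_eq_2)
  qed
  then show "\<exists>n. \<forall>i\<ge>n. \<forall>j>i. \<bar>norm (x i + x j) - norm (s 0 + s 1)\<bar> < \<epsilon>" by blast
qed

lemma block_basis_normalize: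
  assumes "block_basis e v"
  shows "block_basis e (\<lambda>i. sgn (v i))" "normalized (\<lambda>i. sgn (v i))"
proof -
  note nz = block_basis_nonzero[OF assms]
  show "block_basis e (\<lambda>i. sgn (v i))"
    by (rule block_basis_blocks[OF assms, where S = "\<lambda>k. {k}" and d = "\<lambda>k _. inverse (norm (v k))"])
       (auto simp: successive_def sgn_div_norm nz)
  show "normalized (\<lambda>i. sgn (v i))" unfolding normalized_def using nz by (simp add: norm_sgn)
qed

text \<open>Sums and averages of blocks are not normalized, but their norms converge along suitable
  subsequences. Then \<open>v i\<close> is close to \<open>c *\<^sub>R sgn (v i)\<close>, and the
  limit for the normalized vectors is multiplied by \<open>c\<close>.\<close>

lemma pairlim_scale:
  fixes v :: "nat \<Rightarrow> 'a::real_normed_vector"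
  assumes v: "\<And>i. v i \<noteq> 0" and c: "(\<lambda>i. norm (v i)) \<longlonglongrightarrow> c" and L: "pairlim (\<lambda>i. sgn (v i)) L"
  shows "pairlim v (c * L)"
  unfolding pairlim_def
proof (intro allI impI)
  fix \<epsilon> :: real assume "\<epsilon> > 0"
  have c0: "c \<ge> 0" using c by (rule LIMSEQ_le_const) simp
  obtain N1 where N1: "\<forall>i\<ge>N1. \<bar>norm (v i) - c\<bar> < \<epsilon> / 4"
    using LIMSEQ_D[OF c, of "\<epsilon> / 4"] \<open>\<epsilon> > 0\<close> by auto
  obtain N2 where N2: "\<forall>i\<ge>N2. \<forall>j>i. \<bar>norm (sgn (v i) + sgn (v j)) - L\<bar> < \<epsilon> / (2 * (c + 1))"
    using pairlimD[OF L, of "\<epsilon> / (2 * (c + 1))"] c0 \<open>\<epsilon> > 0\<close> by auto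
  have "\<bar>norm (v i + v j) - c * L\<bar> < \<epsilon>" if i: "i \<ge> max N1 N2" and j: "j > i" for i j
  proof -
    have dec: "norm (v k - c *\<^sub>R sgn (v k)) = \<bar>norm (v k) - c\<bar>" for k
    proof -
      have "v k - c *\<^sub>R sgn (v k) = (norm (v k) - c) *\<^sub>R sgn (v k)"
      proof -
        have "norm (v k) *\<^sub>R sgn (v k) = v k" using v[of k] by (simp add: sgn_div_norm)
        then show ?thesis by (simp add: scaleR_diff_left)
      qed
      then show ?thesis using v[of k] by (simp add: norm_sgn)
    qed
    have "\<bar>norm (v i + v j) - norm (c *\<^sub>R sgn (v i) + c *\<^sub>R sgn (v j))\<bar>
        \<le> norm ((v i - c *\<^sub>R sgn (v i)) + (v j - c *\<^sub>R sgn (v j)))"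
      using norm_triangle_ineq3[of "v i + v j" "c *\<^sub>R sgn (v i) + c *\<^sub>R sgn (v j)"]
      by (simp add: algebra_simps)
    also have "\<dots> \<le> \<bar>norm (v i) - c\<bar> + \<bar>norm (v j) - c\<bar>"
      using norm_triangle_ineq[of "v i - c *\<^sub>R sgn (v i)" "v j - c *\<^sub>R sgn (v j)"] unfolding dec .
    also have "\<dots> < \<epsilon> / 2"
      using N1[rule_format, of i] N1[rule_format, of j] i j by simp
    finally have 1: "\<bar>norm (v i + v j) - norm (c *\<^sub>R sgn (v i) + c *\<^sub>R sgn (v j))\<bar> < \<epsilon> / 2" .
    have "norm (c *\<^sub>R sgn (v i) + c *\<^sub>R sgn (v j)) = c * norm (sgn (v i) + sgn (v j))"
      using c0 by (simp flip: scaleR_add_right)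
    then have "\<bar>norm (c *\<^sub>R sgn (v i) + c *\<^sub>R sgn (v j)) - c * L\<bar> = c * \<bar>norm (sgn (v i) + sgn (v j)) - L\<bar>"
      using c0 by (simp add: abs_mult flip: right_diff_distrib)
    also have "\<dots> \<le> c * (\<epsilon> / (2 * (c + 1)))"
      using N2 i j c0 by (intro mult_left_mono) (auto intro: less_imp_le)
    also have "\<dots> \<le> \<epsilon> / 2" using c0 \<open>\<epsilon> > 0\<close> by (simp add: field_simps)
    finally show ?thesis using 1 by linarith
  qed
  then show "\<exists>n. \<forall>i\<ge>n. \<forall>j>i. \<bar>norm (v i + v j) - c * L\<bar> < \<epsilon>" by blast
qed

lemma norm_sgn_diff_le:
  fixes u v :: "'a::real_normed_vector"
  assumes "u \<noteq> 0" "v \<noteq> 0"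
  shows "norm (sgn u - sgn v) \<le> 2 * norm (u - v) / norm u"
proof -
  have "sgn u - sgn v = (1 / norm u) *\<^sub>R (u - v) + ((norm v - norm u) / norm u) *\<^sub>R sgn v"
  proof -
    have "1 / norm u = 1 / norm v + (norm v - norm u) / norm u * (1 / norm v)"
      using assms by (simp add: field_simps)
    then have "(1 / norm u) *\<^sub>R v = (1 / norm v) *\<^sub>R v + ((norm v - norm u) / norm u * (1 / norm v)) *\<^sub>R v"
      by (metis scaleR_add_left)
    then show ?thesis
      by (simp add: sgn_div_norm scaleR_diff_right inverse_eq_divide)
  qed
  also have "norm \<dots> \<le> norm ((1 / norm u) *\<^sub>R (u - v)) + norm (((norm v - norm u) / norm u) *\<^sub>R sgn v)"
    by (rule norm_triangle_ineq)
  also have "\<dots> = norm (u - v) / norm u + \<bar>norm v - norm u\<bar> / norm u"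
    using assms by (simp add: norm_sgn)
  also have "\<dots> \<le> 2 * norm (u - v) / norm u"
    using norm_triangle_ineq3[of v u] by (simp add: divide_right_mono norm_minus_commute flip: add_divide_distrib)
  finally show ?thesis .
qed

lemma successiveI:
  assumes fin: "\<And>k. finite (S k)" and ne: "\<And>k. S k \<noteq> {}"
    and less: "\<And>k i j. i \<in> S k \<Longrightarrow> j \<in> S (Suc k) \<Longrightarrow> i < j"
  shows "successive S"
  unfolding successive_def
proof (intro conjI allI impI)
  fix k l :: nat assume "k < l"
  then show "\<forall>i\<in>S k. \<forall>j\<in>S l. i < j"
  proof (induction l rule: less_Suc_induct)
    case (1 k)
    then show ?case using less by blast
  next
    case (2 k l m)
    then show ?case using ne[of l] by (meson all_not_in_conv order_less_trans)
  qed
qed (rule fin)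

text \<open>The supports of two block bases may overlap, and combinations of one member of each
  would then not form a block sequence. Subsequences with alternating supports repair this; they
  exist because \<open>p\<close> and \<open>q\<close> tend to infinity.\<close>

lemma block_basis_interlace:
  fixes e :: "nat \<Rightarrow> 'a::real_normed_vector"
  assumes x: "block_basis e x" and y: "block_basis e y"
  shows "\<exists>m n. strict_mono m \<and> strict_mono n \<and>
    block_basis e (\<lambda>k. if even k then x (m (k div 2)) else y (n (k div 2)))"
proof -
  obtain p a where p: "strict_mono p" and xa: "\<And>k. x k = (\<Sum>i\<in>{p k..<p (Suc k)}. a i *\<^sub>R e i)"
    using x unfolding block_basis_def by blast
  obtain q b where q: "strict_mono q" and yb: "\<And>k. y k = (\<Sum>i\<in>{q k..<q (Suc k)}. b i *\<^sub>R e i)"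
    using y unfolding block_basis_def by blast
  have "\<exists>f. \<forall>k. p (Suc (fst (f k))) \<le> q (snd (f k)) \<and>
      (q (Suc (snd (f k))) \<le> p (fst (f (Suc k))) \<and> fst (f k) < fst (f (Suc k)) \<and> snd (f k) < snd (f (Suc k)))"
  proof (rule dependent_nat_choice)
    show "\<exists>z. p (Suc (fst z)) \<le> q (snd z)"
      using seq_suble[OF q] by (intro exI[of _ "(0, p (Suc 0))"]) simp
    fix z :: "nat \<times> nat" and k :: nat
    define m' where "m' = max (Suc (fst z)) (q (Suc (snd z)))"
    define n' where "n' = max (Suc (snd z)) (p (Suc m'))"
    have "q (Suc (snd z)) \<le> p m'" using seq_suble[OF p, of m'] unfolding m'_def by linarith
    moreover have "p (Suc m') \<le> q n'" using seq_suble[OF q, of n'] unfolding n'_def by linarith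
    moreover have "fst z < m'" "snd z < n'" unfolding m'_def n'_def by simp_all
    ultimately show "\<exists>z'. p (Suc (fst z')) \<le> q (snd z') \<and>
        (q (Suc (snd z)) \<le> p (fst z') \<and> fst z < fst z' \<and> snd z < snd z')"
      by (intro exI[of _ "(m', n')"]) simp
  qed
  then obtain f where f: "\<And>k. p (Suc (fst (f k))) \<le> q (snd (f k))"
    "\<And>k. q (Suc (snd (f k))) \<le> p (fst (f (Suc k)))"
    "\<And>k. fst (f k) < fst (f (Suc k))" "\<And>k. snd (f k) < snd (f (Suc k))"
    by blast
  define m where "m k = fst (f k)" for k
  define n where "n k = snd (f k)" for k
  have "strict_mono m" "strict_mono n"
    unfolding strict_mono_Suc_iff m_def n_def using f by auto
  define S where "S k = (if even k then {p (m (k div 2))..<p (Suc (m (k div 2)))}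
     else {q (n (k div 2))..<q (Suc (n (k div 2)))})" for k
  have "successive S"
  proof (rule successiveI)
    show "finite (S k)" "S k \<noteq> {}" for k
      using strict_monoD[OF p, of "m (k div 2)" "Suc (m (k div 2))"]
        strict_monoD[OF q, of "n (k div 2)" "Suc (n (k div 2))"] unfolding S_def by auto
    fix k i j assume "i \<in> S k" "j \<in> S (Suc k)"
    then show "i < j"
      using f(1)[of "k div 2"] f(2)[of "k div 2"] unfolding S_def m_def n_def
      by (cases "even k") auto
  qed
  then have "block_basis e (\<lambda>k. if even k then x (m (k div 2)) else y (n (k div 2)))"
  proof (rule block_basisI[where c = "\<lambda>k. if even k then a else b"])
    show "(if even k then x (m (k div 2)) else y (n (k div 2))) =
        (\<Sum>i\<in>S k. (if even k then a else b) i *\<^sub>R e i)" for k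
      unfolding S_def by (simp add: xa yb)
    show "(if even k then x (m (k div 2)) else y (n (k div 2))) \<noteq> 0" for k
      using block_basis_nonzero[OF x] block_basis_nonzero[OF y] by simp
  qed
  with \<open>strict_mono m\<close> \<open>strict_mono n\<close> show ?thesis by blast
qed

text \<open>The path \<open>(1 - t) x + t y\<close>, normalized, would lead from the value 2 to a value at most 1,
  but the values along it avoid the interval between 1 and 2.\<close>

lemma no_mixed_pairlim:
  fixes e :: "nat \<Rightarrow> 'a::real_normed_vector"
  assumes e: "basic_with K e"
    and gap: "\<And>x. block_basis e x \<Longrightarrow> normalized x \<Longrightarrow>
      \<exists>r L. strict_mono r \<and> pairlim (x \<circ> r) L \<and> (L \<le> 1 \<or> L = 2)"
    and x: "block_basis e x" "normalized x" "pairlim x 2"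
    and y: "block_basis e y" "normalized y" "pairlim y L" "L \<le> 1"
  shows False
proof -
  obtain m n where mn: "strict_mono m" "strict_mono n"
    and w: "block_basis e (\<lambda>k. if even k then x (m (k div 2)) else y (n (k div 2)))"
    using block_basis_interlace[OF x(1) y(1)] by blast
  define w where "w k = (if even k then x (m (k div 2)) else y (n (k div 2)))" for k
  have w: "block_basis e w" using w unfolding w_def .
  have K: "K \<ge> 1" using basic_with_ge_1[OF e] .
  have w_basic: "basic_with K w" by (rule basic_with_block_basis[OF e w])
  have nw: "norm (w k) = 1" for k using x(2) y(2) unfolding w_def normalized_def by simp
  define z where "z t i = (1 - t) *\<^sub>R w (2 * i) + t *\<^sub>R w (Suc (2 * i))" for t i
  \<comment> \<open>The coefficients \<open>1 - t\<close> and \<open>t\<close> have absolute values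
    adding up to at least 1, so the basis inequality keeps the path away from 0. Normalization is
    therefore Lipschitz in \<open>t\<close>, uniformly in \<open>i\<close>.\<close>
  have z_ge: "norm (z t i) \<ge> 1 / (4 * K)" for t i
  proof -
    define d where "d j = (if j = 2 * i then 1 - t else if j = Suc (2 * i) then t else 0)" for j
    have "(\<Sum>j<Suc (Suc (2 * i)). d j *\<^sub>R w j) = z t i"
      unfolding z_def d_def by simp
    then have "\<bar>d j\<bar> \<le> 2 * K * norm (z t i)" if "j < Suc (Suc (2 * i))" for j
      using basic_with_coeff_le[OF w_basic that, of d] nw by simp
    from this[of "2 * i"] this[of "Suc (2 * i)"]
    have "\<bar>1 - t\<bar> \<le> 2 * K * norm (z t i)" "\<bar>t\<bar> \<le> 2 * K * norm (z t i)"
      unfolding d_def by simp_all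
    then have "1 \<le> 4 * K * norm (z t i)" by linarith
    then show ?thesis using K by (simp add: field_simps)
  qed
  then have z_nz: "z t i \<noteq> 0" for t i
    using K by (metis divide_pos_pos less_le_not_le norm_zero mult_pos_pos zero_less_numeral zero_less_one order_less_le_trans)
  have z_block: "block_basis e (z t)" for t
  proof (rule block_basis_blocks[OF w, where S = "\<lambda>i. {2 * i, Suc (2 * i)}"
        and d = "\<lambda>i j. if even j then 1 - t else t"])
    show "successive (\<lambda>i. {2 * i, Suc (2 * i)})" by (rule successiveI) auto
    show "z t k = (\<Sum>j\<in>{2 * k, Suc (2 * k)}. (if even j then 1 - t else t) *\<^sub>R w j)" for k
      unfolding z_def by simp
  qed (rule z_nz)
  define u where "u t i = sgn (z t i)" for t i
  have u_block: "block_basis e (u t)" "normalized (u t)" for t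
    using block_basis_normalize[OF z_block, of t] unfolding u_def by simp_all
  have u_diff: "norm (u t i - u s i) \<le> 16 * K * \<bar>t - s\<bar>" for t s i
  proof -
    have "z t i - z s i = (t - s) *\<^sub>R (w (Suc (2 * i)) - w (2 * i))"
      unfolding z_def by (simp add: algebra_simps)
    then have "norm (z t i - z s i) \<le> \<bar>t - s\<bar> * 2"
      using norm_triangle_ineq4[of "w (Suc (2 * i))" "w (2 * i)"] nw by (simp add: mult_left_mono)
    then have "2 * norm (z t i - z s i) / norm (z t i) \<le> 2 * (\<bar>t - s\<bar> * 2) / (1 / (4 * K))"
      using z_ge[of t i] K by (intro frac_le) simp_all
    with norm_sgn_diff_le[OF z_nz z_nz, of t i s i] show ?thesis
      unfolding u_def by (simp add: algebra_simps)
  qed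
  \<comment> \<open>A step of length \<open>1 / N\<close> moves each normalized vector by at most
    1/4 and hence a pair limit by at most 1/2. This is too little to leave the value 2 for a value
    at most 1, so 2 persists through all \<open>N\<close> steps.\<close>
  obtain N :: nat where N: "N > 0" "32 * K / real N \<le> 1 / 2"
  proof -
    obtain N :: nat where "64 * K < real N" using reals_Archimedean2 by blast
    moreover from this have "N > 0" using K by (cases N) auto
    ultimately show ?thesis using that[of N] by (simp add: field_simps)
  qed
  have "k \<le> N \<longrightarrow> (\<exists>r. strict_mono r \<and> pairlim (u (real k / real N) \<circ> r) 2)" for k
  proof (induction k)
    case 0
    have "u 0 = x \<circ> m"
      using x(2) by (auto simp: u_def z_def w_def normalized_def sgn_div_norm fun_eq_iff)
    then have "pairlim (u 0 \<circ> id) 2" using pairlim_subseq[OF x(3) mn(1)] by simp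
    then show ?case by (intro impI exI[of _ id]) (simp add: strict_mono_def)
  next
    case (Suc k)
    show ?case
    proof
      assume "Suc k \<le> N"
      then obtain r where r: "strict_mono r" "pairlim (u (real k / real N) \<circ> r) 2"
        using Suc Suc_leD by blast
      let ?v = "u (real (Suc k) / real N)"
      have "normalized (?v \<circ> r)" using u_block(2) unfolding normalized_def by simp
      then obtain r' L' where r': "strict_mono r'" "pairlim (?v \<circ> r \<circ> r') L'" "L' \<le> 1 \<or> L' = 2"
        using gap[OF block_basis_subseq[OF u_block(1) r(1)]] by blast
      have near: "norm (?v i - u (real k / real N) i) \<le> 1 / 4" for i
      proof -
        have "norm (?v i - u (real k / real N) i) \<le> 16 * K * \<bar>real (Suc k) / real N - real k / real N\<bar>"
          by (rule u_diff)
        also have "real (Suc k) / real N - real k / real N = 1 / real N"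
          by (simp add: diff_divide_distrib[symmetric])
        also have "16 * K * \<bar>1 / real N\<bar> = (32 * K / real N) / 2" by simp
        also have "(32 * K / real N) / 2 \<le> (1 / 2) / 2" by (rule divide_right_mono[OF N(2)]) simp
        finally show ?thesis by simp
      qed
      have "\<bar>L' - 2\<bar> \<le> 1 / 2"
      proof (rule pairlim_close[OF r'(2) pairlim_subseq[OF r(2) r'(1)]])
        fix i j :: nat
        let ?i = "r (r' i)" and ?j = "r (r' j)" and ?w = "u (real k / real N)"
        have "\<bar>norm (?v ?i + ?v ?j) - norm (?w ?i + ?w ?j)\<bar> \<le> norm ((?v ?i + ?v ?j) - (?w ?i + ?w ?j))"
          by (rule norm_triangle_ineq3)
        also have "(?v ?i + ?v ?j) - (?w ?i + ?w ?j) = (?v ?i - ?w ?i) + (?v ?j - ?w ?j)" by simp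
        also have "norm \<dots> \<le> 1 / 4 + 1 / 4" using near by (intro norm_triangle_mono)
        finally show "\<bar>norm ((?v \<circ> r \<circ> r') i + (?v \<circ> r \<circ> r') j) -
            norm ((?w \<circ> r \<circ> r') i + (?w \<circ> r \<circ> r') j)\<bar> \<le> 1 / 2" by simp
      qed
      then have "L' = 2" using r'(3) by auto
      then show "\<exists>r. strict_mono r \<and> pairlim (?v \<circ> r) 2"
        using r'(2) strict_mono_o[OF r(1) r'(1)] unfolding comp_assoc by blast
    qed
  qed
  from this[of N] obtain r where r: "strict_mono r" "pairlim (u 1 \<circ> r) 2" using N(1) by auto
  have "u 1 = y \<circ> n"
    using y(2) by (auto simp: u_def z_def w_def normalized_def sgn_div_norm fun_eq_iff)
  then have "pairlim (u 1 \<circ> r) L" using pairlim_subseq[OF pairlim_subseq[OF y(3) mn(2)] r(1)] by simp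
  then show False using pairlim_unique[OF r(2)] y(4) by fastforce
qed

lemma pairlim_dichotomy:
  fixes e :: "nat \<Rightarrow> 'a::real_normed_vector"
  assumes e: "basic_with K e"
    and gap: "\<And>x. block_basis e x \<Longrightarrow> normalized x \<Longrightarrow>
      \<exists>r L. strict_mono r \<and> pairlim (x \<circ> r) L \<and> (L \<le> 1 \<or> L = 2)"
  shows "(\<forall>x. block_basis e x \<longrightarrow> normalized x \<longrightarrow> (\<exists>r. strict_mono r \<and> pairlim (x \<circ> r) 2)) \<or>
    (\<forall>x. block_basis e x \<longrightarrow> normalized x \<longrightarrow> (\<exists>r L. strict_mono r \<and> pairlim (x \<circ> r) L \<and> L \<le> 1))"
proof (rule ccontr)
  have sub: "block_basis e (x \<circ> r)" "normalized (x \<circ> r)"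
    if "block_basis e x" "normalized x" "strict_mono r" for x r
    using that block_basis_subseq by (auto simp: normalized_def)
  assume "\<not> ?thesis"
  then obtain x y where x: "block_basis e x" "normalized x" "\<nexists>r L. strict_mono r \<and> pairlim (x \<circ> r) L \<and> L \<le> 1"
    and y: "block_basis e y" "normalized y" "\<nexists>r. strict_mono r \<and> pairlim (y \<circ> r) 2"
    by blast
  obtain r where r: "strict_mono r" "pairlim (x \<circ> r) 2" using gap[OF x(1,2)] x(3) by blast
  obtain r' L where r': "strict_mono r'" "pairlim (y \<circ> r') L" "L \<le> 1" using gap[OF y(1,2)] y(3) by blast
  show False
    by (rule no_mixed_pairlim[OF e gap sub[OF x(1,2) r(1)] r(2) sub[OF y(1,2) r'(1)] r'(2,3)])
qed

lemma block_pairlim: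
  fixes e :: "nat \<Rightarrow> 'a::real_normed_vector"
  assumes H: "\<And>x. block_basis e x \<Longrightarrow> normalized x \<Longrightarrow> \<exists>r L. strict_mono r \<and> pairlim (x \<circ> r) L \<and> P L"
    and v: "block_basis e v" "(\<lambda>i. norm (v i)) \<longlonglongrightarrow> c"
  shows "\<exists>r L. strict_mono r \<and> pairlim (v \<circ> r) (c * L) \<and> P L"
proof -
  obtain r L where r: "strict_mono r" "pairlim ((\<lambda>i. sgn (v i)) \<circ> r) L" "P L"
    using H[OF block_basis_normalize[OF v(1)]] by blast
  have "(\<lambda>i. norm ((v \<circ> r) i)) \<longlonglongrightarrow> c"
    using LIMSEQ_subseq_LIMSEQ[OF v(2) r(1)] by (simp add: comp_def)
  then have "pairlim (v \<circ> r) (c * L)"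
    using r(2) block_basis_nonzero[OF v(1)] by (intro pairlim_scale) (simp_all add: comp_def)
  then show ?thesis using r by blast
qed

section \<open>Galvin's lemma and bar induction\<close>

text \<open>Vacuously true if one side is empty; thus \<open>{}\<close> is an initial segment of
  every set, as the start of the bar inductions requires.\<close>

definition before :: "nat set \<Rightarrow> nat set \<Rightarrow> bool" (infix "\<lless>" 50) where
  "A \<lless> B \<longleftrightarrow> (\<forall>i\<in>A. \<forall>j\<in>B. i < j)"

lemma increasing_sequence_exists:
  assumes "P {}" and step: "\<And>S m. finite S \<Longrightarrow> P S \<Longrightarrow> \<exists>k\<ge>m. P (insert k S)"
  shows "\<exists>k :: nat \<Rightarrow> nat. strict_mono k \<and> (\<forall>i. P (k ` {..<i}))"
proof -
  have "\<exists>f. \<forall>i. (finite (f i) \<and> P (f i) \<and> (i = 0 \<longrightarrow> f i = {})) \<and>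
      (\<exists>k. (\<forall>j\<in>f i. j < k) \<and> f (Suc i) = insert k (f i))"
  proof (rule dependent_nat_choice)
    show "\<exists>S. finite S \<and> P S \<and> ((0::nat) = 0 \<longrightarrow> S = {})" using assms(1) by auto
    fix S and i :: nat assume S: "finite S \<and> P S \<and> (i = 0 \<longrightarrow> S = {})"
    then obtain k where k: "k \<ge> Suc (Max (insert 0 S))" "P (insert k S)" using step by blast
    have "\<forall>j\<in>S. j < k"
    proof
      fix j assume "j \<in> S"
      then have "j \<le> Max (insert 0 S)" using S by (intro Max_ge) auto
      then show "j < k" using k(1) by simp
    qed
    with k(2) show "\<exists>S'. (finite S' \<and> P S' \<and> (Suc i = 0 \<longrightarrow> S' = {})) \<and> (\<exists>k. (\<forall>j\<in>S. j < k) \<and> S' = insert k S)"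
      using S by (intro exI[of _ "insert k S"] conjI exI[of _ k]) simp_all
  qed
  then obtain f where F: "\<forall>i. (finite (f i) \<and> P (f i) \<and> (i = 0 \<longrightarrow> f i = {})) \<and>
      (\<exists>k. (\<forall>j\<in>f i. j < k) \<and> f (Suc i) = insert k (f i))" ..
  have f: "P (f i)" "i = 0 \<longrightarrow> f i = {}" "\<exists>k. (\<forall>j\<in>f i. j < k) \<and> f (Suc i) = insert k (f i)" for i
    using F[THEN spec, of i] by - (elim conjE, assumption)+
  from choice[OF allI[OF f(3)]] obtain k
    where "\<forall>i. (\<forall>j\<in>f i. j < k i) \<and> f (Suc i) = insert (k i) (f i)" ..
  then have k: "\<forall>j\<in>f i. j < k i" "f (Suc i) = insert (k i) (f i)" for i by simp_all
  have "f i = k ` {..<i}" for i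
    by (induction i) (simp_all add: f(2)[of 0] k(2) lessThan_Suc)
  moreover have "strict_mono k"
    unfolding strict_mono_Suc_iff using k(1)[of "Suc _"] k(2) by auto
  ultimately show ?thesis using f(1) by (intro exI[of _ k]) auto
qed

text \<open>Combinatorial forcing in the style of Nash-Williams.\<close>

context
  fixes \<F> :: "nat set set"
begin

definition accepts :: "nat set \<Rightarrow> nat set \<Rightarrow> bool" where
  "accepts s M \<longleftrightarrow> (\<forall>N\<subseteq>M. infinite N \<longrightarrow> s \<lless> N \<longrightarrow> (\<exists>n. (s \<union> N) \<inter> {..<n} \<in> \<F>))"

definition rejects :: "nat set \<Rightarrow> nat set \<Rightarrow> bool" where
  "rejects s M \<longleftrightarrow> (\<forall>N\<subseteq>M. infinite N \<longrightarrow> \<not> accepts s N)"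

lemma accepts_mono: "accepts s M \<Longrightarrow> N \<subseteq> M \<Longrightarrow> accepts s N"
  unfolding accepts_def by blast

lemma rejects_mono: "rejects s M \<Longrightarrow> N \<subseteq> M \<Longrightarrow> rejects s N"
  unfolding rejects_def by blast

lemma decided_subset_exists:
  assumes "finite T" "infinite M"
  shows "\<exists>N\<subseteq>M. infinite N \<and> (\<forall>s\<in>T. accepts s N \<or> rejects s N)"
  using assms(1)
proof (induction T rule: finite_induct)
  case empty
  then show ?case using assms(2) by blast
next
  case (insert s T)
  then obtain N where N: "N \<subseteq> M" "infinite N" "\<forall>s\<in>T. accepts s N \<or> rejects s N" by blast
  obtain N' where N': "N' \<subseteq> N" "infinite N'" "accepts s N' \<or> rejects s N'"
    using N(2) unfolding rejects_def by blast
  have "\<forall>t\<in>insert s T. accepts t N' \<or> rejects t N'"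
    using N(3) N' accepts_mono rejects_mono by blast
  then show ?case using N(1) N'(1,2) by blast
qed

text \<open>Fusion: a stage consists of a finite set and an infinite reservoir behind it. The next
  stage moves one point from the reservoir to the finite set and shrinks the reservoir until every
  subset of the finite set is decided in it. Decisions pass to smaller sets, so they survive in the
  limit \<open>L\<close>.\<close>

lemma deciding_set_exists:
  "\<exists>L. infinite L \<and> (\<forall>s\<subseteq>L. finite s \<longrightarrow> accepts s L \<or> rejects s L)"
proof -
  have "\<exists>f. \<forall>i. (finite (fst (f i)) \<and> infinite (snd (f i)) \<and> fst (f i) \<lless> snd (f i) \<and>
        (\<forall>s\<subseteq>fst (f i). accepts s (snd (f i)) \<or> rejects s (snd (f i))) \<and> (i = 0 \<longrightarrow> fst (f i) = {})) \<and>
      (\<exists>l\<in>snd (f i). fst (f (Suc i)) = insert l (fst (f i)) \<and> snd (f (Suc i)) \<subseteq> snd (f i))"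
  proof (rule dependent_nat_choice)
    obtain N where "infinite N" "\<forall>s\<in>{{}}. accepts s N \<or> rejects s N"
      using decided_subset_exists[of "{{}}" UNIV] by auto
    then show "\<exists>z. finite (fst z) \<and> infinite (snd z) \<and> fst z \<lless> snd z \<and>
        (\<forall>s\<subseteq>fst z. accepts s (snd z) \<or> rejects s (snd z)) \<and> ((0::nat) = 0 \<longrightarrow> fst z = {})"
      by (intro exI[of _ "({}, N)"]) (simp add: before_def)
    fix z :: "nat set \<times> nat set" and i :: nat
    assume z: "finite (fst z) \<and> infinite (snd z) \<and> fst z \<lless> snd z \<and>
        (\<forall>s\<subseteq>fst z. accepts s (snd z) \<or> rejects s (snd z)) \<and> (i = 0 \<longrightarrow> fst z = {})"
    then obtain l where l: "l \<in> snd z" by (metis finite.emptyI all_not_in_conv)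
    have "infinite (snd z - {..l})" using z by (simp add: Diff_infinite_finite)
    then obtain N where N: "N \<subseteq> snd z - {..l}" "infinite N"
      "\<forall>s\<in>Pow (insert l (fst z)). accepts s N \<or> rejects s N"
      using decided_subset_exists[of "Pow (insert l (fst z))" "snd z - {..l}"] z by auto
    have "insert l (fst z) \<lless> N" using N(1) z unfolding before_def by auto
    then show "\<exists>z'. (finite (fst z') \<and> infinite (snd z') \<and> fst z' \<lless> snd z' \<and>
        (\<forall>s\<subseteq>fst z'. accepts s (snd z') \<or> rejects s (snd z')) \<and> (Suc i = 0 \<longrightarrow> fst z' = {})) \<and>
      (\<exists>l\<in>snd z. fst z' = insert l (fst z) \<and> snd z' \<subseteq> snd z)"
      using N z l by (intro exI[of _ "(insert l (fst z), N)"]) auto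
  qed
  then obtain f where F: "\<forall>i. (finite (fst (f i)) \<and> infinite (snd (f i)) \<and> fst (f i) \<lless> snd (f i) \<and>
        (\<forall>s\<subseteq>fst (f i). accepts s (snd (f i)) \<or> rejects s (snd (f i))) \<and> (i = 0 \<longrightarrow> fst (f i) = {})) \<and>
      (\<exists>l\<in>snd (f i). fst (f (Suc i)) = insert l (fst (f i)) \<and> snd (f (Suc i)) \<subseteq> snd (f i))" ..
  have f: "finite (fst (f i))" "infinite (snd (f i))" "fst (f i) \<lless> snd (f i)"
    "\<forall>s\<subseteq>fst (f i). accepts s (snd (f i)) \<or> rejects s (snd (f i))"
    "\<exists>l\<in>snd (f i). fst (f (Suc i)) = insert l (fst (f i)) \<and> snd (f (Suc i)) \<subseteq> snd (f i)"
    "i = 0 \<longrightarrow> fst (f i) = {}" for i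
    using F[THEN spec, of i] by - (elim conjE, assumption)+
  have f0: "fst (f 0) = {}" using f(6)[of 0] by simp
  define L where "L = (\<Union>i. fst (f i))"
  have fst_mono: "fst (f i) \<subseteq> fst (f j)" if "i \<le> j" for i j
    using that
  proof (induction j rule: dec_induct)
    case (step j)
    then show ?case using f(5)[of j] by blast
  qed simp
  have snd_mono: "snd (f j) \<subseteq> snd (f i)" if "i \<le> j" for i j
    using that
  proof (induction j rule: dec_induct)
    case (step j)
    then show ?case using f(5)[of j] by blast
  qed simp
  have rest: "fst (f j) - fst (f i) \<subseteq> snd (f i)" if "i \<le> j" for i j
    using that
  proof (induction j rule: dec_induct)
    case (step j)
    obtain l where "l \<in> snd (f j)" "fst (f (Suc j)) = insert l (fst (f j))" using f(5)[of j] by blast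
    then show ?case using step.IH snd_mono[OF step(1)] by auto
  qed simp
  have rest_L: "L - fst (f i) \<subseteq> snd (f i)" for i
  proof
    fix a assume "a \<in> L - fst (f i)"
    then obtain j where "a \<in> fst (f j)" unfolding L_def by blast
    then have "a \<in> fst (f (max i j)) - fst (f i)"
      using fst_mono[of j "max i j"] \<open>a \<in> L - fst (f i)\<close> by auto
    then show "a \<in> snd (f i)" using rest[of i "max i j"] by auto
  qed
  have "infinite L"
  proof
    assume "finite L"
    have "\<exists>i. card (fst (f i)) \<ge> n" for n
    proof (induction n)
      case (Suc n)
      then obtain i where i: "card (fst (f i)) \<ge> n" by blast
      obtain l where l: "l \<in> snd (f i)" "fst (f (Suc i)) = insert l (fst (f i))" using f(5) by blast
      have "l \<notin> fst (f i)" using f(3)[of i] l(1) unfolding before_def by blast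
      then have "card (fst (f (Suc i))) = Suc (card (fst (f i)))" using l(2) f(1) by simp
      then show ?case using i by (intro exI[of _ "Suc i"]) simp
    qed simp
    then obtain i where "card (fst (f i)) \<ge> Suc (card L)" by blast
    moreover have "card (fst (f i)) \<le> card L"
      using \<open>finite L\<close> unfolding L_def by (intro card_mono) auto
    ultimately show False by simp
  qed
  moreover have "accepts s L \<or> rejects s L" if s: "s \<subseteq> L" "finite s" for s
  proof -
    have "\<exists>i. s \<subseteq> fst (f i)"
      using s(2,1)
    proof (induction s rule: finite_induct)
      case (insert a s)
      then obtain i j where "s \<subseteq> fst (f i)" "a \<in> fst (f j)" unfolding L_def by blast
      then have "insert a s \<subseteq> fst (f (max i j))"
        using fst_mono[of i "max i j"] fst_mono[of j "max i j"] by auto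
      then show ?case by blast
    qed simp
    \<comment> \<open>At the first stage that contains \<open>s\<close>, the point just added
      belongs to \<open>s\<close> and is the largest so far. Whatever lies in \<open>L\<close>
      behind \<open>s\<close> therefore comes from the reservoir of that stage, where
      \<open>s\<close> is decided.\<close>
    define i where "i = (LEAST i. s \<subseteq> fst (f i))"
    have i: "s \<subseteq> fst (f i)" unfolding i_def using \<open>\<exists>i. s \<subseteq> fst (f i)\<close> by (rule LeastI_ex)
    have tail: "N \<subseteq> snd (f i)" if N: "N \<subseteq> L" "s \<lless> N" for N
    proof
      fix a assume a: "a \<in> N"
      have "a \<notin> fst (f i)"
      proof
        assume af: "a \<in> fst (f i)"
        show False
        proof (cases i)
          case 0
          then show ?thesis using af f0 by simp
        next
          case (Suc j)
          then have "j < i" by simp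
          then have "\<not> s \<subseteq> fst (f j)" unfolding i_def by (rule not_less_Least)
          obtain l where l: "l \<in> snd (f j)" "fst (f i) = insert l (fst (f j))"
            using f(5)[of j] Suc by blast
          then have "l \<in> s" using i \<open>\<not> s \<subseteq> fst (f j)\<close> by (auto simp: subset_insert_iff)
          moreover have "a \<le> l" using af l f(3)[of j] unfolding before_def by (auto intro: less_imp_le)
          ultimately show False using N(2) a unfolding before_def by fastforce
        qed
      qed
      then show "a \<in> snd (f i)" using rest_L a N(1) by blast
    qed
    consider "accepts s (snd (f i))" | "rejects s (snd (f i))" using f(4)[of i] i by blast
    then show ?thesis
    proof cases
      case 1
      then have "accepts s L" using tail unfolding accepts_def by blast
      then show ?thesis by simp
    next
      case 2
      have "rejects s L"
        unfolding rejects_def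
      proof (intro allI impI notI)
        fix N assume N: "N \<subseteq> L" "infinite N" "accepts s N"
        let ?N = "N - {..Max (insert 0 s)}"
        have "i \<le> Max (insert 0 s)" if "i \<in> s" for i using that s(2) by (intro Max_ge) auto
        then have "s \<lless> ?N" unfolding before_def by fastforce
        then have "?N \<subseteq> snd (f i)" using tail N(1) by blast
        moreover have "infinite ?N" using N(2) by (simp add: Diff_infinite_finite)
        moreover have "accepts s ?N" using accepts_mono[OF N(3)] by blast
        ultimately show False using 2 unfolding rejects_def by blast
      qed
      then show ?thesis by simp
    qed
  qed
  ultimately show ?thesis by blast
qed

text \<open>If \<open>{}\<close> is accepted, the second alternative holds. If it is rejected, then
  each rejected set has only finitely many one-point end extensions that are not rejected, since
  infinitely many would form a set accepting it. So an infinite set can be built all of whose finite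
  subsets are rejected; it contains no member of \<open>\<F>\<close>, because a member is
  accepted.\<close>

lemma Galvin:
  "\<exists>L. infinite L \<and> ((\<forall>A\<subseteq>L. finite A \<longrightarrow> A \<notin> \<F>) \<or> (\<forall>M\<subseteq>L. infinite M \<longrightarrow> (\<exists>n. M \<inter> {..<n} \<in> \<F>)))"
proof -
  obtain L where L: "infinite L" "\<And>s. s \<subseteq> L \<Longrightarrow> finite s \<Longrightarrow> accepts s L \<or> rejects s L"
    using deciding_set_exists by blast
  show ?thesis
  proof (cases "accepts {} L")
    case True
    then have "\<forall>M\<subseteq>L. infinite M \<longrightarrow> (\<exists>n. M \<inter> {..<n} \<in> \<F>)"
      unfolding accepts_def before_def by simp
    then show ?thesis using L(1) by blast
  next
    case False
    then have rej0: "rejects {} L" using L(2)[of "{}"] by simp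
    have extend: "finite {k \<in> L. s \<lless> {k} \<and> \<not> rejects (insert k s) L}"
      if s: "s \<subseteq> L" "finite s" "rejects s L" for s
    proof (rule ccontr)
      let ?N = "{k \<in> L. s \<lless> {k} \<and> \<not> rejects (insert k s) L}"
      assume inf: "infinite ?N"
      have "accepts s ?N"
        unfolding accepts_def
      proof (intro allI impI)
        fix N assume N: "N \<subseteq> ?N" "infinite N" "s \<lless> N"
        define k where "k = (LEAST k. k \<in> N)"
        have k: "k \<in> N" unfolding k_def using N(2) by (metis LeastI finite.emptyI all_not_in_conv)
        then have "\<not> rejects (insert k s) L" "k \<in> L" using N(1) by auto
        then have "accepts (insert k s) L" using L(2)[of "insert k s"] s by auto
        moreover have "N - {k} \<subseteq> L" "infinite (N - {k})" using N by auto
        moreover have "insert k s \<lless> N - {k}"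
          using N(3) unfolding before_def k_def by (auto intro: le_neq_implies_less Least_le)
        ultimately have "\<exists>n. (insert k s \<union> (N - {k})) \<inter> {..<n} \<in> \<F>" unfolding accepts_def by blast
        moreover have "insert k s \<union> (N - {k}) = s \<union> N" using k by blast
        ultimately show "\<exists>n. (s \<union> N) \<inter> {..<n} \<in> \<F>" by simp
      qed
      moreover have "?N \<subseteq> L" by blast
      ultimately show False using s(3) inf unfolding rejects_def by blast
    qed
    have "\<exists>k :: nat \<Rightarrow> nat. strict_mono k \<and> (\<forall>i. k ` {..<i} \<subseteq> L \<and> (\<forall>s\<subseteq>k ` {..<i}. rejects s L))"
    proof (rule increasing_sequence_exists)
      show "{} \<subseteq> L \<and> (\<forall>s\<subseteq>{}. rejects s L)" using rej0 by simp
      fix S :: "nat set" and m :: nat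
      assume S: "finite S" "S \<subseteq> L \<and> (\<forall>s\<subseteq>S. rejects s L)"
      define bad where "bad = (\<Union>s\<in>Pow S. {k \<in> L. s \<lless> {k} \<and> \<not> rejects (insert k s) L})"
      have "finite bad"
        unfolding bad_def
      proof (rule finite_UN_I)
        fix s assume "s \<in> Pow S"
        then show "finite {k \<in> L. s \<lless> {k} \<and> \<not> rejects (insert k s) L}"
          using S finite_subset[of s S] by (intro extend) auto
      qed (use S in simp)
      then have "infinite (L - (bad \<union> {..m + Max (insert 0 S)}))"
        using L(1) by (intro Diff_infinite_finite) auto
      then have "L - (bad \<union> {..m + Max (insert 0 S)}) \<noteq> {}" by force
      then obtain k where "k \<in> L - (bad \<union> {..m + Max (insert 0 S)})" by blast
      then have k: "k \<in> L" "k \<notin> bad" "k > m + Max (insert 0 S)"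
        unfolding Diff_iff Un_iff atMost_iff not_le de_Morgan_disj by blast+
      have Sk: "S \<lless> {k}"
      proof -
        have "i \<le> Max (insert 0 S)" if "i \<in> S" for i using that S(1) by (intro Max_ge) auto
        then show ?thesis using k(3) unfolding before_def by fastforce
      qed
      have "rejects s L" if s: "s \<subseteq> insert k S" for s
      proof (cases "k \<in> s")
        case True
        let ?t = "s - {k}"
        have "?t \<subseteq> S" using s by blast
        moreover from this have "?t \<lless> {k}" using Sk unfolding before_def by blast
        ultimately have "rejects (insert k ?t) L" using k(1,2) unfolding bad_def by blast
        moreover have "insert k ?t = s" using True by blast
        ultimately show ?thesis by simp
      next
        case False
        then show ?thesis using s S(2) by blast
      qed
      then show "\<exists>k\<ge>m. insert k S \<subseteq> L \<and> (\<forall>s\<subseteq>insert k S. rejects s L)"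
        using k S by (intro exI[of _ k]) auto
    qed
    then obtain k :: "nat \<Rightarrow> nat"
      where K: "strict_mono k \<and> (\<forall>i. k ` {..<i} \<subseteq> L \<and> (\<forall>s\<subseteq>k ` {..<i}. rejects s L))" ..
    have k: "strict_mono k" "k ` {..<i} \<subseteq> L" "\<forall>s\<subseteq>k ` {..<i}. rejects s L" for i
      using K[THEN conjunct1] K[THEN conjunct2, THEN spec, of i] by - (elim conjE, assumption)+
    have "A \<notin> \<F>" if A: "A \<subseteq> range k" "finite A" for A
    proof
      assume "A \<in> \<F>"
      obtain I where I: "A = k ` I" "finite I" using finite_subset_image[OF A(2,1)] by blast
      obtain i where "I \<subseteq> {..<i}" using I(2) finite_nat_iff_bounded by blast
      then have "rejects A L" using k(3)[of i] I(1) by blast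
      moreover have "accepts A L"
        unfolding accepts_def
      proof (intro allI impI)
        fix N assume "infinite N" "A \<lless> N"
        define n where "n = (if A = {} then 0 else Suc (Max A))"
        have "(A \<union> N) \<inter> {..<n} = A"
        proof (cases "A = {}")
          case False
          then have "Max A \<in> A" using A(2) by simp
          then have "\<forall>j\<in>N. Max A < j" using \<open>A \<lless> N\<close> unfolding before_def by blast
          then have "x \<in> A" if "x \<in> A \<union> N" "x < Suc (Max A)" for x using that by fastforce
          moreover have "x < Suc (Max A)" if "x \<in> A" for x using Max_ge[OF A(2) that] by simp
          ultimately show ?thesis using False unfolding n_def by auto
        qed (simp add: n_def)
        then show "\<exists>n. (A \<union> N) \<inter> {..<n} \<in> \<F>" using \<open>A \<in> \<F>\<close> by (intro exI[of _ n]) simp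
      qed
      ultimately show False using L(1) unfolding rejects_def by blast
    qed
    moreover have "infinite (range k)"
      using k(1) by (simp add: range_inj_infinite strict_mono_imp_inj_on)
    ultimately show ?thesis by blast
  qed
qed

end

text \<open>A failure at \<open>{}\<close> propagates to a strictly increasing chain of failures,
  each an end extension of the one before, whose union \<open>M\<close> is infinite. The chain meets
  only some initial segments of \<open>M\<close>, because whole blocks \<open>B\<close> are
  appended; this is why the bar is required for all \<open>m \<ge> n\<close>.\<close>

lemma bar_induct:
  fixes P :: "nat set \<Rightarrow> bool"
  assumes bar: "\<And>M. infinite M \<Longrightarrow> \<exists>n. \<forall>m\<ge>n. P (M \<inter> {..<m})"
    and step: "\<And>s. finite s \<Longrightarrow> (\<And>B. finite B \<Longrightarrow> B \<noteq> {} \<Longrightarrow> s \<lless> B \<Longrightarrow> P (s \<union> B)) \<Longrightarrow> P s"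
  shows "P {}"
proof (rule ccontr)
  assume "\<not> P {}"
  have "\<exists>f. \<forall>i. (finite (f i) \<and> \<not> P (f i)) \<and> (\<exists>B. B \<noteq> {} \<and> f i \<lless> B \<and> f (Suc i) = f i \<union> B)"
  proof (rule dependent_nat_choice)
    show "\<exists>s. finite s \<and> \<not> P s" using \<open>\<not> P {}\<close> by blast
    fix s and i :: nat assume "finite s \<and> \<not> P s"
    then obtain B where "finite B" "B \<noteq> {}" "s \<lless> B" "\<not> P (s \<union> B)" using step by blast
    then show "\<exists>t. (finite t \<and> \<not> P t) \<and> (\<exists>B. B \<noteq> {} \<and> s \<lless> B \<and> t = s \<union> B)"
      using \<open>finite s \<and> \<not> P s\<close> by blast
  qed
  then obtain f where F: "\<forall>i. (finite (f i) \<and> \<not> P (f i)) \<and>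
      (\<exists>B. B \<noteq> {} \<and> f i \<lless> B \<and> f (Suc i) = f i \<union> B)" ..
  have f: "finite (f i)" "\<not> P (f i)" "\<exists>B. B \<noteq> {} \<and> f i \<lless> B \<and> f (Suc i) = f i \<union> B" for i
    using F[THEN spec, of i] by - (elim conjE, assumption)+
  from choice[OF allI[OF f(3)]] obtain B
    where "\<forall>i. B i \<noteq> {} \<and> f i \<lless> B i \<and> f (Suc i) = f i \<union> B i" ..
  then have B: "B i \<noteq> {}" "f i \<lless> B i" "f (Suc i) = f i \<union> B i" for i by simp_all
  have mono: "f i \<subseteq> f j" if "i \<le> j" for i j
    using that by (induction j rule: dec_induct) (auto simp: B(3))
  have new: "a \<in> f i \<or> f i \<lless> {a}" if "a \<in> f j" for a i j
    using that
  proof (induction j)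
    case 0
    then show ?case using mono[of 0 i] by blast
  next
    case (Suc j)
    show ?case
    proof (cases "i \<le> j \<and> a \<in> B j")
      case True
      then show ?thesis using B(2)[of j] mono[of i j] unfolding before_def by blast
    next
      case False
      then show ?thesis using Suc B(3)[of j] mono[of "Suc j" i] by (cases "i \<le> j") auto
    qed
  qed
  define b where "b i = (SOME a. a \<in> B i)" for i
  have b: "b i \<in> B i" for i unfolding b_def using B(1) by (simp add: some_in_eq)
  have bmono: "strict_mono b"
    unfolding strict_mono_Suc_iff
    using b B(2,3) unfolding before_def by blast
  define M where "M = (\<Union>i. f i)"
  have "b i \<in> M" for i using b B(3) unfolding M_def by blast
  then have "infinite M"
    using bmono by (meson finite_subset image_subset_iff range_inj_infinite strict_mono_imp_inj_on)
  then obtain n where n: "\<And>m. m \<ge> n \<Longrightarrow> P (M \<inter> {..<m})" using bar by blast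
  let ?i = "Suc n"
  define m where "m = Suc (Max (f ?i))"
  have ne: "b n \<in> f ?i" using b B(3) by blast
  have "M \<inter> {..<m} = f ?i"
  proof (intro equalityI subsetI)
    fix a assume a: "a \<in> M \<inter> {..<m}"
    then obtain j where "a \<in> f j" unfolding M_def by blast
    moreover have "\<not> f ?i \<lless> {a}"
      using a ne Max_in[of "f ?i"] f(1) unfolding before_def m_def by fastforce
    ultimately show "a \<in> f ?i" using new by blast
  qed (use f(1) in \<open>auto simp: M_def m_def less_Suc_eq_le\<close>)
  moreover have "n \<le> b n" by (rule seq_suble[OF bmono])
  then have "m \<ge> n" using Max_ge[OF f(1) ne] unfolding m_def by linarith
  ultimately show False using n f(2) by metis
qed

section \<open>Pairs of norm at most 1 yield \<open>c\<^sub>0\<close>\<close>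

text \<open>The common frame for \<open>c0\<close> and \<open>ell1\<close>. Nothing is assumed of
  \<open>N\<close> as a norm; that it separates points, hence injectivity, is drawn from
  \<open>coord\<close>.\<close>

lemma seq_space_embeds:
  fixes y :: "nat \<Rightarrow> 'a::banach" and V :: "(nat \<Rightarrow> real) set" and N :: "(nat \<Rightarrow> real) \<Rightarrow> real"
  assumes zero: "(\<lambda>_. 0) \<in> V"
    and add: "\<And>a b. a \<in> V \<Longrightarrow> b \<in> V \<Longrightarrow> (\<lambda>n. a n + b n) \<in> V"
    and scale: "\<And>r a. a \<in> V \<Longrightarrow> (\<lambda>n. r * a n) \<in> V"
    and summ: "\<And>a. a \<in> V \<Longrightarrow> summable (\<lambda>n. a n *\<^sub>R y n)"
    and coord: "\<And>a i. a \<in> V \<Longrightarrow> \<bar>a i\<bar> \<le> N a"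
    and upper: "C > 0" "\<And>a. a \<in> V \<Longrightarrow> norm (\<Sum>n. a n *\<^sub>R y n) \<le> C * N a"
    and lower: "D > 0" "\<And>a. a \<in> V \<Longrightarrow> N a \<le> D * norm (\<Sum>n. a n *\<^sub>R y n)"
  shows "\<exists>Y :: 'a set. subspace Y \<and> isomorphic_to_seq_space Y V N"
proof -
  define T where "T a = (\<Sum>n. a n *\<^sub>R y n)" for a
  have T_add: "T (\<lambda>n. a n + b n) = T a + T b" if "a \<in> V" "b \<in> V" for a b
    unfolding T_def scaleR_add_left by (rule suminf_add[symmetric]) (use summ that in auto)
  have T_scale: "T (\<lambda>n. r * a n) = r *\<^sub>R T a" if "a \<in> V" for r a
    unfolding T_def using suminf_scaleR_right[OF summ[OF that], of r] by simp
  have T_inj: "inj_on T V"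
  proof (rule inj_onI)
    fix a b assume a: "a \<in> V" and b: "b \<in> V" and eq: "T a = T b"
    have mb: "(\<lambda>n. - 1 * b n) \<in> V" by (rule scale[OF b])
    then have d: "(\<lambda>n. a n + - 1 * b n) \<in> V" by (rule add[OF a])
    have "T (\<lambda>n. a n + - 1 * b n) = 0"
      using T_add[OF a mb] T_scale[OF b, of "- 1"] eq by simp
    then have "N (\<lambda>n. a n + - 1 * b n) \<le> 0"
      using lower(2)[OF d] unfolding T_def by simp
    then have "\<bar>a i + - 1 * b i\<bar> \<le> 0" for i
      using coord[OF d, of i] by linarith
    then show "a = b" by (simp add: fun_eq_iff)
  qed
  have "subspace (T ` V)"
  proof (rule subspaceI)
    have "T (\<lambda>_. 0) = 0" unfolding T_def by simp
    then show "0 \<in> T ` V" using zero by force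
    show "x + z \<in> T ` V" if xz: "x \<in> T ` V" "z \<in> T ` V" for x z
    proof -
      obtain a b where ab: "a \<in> V" "x = T a" "b \<in> V" "z = T b" using xz by blast
      show ?thesis using T_add[OF ab(1,3)] add[OF ab(1,3)] unfolding ab(2,4) by (metis imageI)
    qed
    show "c *\<^sub>R x \<in> T ` V" if xV: "x \<in> T ` V" for c x
    proof -
      obtain a where a: "a \<in> V" "x = T a" using xV by blast
      show ?thesis using T_scale[OF a(1), of c] scale[OF a(1), of c] unfolding a(2) by (metis imageI)
    qed
  qed
  moreover have "isomorphic_to_seq_space (T ` V) V N"
    unfolding isomorphic_to_seq_space_def
  proof (intro exI[of _ T] conjI ballI allI)
    show "bij_betw T V (T ` V)" using T_inj by (rule inj_on_imp_bij_betw)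
    show "\<exists>C>0. \<forall>a\<in>V. norm (T a) \<le> C * N a"
      using upper unfolding T_def by (intro exI[of _ C]) simp
    show "\<exists>D>0. \<forall>a\<in>V. N a \<le> D * norm (T a)"
      using lower unfolding T_def by (intro exI[of _ D]) simp
  qed (simp_all add: T_add T_scale)
  ultimately show ?thesis by blast
qed

text \<open>A coefficient between 0 and 1 is a convex combination of 0 and 1, so the bound extends
  from the vertices of a cube to the cube. The offset \<open>z\<close> carries the coefficients that
  the induction has already replaced.\<close>

lemma norm_combination_subset_bound:
  fixes y :: "nat \<Rightarrow> 'a::real_normed_vector"
  assumes "finite S" "\<And>i. i \<in> S \<Longrightarrow> 0 \<le> a i \<and> a i \<le> 1"
    and "\<And>B. B \<subseteq> S \<Longrightarrow> norm (z + (\<Sum>i\<in>B. y i)) \<le> C"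
  shows "norm (z + (\<Sum>i\<in>S. a i *\<^sub>R y i)) \<le> C"
  using assms
proof (induction S arbitrary: z rule: finite_induct)
  case empty
  then show ?case using empty(2)[of "{}"] by simp
next
  case (insert i S)
  have "norm ((z + a i *\<^sub>R y i) + (\<Sum>i\<in>B. y i)) \<le> C" if B: "B \<subseteq> S" for B
  proof -
    let ?u = "z + (\<Sum>i\<in>B. y i)"
    have "i \<notin> B" "finite B" using B insert.hyps finite_subset by auto
    then have eq: "?u + y i = z + (\<Sum>i\<in>insert i B. y i)" by (simp add: algebra_simps)
    have "insert i B \<subseteq> insert i S" "B \<subseteq> insert i S" using B by auto
    then have 1: "norm (?u + y i) \<le> C" and 2: "norm ?u \<le> C"
      unfolding eq by (blast intro: insert.prems(2))+
    have a: "0 \<le> a i" "a i \<le> 1" using insert.prems(1)[of i] by auto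
    have "(z + a i *\<^sub>R y i) + (\<Sum>i\<in>B. y i) = (1 - a i) *\<^sub>R ?u + a i *\<^sub>R (?u + y i)"
      by (simp add: algebra_simps)
    also have "norm \<dots> \<le> (1 - a i) * norm ?u + a i * norm (?u + y i)"
      using a norm_triangle_ineq[of "(1 - a i) *\<^sub>R ?u" "a i *\<^sub>R (?u + y i)"] by simp
    also have "\<dots> \<le> (1 - a i) * C + a i * C"
      using a 1 2 by (intro add_mono mult_left_mono) simp_all
    finally show ?thesis by (simp add: algebra_simps)
  qed
  then have "norm ((z + a i *\<^sub>R y i) + (\<Sum>i\<in>S. a i *\<^sub>R y i)) \<le> C"
    using insert.prems(1) by (intro insert.IH) auto
  then show ?case using insert.hyps by (simp add: algebra_simps)
qed

text \<open>Positive and negative parts, divided by \<open>\<delta>\<close>, lie in the cube treated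
  above; each contributes \<open>C\<close>, whence the factor 2.\<close>

lemma norm_combination_bound:
  fixes y :: "nat \<Rightarrow> 'a::real_normed_vector"
  assumes C: "\<And>A. finite A \<Longrightarrow> norm (\<Sum>i\<in>A. y i) \<le> C"
    and S: "finite S" and \<delta>: "\<delta> > 0" and a: "\<And>i. i \<in> S \<Longrightarrow> \<bar>a i\<bar> \<le> \<delta>"
  shows "norm (\<Sum>i\<in>S. a i *\<^sub>R y i) \<le> 2 * C * \<delta>"
proof -
  define p where "p i = max (a i) 0 / \<delta>" for i
  define q where "q i = max (- a i) 0 / \<delta>" for i
  have pq: "0 \<le> p i \<and> p i \<le> 1" "0 \<le> q i \<and> q i \<le> 1" if "i \<in> S" for i
    using a[OF that] \<delta> unfolding p_def q_def by auto
  have B: "norm (0 + (\<Sum>i\<in>B. y i)) \<le> C" if "B \<subseteq> S" for B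
    using C[OF finite_subset[OF that S]] by simp
  have "norm (0 + (\<Sum>i\<in>S. p i *\<^sub>R y i)) \<le> C"
    by (rule norm_combination_subset_bound[OF S pq(1) B])
  moreover have "norm (0 + (\<Sum>i\<in>S. q i *\<^sub>R y i)) \<le> C"
    by (rule norm_combination_subset_bound[OF S pq(2) B])
  ultimately have bd: "norm (\<Sum>i\<in>S. p i *\<^sub>R y i) \<le> C" "norm (\<Sum>i\<in>S. q i *\<^sub>R y i) \<le> C" by simp_all
  have "a i = \<delta> * (p i - q i)" for i
    using \<delta> unfolding p_def q_def by (simp add: max_def field_simps)
  then have "(\<Sum>i\<in>S. a i *\<^sub>R y i) = \<delta> *\<^sub>R (\<Sum>i\<in>S. (p i - q i) *\<^sub>R y i)"
    unfolding scaleR_sum_right by (intro sum.cong) (simp_all only: scaleR_scaleR)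
  then have "(\<Sum>i\<in>S. a i *\<^sub>R y i) = \<delta> *\<^sub>R ((\<Sum>i\<in>S. p i *\<^sub>R y i) - (\<Sum>i\<in>S. q i *\<^sub>R y i))"
    by (simp only: scaleR_diff_left sum_subtractf)
  then have "norm (\<Sum>i\<in>S. a i *\<^sub>R y i) = \<delta> * norm ((\<Sum>i\<in>S. p i *\<^sub>R y i) - (\<Sum>i\<in>S. q i *\<^sub>R y i))"
    using \<delta> by simp
  also have "\<dots> \<le> \<delta> * (C + C)"
  proof (rule mult_left_mono)
    show "norm ((\<Sum>i\<in>S. p i *\<^sub>R y i) - (\<Sum>i\<in>S. q i *\<^sub>R y i)) \<le> C + C"
      using norm_triangle_ineq4[of "\<Sum>i\<in>S. p i *\<^sub>R y i" "\<Sum>i\<in>S. q i *\<^sub>R y i"] bd by linarith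
  qed (use \<delta> in simp)
  finally show ?thesis by (simp add: algebra_simps)
qed

lemma c0_coord_le: "a \<in> c0 \<Longrightarrow> \<bar>a i\<bar> \<le> c0_norm a"
proof -
  assume "a \<in> c0"
  then have "Bseq a" unfolding c0_def by (auto intro: convergent_imp_Bseq convergentI)
  then obtain B where "\<And>n. \<bar>a n\<bar> \<le> B" unfolding Bseq_def by auto
  then have "bdd_above (range (\<lambda>n. \<bar>a n\<bar>))" by (intro bdd_aboveI[of _ B]) auto
  then show ?thesis unfolding c0_norm_def by (rule cSUP_upper[OF UNIV_I])
qed

lemma c0_embeds:
  fixes y :: "nat \<Rightarrow> 'a::banach"
  assumes y: "basic_with K y" "normalized y"
    and C: "\<And>A. finite A \<Longrightarrow> norm (\<Sum>i\<in>A. y i) \<le> C"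
  shows "\<exists>Y :: 'a set. subspace Y \<and> isomorphic_to_seq_space Y c0 c0_norm"
proof -
  have K: "K \<ge> 1" using basic_with_ge_1[OF y(1)] .
  have C1: "C \<ge> 1" using C[of "{0}"] y(2) unfolding normalized_def by simp
  have summ: "summable (\<lambda>n. a n *\<^sub>R y n)" if a: "a \<in> c0" for a
    unfolding summable_Cauchy
  proof (intro allI impI)
    fix \<epsilon> :: real assume "\<epsilon> > 0"
    define \<delta> where "\<delta> = \<epsilon> / (4 * C)"
    have \<delta>: "\<delta> > 0" unfolding \<delta>_def using \<open>\<epsilon> > 0\<close> C1 by simp
    obtain N where N: "\<And>n. n \<ge> N \<Longrightarrow> \<bar>a n\<bar> < \<delta>"
      using a LIMSEQ_D[of a 0 \<delta>] \<delta> unfolding c0_def by auto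
    have "norm (\<Sum>i\<in>{m..<n}. a i *\<^sub>R y i) < \<epsilon>" if "m \<ge> N" for m n
    proof -
      have "norm (\<Sum>i\<in>{m..<n}. a i *\<^sub>R y i) \<le> 2 * C * \<delta>"
        using N that by (intro norm_combination_bound C \<delta>) (auto intro: less_imp_le)
      also have "\<dots> < \<epsilon>" unfolding \<delta>_def using \<open>\<epsilon> > 0\<close> C1 by simp
      finally show ?thesis .
    qed
    then show "\<exists>N. \<forall>m\<ge>N. \<forall>n. norm (\<Sum>i\<in>{m..<n}. a i *\<^sub>R y i) < \<epsilon>" by blast
  qed
  have lim: "(\<lambda>n. \<Sum>i<n. a i *\<^sub>R y i) \<longlonglongrightarrow> (\<Sum>n. a n *\<^sub>R y n)" if "a \<in> c0" for a
    by (rule summable_LIMSEQ[OF summ[OF that]])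
  show ?thesis
  proof (rule seq_space_embeds[where y = y and C = "2 * C" and D = "2 * K"])
    show "(\<lambda>_. 0) \<in> c0" unfolding c0_def by simp
    show "(\<lambda>n. a n + b n) \<in> c0" if "a \<in> c0" "b \<in> c0" for a b
      using that tendsto_add[of a 0 sequentially b 0] unfolding c0_def by simp
    show "(\<lambda>n. r * a n) \<in> c0" if "a \<in> c0" for r a
      using that tendsto_mult_left[of a 0 sequentially r] unfolding c0_def by simp
    show "2 * C > 0" "2 * K > 0" using C1 K by simp_all
    fix a assume a: "a \<in> c0"
    show "norm (\<Sum>n. a n *\<^sub>R y n) \<le> 2 * C * c0_norm a"
    proof (rule field_le_epsilon)
      fix \<epsilon> :: real assume \<epsilon>: "\<epsilon> > 0"
      \<comment> \<open>The extra term makes \<open>\<delta>\<close> positive even for the zero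
        sequence and adds exactly \<open>\<epsilon>\<close> after multiplication by
        \<open>2 * C\<close>.\<close>
      define \<delta> where "\<delta> = c0_norm a + \<epsilon> / (2 * C)"
      have "c0_norm a \<ge> 0" using c0_coord_le[OF a, of 0] by linarith
      then have \<delta>: "\<delta> > 0" unfolding \<delta>_def using \<epsilon> C1 by (simp add: add_nonneg_pos)
      have "\<bar>a i\<bar> \<le> \<delta>" for i
        using c0_coord_le[OF a, of i] \<epsilon> C1 unfolding \<delta>_def by (simp add: add_increasing2)
      then have "norm (\<Sum>i<n. a i *\<^sub>R y i) \<le> 2 * C * \<delta>" for n
        by (intro norm_combination_bound C \<delta>) auto
      then have "norm (\<Sum>n. a n *\<^sub>R y n) \<le> 2 * C * \<delta>"
        by (intro LIMSEQ_le_const2[OF tendsto_norm[OF lim[OF a]]]) blast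
      also have "\<dots> = 2 * C * c0_norm a + \<epsilon>" unfolding \<delta>_def using C1 by (simp add: algebra_simps)
      finally show "norm (\<Sum>n. a n *\<^sub>R y n) \<le> 2 * C * c0_norm a + \<epsilon>" .
    qed
    show "c0_norm a \<le> 2 * K * norm (\<Sum>n. a n *\<^sub>R y n)"
      unfolding c0_norm_def
    proof (rule cSUP_least)
      fix i
      have "(\<lambda>n. 2 * K * norm (\<Sum>i<n. a i *\<^sub>R y i)) \<longlonglongrightarrow> 2 * K * norm (\<Sum>n. a n *\<^sub>R y n)"
        by (intro tendsto_intros lim a)
      moreover have "\<forall>n\<ge>Suc i. \<bar>a i\<bar> \<le> 2 * K * norm (\<Sum>i<n. a i *\<^sub>R y i)"
        using basic_with_coeff_le[OF y(1), of i _ a] y(2) unfolding normalized_def by simp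
      ultimately show "\<bar>a i\<bar> \<le> 2 * K * norm (\<Sum>n. a n *\<^sub>R y n)"
        by (intro LIMSEQ_le_const[where X = "\<lambda>n. 2 * K * norm (\<Sum>i<n. a i *\<^sub>R y i)"]) blast+
    qed simp
  qed (auto intro: summ c0_coord_le)
qed

lemma basic_with_sum_initial:
  assumes x: "basic_with K x" and Z: "finite Z" "T \<subseteq> Z" "T \<lless> Z - T"
  shows "norm (\<Sum>i\<in>T. a i *\<^sub>R x i) \<le> K * norm (\<Sum>i\<in>Z. a i *\<^sub>R x i)"
proof -
  have finT: "finite T" using Z finite_subset by blast
  define b where "b i = (if i \<in> Z then a i else 0)" for i
  define m where "m = (if T = {} then 0 else Suc (Max T))"
  obtain n0 where n0: "Z \<subseteq> {..<n0}" using Z(1) finite_nat_iff_bounded by blast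
  define n where "n = max m n0"
  have mem: "i \<in> T" if i: "i \<in> Z" "i < m" for i
  proof (rule ccontr)
    assume "i \<notin> T"
    have "T \<noteq> {}" using i(2) unfolding m_def by auto
    then have "Max T \<in> T" using finT by simp
    then have "Max T < i" using Z(3) i(1) \<open>i \<notin> T\<close> unfolding before_def by blast
    then show False using i(2) \<open>T \<noteq> {}\<close> unfolding m_def by simp
  qed
  have Tm: "T \<subseteq> {..<m}"
  proof
    fix i assume "i \<in> T"
    then show "i \<in> {..<m}" using Max_ge[OF finT] unfolding m_def by (auto simp: less_Suc_eq_le)
  qed
  have "(\<Sum>i<m. b i *\<^sub>R x i) = (\<Sum>i\<in>T. b i *\<^sub>R x i)"
    using Tm mem by (intro sum.mono_neutral_right) (auto simp: b_def)
  also have "\<dots> = (\<Sum>i\<in>T. a i *\<^sub>R x i)"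
    using Z(2) by (intro sum.cong) (auto simp: b_def)
  finally have 1: "(\<Sum>i<m. b i *\<^sub>R x i) = (\<Sum>i\<in>T. a i *\<^sub>R x i)" .
  have "(\<Sum>i<n. b i *\<^sub>R x i) = (\<Sum>i\<in>Z. b i *\<^sub>R x i)"
    using n0 unfolding n_def by (intro sum.mono_neutral_right) (auto simp: b_def)
  also have "\<dots> = (\<Sum>i\<in>Z. a i *\<^sub>R x i)"
    by (intro sum.cong) (auto simp: b_def)
  finally have 2: "(\<Sum>i<n. b i *\<^sub>R x i) = (\<Sum>i\<in>Z. a i *\<^sub>R x i)" .
  show ?thesis
    using basic_with_le[OF x, of m n b] unfolding 1 2 by (simp add: n_def)
qed

lemma basic_with_sum_ge:
  assumes x: "basic_with K x" "normalized x" and Z: "finite Z" "i \<in> Z"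
  shows "\<bar>a i\<bar> \<le> 2 * K * norm (\<Sum>j\<in>Z. a j *\<^sub>R x j)"
proof -
  define b where "b j = (if j \<in> Z then a j else 0)" for j
  obtain n where n: "Z \<subseteq> {..<n}" using Z(1) finite_nat_iff_bounded by blast
  have "(\<Sum>j<n. b j *\<^sub>R x j) = (\<Sum>j\<in>Z. b j *\<^sub>R x j)"
    using n by (intro sum.mono_neutral_right) (auto simp: b_def)
  also have "\<dots> = (\<Sum>j\<in>Z. a j *\<^sub>R x j)"
    by (intro sum.cong) (auto simp: b_def)
  finally have "(\<Sum>j<n. b j *\<^sub>R x j) = (\<Sum>j\<in>Z. a j *\<^sub>R x j)" .
  moreover have "\<bar>b i\<bar> * norm (x i) \<le> 2 * K * norm (\<Sum>j<n. b j *\<^sub>R x j)"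
    using Z n by (intro basic_with_coeff_le[OF x(1)]) auto
  ultimately show ?thesis using Z x(2) unfolding b_def normalized_def by simp
qed

section \<open>Joins of successive sets and the bar induction for sums\<close>

lemma beforeD: "A \<lless> B \<Longrightarrow> i \<in> A \<Longrightarrow> j \<in> B \<Longrightarrow> i < j"
  unfolding before_def by blast

lemma before_disjoint: "A \<lless> B \<Longrightarrow> A \<inter> B = {}"
  unfolding before_def by blast

lemma before_Un_left: "A \<union> B \<lless> C \<longleftrightarrow> A \<lless> C \<and> B \<lless> C"
  unfolding before_def by blast

lemma before_Un_right: "A \<lless> B \<union> C \<longleftrightarrow> A \<lless> B \<and> A \<lless> C"
  unfolding before_def by blast

lemma successive_before: "successive S \<Longrightarrow> k < l \<Longrightarrow> S k \<lless> S l"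
  unfolding successive_def before_def by blast

lemma successive_ge:
  assumes S: "successive S" and ne: "\<And>k. S k \<noteq> {}"
  shows "i \<in> S k \<Longrightarrow> k \<le> i"
proof (induction k arbitrary: i)
  case (Suc k)
  obtain j where "j \<in> S k" using ne by blast
  then have "j < i" using successive_less[OF S _ _ Suc.prems, of k j] by simp
  moreover have "k \<le> j" by (rule Suc.IH) fact
  ultimately show ?case by simp
qed simp

text \<open>Each new stage of the construction consists of joins of members of the stage before.
  Membership in this closure records the relation across any number of stages, and induction over it
  carries properties stable under appending later sets.\<close>

inductive_set set_joins :: "(nat \<Rightarrow> nat set) \<Rightarrow> nat set set" for V where
  base: "V k \<in> set_joins V"
| join: "A \<in> set_joins V \<Longrightarrow> B \<in> set_joins V \<Longrightarrow> A \<lless> B \<Longrightarrow> A \<union> B \<in> set_joins V"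

lemma set_joins_mono:
  assumes "range W \<subseteq> set_joins V"
  shows "set_joins W \<subseteq> set_joins V"
proof
  fix A assume "A \<in> set_joins W"
  then show "A \<in> set_joins V"
    using assms by (induction rule: set_joins.induct) (auto intro: set_joins.join)
qed

context
  fixes e :: "nat \<Rightarrow> 'a::banach" and K :: real and x :: "nat \<Rightarrow> 'a" and L :: "nat set"
  assumes e: "basic_with K e"
    and le1: "\<And>x. block_basis e x \<Longrightarrow> normalized x \<Longrightarrow> \<exists>r L. strict_mono r \<and> pairlim (x \<circ> r) L \<and> L \<le> 1"
    and x: "block_basis e x" "normalized x"
begin

text \<open>Only the upper estimate 1 in the limit is asked for: pair sums reproduce this, but not
  norms at most 1.\<close>

definition good_sets :: "(nat \<Rightarrow> nat set) \<Rightarrow> bool" where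
  "good_sets V \<longleftrightarrow> successive V \<and> (\<forall>k. V k \<noteq> {} \<and> V k \<subseteq> L) \<and>
     (\<forall>\<epsilon>>0. \<exists>n. \<forall>k\<ge>n. norm (\<Sum>i\<in>V k. x i) < 1 + \<epsilon>)"

lemma good_setsD:
  assumes "good_sets V"
  shows "successive V" "finite (V k)" "V k \<noteq> {}" "V k \<subseteq> L"
  using assms successive_finite unfolding good_sets_def by auto

lemma x_basic: "basic_with K x"
  by (rule basic_with_block_basis[OF e x(1)])

lemma K_ge_1: "K \<ge> 1"
  by (rule basic_with_ge_1[OF e])

text \<open>Along a subsequence the norms of the sums converge to some \<open>c \<le> 1\<close>, and
  the normalized sums have a pair limit \<open>M \<le> 1\<close>. The pair sums then have norms
  tending to \<open>c * M \<le> 1\<close>.\<close>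

lemma good_sets_pairs:
  assumes V: "good_sets V"
  shows "\<exists>r. strict_mono r \<and> good_sets (\<lambda>k. V (r (2 * k)) \<union> V (r (Suc (2 * k))))"
proof -
  define v where "v k = (\<Sum>i\<in>V k. x i)" for k
  have ge: "1 \<le> 2 * K * norm (v k)" for k
  proof -
    obtain i where "i \<in> V k" using good_setsD(3)[OF V] by blast
    then show ?thesis
      using basic_with_sum_ge[OF x_basic x(2) good_setsD(2)[OF V], of i k "\<lambda>_. 1"] unfolding v_def by simp
  qed
  then have nz: "v k \<noteq> 0" for k by (metis mult_zero_right norm_zero not_one_le_zero)
  have v: "block_basis e v"
    by (rule block_basis_blocks[OF x(1) good_setsD(1)[OF V], where d = "\<lambda>_ _. 1"]) (simp_all add: v_def nz[unfolded v_def])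
  obtain N where N: "\<And>k. k \<ge> N \<Longrightarrow> norm (v k) < 2"
    using V unfolding good_sets_def v_def by (metis one_add_one zero_less_one)
  have "bounded (range (\<lambda>k. norm (v (k + N))))"
    unfolding bounded_iff using N by (intro exI[of _ 2]) (auto intro: less_imp_le)
  then obtain c r0 where r0: "strict_mono r0" "((\<lambda>k. norm (v (k + N))) \<circ> r0) \<longlonglongrightarrow> c"
    using bounded_imp_convergent_subsequence by blast
  define r1 where "r1 k = r0 k + N" for k
  have r1: "strict_mono r1" "(\<lambda>k. norm ((v \<circ> r1) k)) \<longlonglongrightarrow> c"
    using r0 unfolding r1_def strict_mono_def by (simp_all add: comp_def)
  have c0: "c \<ge> 0" by (rule LIMSEQ_le_const[OF r1(2)]) simp
  have c1: "c \<le> 1"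
  proof (rule field_le_epsilon)
    fix \<epsilon> :: real assume "\<epsilon> > 0"
    then obtain n where n: "\<And>k. k \<ge> n \<Longrightarrow> norm (v k) < 1 + \<epsilon>"
      using V unfolding good_sets_def v_def by blast
    have "\<forall>k\<ge>n. norm ((v \<circ> r1) k) \<le> 1 + \<epsilon>"
      using n seq_suble[OF r1(1)] by (auto intro: less_imp_le order_trans)
    then show "c \<le> 1 + \<epsilon>" using LIMSEQ_le_const2[OF r1(2)] by blast
  qed
  obtain r2 M where r2: "strict_mono r2" "pairlim (v \<circ> r1 \<circ> r2) (c * M)" "M \<le> 1"
    using block_pairlim[OF le1 block_basis_subseq[OF v r1(1)] r1(2)] by blast
  define r where "r = r1 \<circ> r2"
  have r: "strict_mono r" unfolding r_def by (rule strict_mono_o[OF r1(1) r2(1)])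
  have cM: "c * M \<le> 1"
    using mult_left_mono[OF r2(3) c0] c1 by simp
  let ?U = "\<lambda>k. V (r (2 * k)) \<union> V (r (Suc (2 * k)))"
  have lt: "V (r i) \<lless> V (r j)" if "i < j" for i j
    using successive_before[OF good_setsD(1)[OF V]] strict_monoD[OF r that] by blast
  have "good_sets ?U"
    unfolding good_sets_def
  proof (intro conjI allI impI)
    show "successive ?U"
    proof (rule successiveI)
      fix k i j assume "i \<in> ?U k" "j \<in> ?U (Suc k)"
      moreover have "?U k \<lless> ?U (Suc k)" unfolding before_Un_left before_Un_right by (intro conjI lt) auto
      ultimately show "i < j" by (rule beforeD[rotated])
    qed (use good_setsD[OF V] in auto)
    show "?U k \<noteq> {}" "?U k \<subseteq> L" for k using good_setsD[OF V] by auto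
    fix \<epsilon> :: real assume "\<epsilon> > 0"
    then obtain n where n: "\<forall>i\<ge>n. \<forall>j>i. \<bar>norm ((v \<circ> r1 \<circ> r2) i + (v \<circ> r1 \<circ> r2) j) - c * M\<bar> < \<epsilon>"
      using pairlimD[OF r2(2)] by blast
    have "norm (\<Sum>i\<in>?U k. x i) < 1 + \<epsilon>" if "k \<ge> n" for k
    proof -
      have "(\<Sum>i\<in>?U k. x i) = v (r (2 * k)) + v (r (Suc (2 * k)))"
        unfolding v_def using before_disjoint[OF lt] good_setsD(2)[OF V] by (intro sum.union_disjoint) auto
      then show ?thesis
        using n[rule_format, of "2 * k" "Suc (2 * k)"] that cM by (simp add: r_def)
    qed
    then show "\<exists>n. \<forall>k\<ge>n. norm (\<Sum>i\<in>?U k. x i) < 1 + \<epsilon>" by blast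
  qed
  with r show ?thesis by blast
qed

text \<open>Largeness is asked of an initial segment because only this persists when later sets are
  appended. The threshold \<open>2 * K\<close> is what the basis inequality turns into a norm above
  2 for the whole sum.\<close>

definition big_initial :: "nat set \<Rightarrow> bool" where
  "big_initial Z \<longleftrightarrow> (\<exists>T\<subseteq>Z. T \<lless> Z - T \<and> norm (\<Sum>i\<in>T. x i) > 2 * K)"

lemma big_initial_extend: "big_initial Z \<Longrightarrow> Z \<lless> Y \<Longrightarrow> big_initial (Z \<union> Y)"
  unfolding big_initial_def
  by (elim exE conjE, rule_tac x = T in exI) (auto simp: before_def)

lemma norm_gt_2_of_big_initial:
  assumes "finite Z" "big_initial Z"
  shows "norm (\<Sum>i\<in>Z. x i) > 2"
proof -
  obtain T where T: "T \<subseteq> Z" "T \<lless> Z - T" "norm (\<Sum>i\<in>T. x i) > 2 * K"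
    using assms(2) unfolding big_initial_def by blast
  have "2 * K < K * norm (\<Sum>i\<in>Z. x i)"
    using basic_with_sum_initial[OF x_basic assms(1) T(1,2), of "\<lambda>_. 1"] T(3) by simp
  then show ?thesis using K_ge_1 by (simp add: mult.commute)
qed

text \<open>The bar induction: a continuation of \<open>s\<close> by a join of members of \<open>V\<close> reaches the bar, where
  partial sums are large, while the continuation itself keeps norm about 1.\<close>

definition reaches :: "nat set \<Rightarrow> bool" where
  "reaches s \<longleftrightarrow> (s \<subseteq> L \<longrightarrow> (\<forall>V. good_sets V \<longrightarrow>
     (\<exists>W. good_sets W \<and> range W \<subseteq> set_joins V \<and> (\<forall>k. s \<lless> W k \<and> big_initial (s \<union> W k)))))"

lemma good_sets_tail:
  assumes "good_sets V"
  shows "good_sets (\<lambda>k. V (k + N))"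
  unfolding good_sets_def
proof (intro conjI allI impI)
  have "strict_mono (\<lambda>k. k + N)" by (simp add: strict_mono_def)
  from successive_subseq[OF good_setsD(1)[OF assms] this]
  show "successive (\<lambda>k. V (k + N))" by (simp add: comp_def)
  show "V (k + N) \<noteq> {}" "V (k + N) \<subseteq> L" for k using good_setsD[OF assms] by auto
  fix \<epsilon> :: real assume "\<epsilon> > 0"
  then obtain n where "\<And>k. k \<ge> n \<Longrightarrow> norm (\<Sum>i\<in>V k. x i) < 1 + \<epsilon>"
    using assms unfolding good_sets_def by blast
  then show "\<exists>n. \<forall>k\<ge>n. norm (\<Sum>i\<in>V (k + N). x i) < 1 + \<epsilon>" by (intro exI[of _ n]) simp
qed

text \<open>Past the bar \<open>s\<close> itself already has a large initial sum, and any tail of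
  \<open>V\<close> behind \<open>s\<close> serves.\<close>

lemma reaches_bar:
  assumes M: "finite s" "T \<subseteq> s" "T \<lless> s - T" "norm (\<Sum>i\<in>T. x i) > 2 * K"
  shows "reaches s"
  unfolding reaches_def
proof (intro impI allI)
  fix V assume V: "good_sets V"
  obtain N where N: "s \<subseteq> {..<N}" using M(1) finite_nat_iff_bounded by blast
  define W where "W k = V (k + N)" for k
  have "s \<lless> W k" for k
    using N successive_ge[OF good_setsD(1)[OF V] good_setsD(3)[OF V]] unfolding before_def W_def
    by fastforce
  moreover have "big_initial s" unfolding big_initial_def using M by blast
  moreover have "good_sets W" unfolding W_def by (rule good_sets_tail[OF V])
  moreover have "range W \<subseteq> set_joins V" unfolding W_def by (auto intro: set_joins.base)
  ultimately show "\<exists>W. good_sets W \<and> range W \<subseteq> set_joins V \<and> (\<forall>k. s \<lless> W k \<and> big_initial (s \<union> W k))"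
    using big_initial_extend by blast
qed

text \<open>Members \<open>A n\<close> are picked one at a time; after each choice the hypothesis
  for \<open>s \<union> A n\<close> replaces the current sequence by one whose members complete
  \<open>s \<union> A n\<close> to the bar. Later choices are joins of these, so
  \<open>A i \<union> A j\<close> completes \<open>s\<close> whenever \<open>i < j\<close>. Pairing
  by \<open>good_sets_pairs\<close> brings the norms of these unions back to about 1.\<close>

lemma reaches_step:
  assumes s: "finite s" and IH: "\<And>B. finite B \<Longrightarrow> B \<noteq> {} \<Longrightarrow> s \<lless> B \<Longrightarrow> reaches (s \<union> B)"
  shows "reaches s"
  unfolding reaches_def
proof (intro impI allI)
  fix V assume sL: "s \<subseteq> L" and V: "good_sets V"
  \<comment> \<open>The bound \<open>1 + 1 / real (Suc n)\<close> at stage \<open>n\<close> makes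
    the diagonal sequence of the chosen sets good, so that it can be paired.\<close>
  define Q where "Q = (\<lambda>n (A, U). good_sets U \<and> range U \<subseteq> set_joins V \<and> A \<in> set_joins V \<and>
      finite A \<and> A \<noteq> {} \<and> A \<subseteq> L \<and> s \<lless> A \<and> norm (\<Sum>i\<in>A. x i) < 1 + 1 / real (Suc n) \<and>
      (\<forall>k. s \<union> A \<lless> U k \<and> big_initial (s \<union> A \<union> U k)))"
  have pick: "\<exists>A U'. Q n (A, U') \<and> A \<in> range U \<and> range U' \<subseteq> set_joins U"
    if U: "good_sets U" "range U \<subseteq> set_joins V" for U n
  proof -
    obtain N where N: "s \<subseteq> {..<N}" using s finite_nat_iff_bounded by blast
    have "\<exists>m. \<forall>k\<ge>m. norm (\<Sum>i\<in>U k. x i) < 1 + 1 / real (Suc n)"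
      using U(1) unfolding good_sets_def by simp
    then obtain m where m: "\<And>k. k \<ge> m \<Longrightarrow> norm (\<Sum>i\<in>U k. x i) < 1 + 1 / real (Suc n)" by blast
    define A where "A = U (max m N)"
    have A: "finite A" "A \<noteq> {}" "A \<subseteq> L" "A \<in> set_joins V" "A \<in> range U"
      using good_setsD[OF U(1)] U(2) unfolding A_def by auto
    have sA: "s \<lless> A"
      using N successive_ge[OF good_setsD(1)[OF U(1)] good_setsD(3)[OF U(1)]]
      unfolding before_def A_def by fastforce
    have "s \<union> A \<subseteq> L" using sL A(3) by blast
    then obtain U' where U': "good_sets U'" "range U' \<subseteq> set_joins U"
      "\<forall>k. s \<union> A \<lless> U' k \<and> big_initial (s \<union> A \<union> U' k)"
      using IH[OF A(1,2) sA] U(1) unfolding reaches_def by blast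
    moreover have "range U' \<subseteq> set_joins V" using U'(2) set_joins_mono[OF U(2)] by (rule order_trans)
    moreover have "norm (\<Sum>i\<in>A. x i) < 1 + 1 / real (Suc n)" unfolding A_def by (rule m) simp
    ultimately have "Q n (A, U')" unfolding Q_def using A sA by simp
    then show ?thesis using A(5) U'(2) by blast
  qed
  have "\<exists>f. \<forall>n. Q n (f n) \<and> (fst (f (Suc n)) \<in> range (snd (f n)) \<and> range (snd (f (Suc n))) \<subseteq> set_joins (snd (f n)))"
  proof (rule dependent_nat_choice)
    have "range V \<subseteq> set_joins V" by (auto intro: set_joins.base)
    from pick[OF V this, of 0] show "\<exists>z. Q 0 z" by blast
    fix z and n :: nat assume "Q n z"
    then have "good_sets (snd z)" "range (snd z) \<subseteq> set_joins V"
      unfolding Q_def by (auto simp: case_prod_beta)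
    from pick[OF this, of "Suc n"]
    show "\<exists>z'. Q (Suc n) z' \<and> (fst z' \<in> range (snd z) \<and> range (snd z') \<subseteq> set_joins (snd z))"
      by (metis fst_conv snd_conv)
  qed
  then obtain f where F: "\<forall>n. Q n (f n) \<and> (fst (f (Suc n)) \<in> range (snd (f n)) \<and> range (snd (f (Suc n))) \<subseteq> set_joins (snd (f n)))" ..
  define A where "A n = fst (f n)" for n
  define U where "U n = snd (f n)" for n
  have Qn: "Q n (A n, U n)" for n using F by (simp add: A_def U_def)
  have A: "A n \<in> set_joins V" "finite (A n)" "A n \<noteq> {}" "A n \<subseteq> L" "s \<lless> A n"
      "norm (\<Sum>i\<in>A n. x i) < 1 + 1 / real (Suc n)" for n
    using Qn[of n] unfolding Q_def by simp_all
  have U: "good_sets (U n)" "s \<union> A n \<lless> U n k" "big_initial (s \<union> A n \<union> U n k)" for n k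
    using Qn[of n] unfolding Q_def by simp_all
  have step: "A (Suc n) \<in> range (U n)" "range (U (Suc n)) \<subseteq> set_joins (U n)" for n
    using F by (simp_all add: A_def U_def)
  have nested: "range (U j) \<subseteq> set_joins (U i)" if "i \<le> j" for i j
    using that
  proof (induction j rule: dec_induct)
    case base
    then show ?case by (auto intro: set_joins.base)
  next
    case (step j)
    then show ?case using set_joins_mono[OF step.IH] \<open>range (U (Suc j)) \<subseteq> set_joins (U j)\<close> by blast
  qed
  have later: "A j \<in> set_joins (U i)" if "i < j" for i j
  proof -
    have "A j \<in> range (U (j - 1))" "i \<le> j - 1" using step(1)[of "j - 1"] that by auto
    then show ?thesis using nested[of i "j - 1"] by blast
  qed
  have reach: "s \<union> A i \<lless> X \<and> big_initial (s \<union> A i \<union> X)" if "X \<in> set_joins (U i)" for i X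
    using that
  proof (induction rule: set_joins.induct)
    case (base k)
    then show ?case using U by blast
  next
    case (join X Y)
    have "s \<union> A i \<union> X \<lless> Y" using join before_Un_left[of "s \<union> A i" X Y] by simp
    then have "big_initial ((s \<union> A i \<union> X) \<union> Y)"
      by (rule big_initial_extend[OF conjunct2[OF join.IH(1)]])
    moreover have "s \<union> A i \<lless> X \<union> Y" using join by (simp add: before_Un_right)
    ultimately show ?case by (simp add: Un_assoc)
  qed
  have AA: "A i \<lless> A j" "big_initial (s \<union> (A i \<union> A j))" if "i < j" for i j
    using reach[OF later[OF that]] by (simp_all add: before_Un_left Un_assoc)
  have "good_sets A"
    unfolding good_sets_def
  proof (intro conjI allI impI)
    show "successive A"
      unfolding successive_def using A(2) AA(1) beforeD by blast
    show "A k \<noteq> {}" "A k \<subseteq> L" for k using A by auto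
    fix \<epsilon> :: real assume "\<epsilon> > 0"
    then obtain n where n: "1 / real (Suc n) < \<epsilon>" using nat_approx_posE by blast
    have "norm (\<Sum>i\<in>A k. x i) < 1 + \<epsilon>" if "k \<ge> n" for k
    proof -
      have "1 / real (Suc k) \<le> 1 / real (Suc n)" using that by (simp add: frac_le)
      then show ?thesis using A(6)[of k] n by linarith
    qed
    then show "\<exists>n. \<forall>k\<ge>n. norm (\<Sum>i\<in>A k. x i) < 1 + \<epsilon>" by blast
  qed
  from good_sets_pairs[OF this] obtain r where r: "strict_mono r"
    and W: "good_sets (\<lambda>k. A (r (2 * k)) \<union> A (r (Suc (2 * k))))" by blast
  have lt: "r (2 * k) < r (Suc (2 * k))" for k using strict_monoD[OF r] by simp
  have "range (\<lambda>k. A (r (2 * k)) \<union> A (r (Suc (2 * k)))) \<subseteq> set_joins V"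
    using A(1) AA(1)[OF lt] by (auto intro: set_joins.join)
  moreover have "s \<lless> A (r (2 * k)) \<union> A (r (Suc (2 * k)))" for k
    unfolding before_Un_right using A(5) by blast
  ultimately show "\<exists>W. good_sets W \<and> range W \<subseteq> set_joins V \<and> (\<forall>k. s \<lless> W k \<and> big_initial (s \<union> W k))"
    using W AA(2)[OF lt] by (intro exI[of _ "\<lambda>k. A (r (2 * k)) \<union> A (r (Suc (2 * k)))"]) simp
qed

text \<open>Otherwise every infinite subset of \<open>L\<close> meets the bar, and bar induction
  gives \<open>reaches {}\<close>. Applied to the singletons of \<open>L\<close>, this produces sets
  with a large initial sum whose total has norm below 2, against
  \<open>norm_gt_2_of_big_initial\<close>.\<close>

lemma bounded_initial_sums_exist:
  assumes L: "infinite L"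
  shows "\<exists>M\<subseteq>L. infinite M \<and> (\<forall>n. norm (\<Sum>i\<in>M \<inter> {..<n}. x i) \<le> 2 * K)"
proof (rule ccontr)
  assume neg: "\<not> ?thesis"
  have "reaches {}"
  proof (rule bar_induct)
    fix M :: "nat set" assume M: "infinite M"
    show "\<exists>n. \<forall>m\<ge>n. reaches (M \<inter> {..<m})"
    proof (cases "M \<subseteq> L")
      case True
      then obtain n where n: "norm (\<Sum>i\<in>M \<inter> {..<n}. x i) > 2 * K"
        using neg M by (meson not_le)
      have "reaches (M \<inter> {..<m})" if "m \<ge> n" for m
        by (rule reaches_bar[OF _ _ _ n]) (use that in \<open>auto simp: before_def\<close>)
      then show ?thesis by blast
    next
      case False
      \<comment> \<open>An initial segment containing a point outside \<open>L\<close> satisfies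
        \<open>reaches\<close> vacuously, so bar induction over all infinite sets of naturals
        amounts to one over subsets of \<open>L\<close>.\<close>
      then obtain a where "a \<in> M" "a \<notin> L" by blast
      then have "\<forall>m\<ge>Suc a. reaches (M \<inter> {..<m})"
        unfolding reaches_def by auto
      then show ?thesis by blast
    qed
  qed (rule reaches_step)
  moreover have V: "good_sets (\<lambda>k. {enumerate L k})"
    unfolding good_sets_def
  proof (intro conjI allI impI)
    show "successive (\<lambda>k. {enumerate L k})"
      by (rule successiveI) (use L in \<open>auto simp: enumerate_mono\<close>)
    show "{enumerate L k} \<noteq> {}" "{enumerate L k} \<subseteq> L" for k
      using L by (auto simp: enumerate_in_set)
    show "\<exists>n. \<forall>k\<ge>n. norm (\<Sum>i\<in>{enumerate L k}. x i) < 1 + \<epsilon>" if "\<epsilon> > 0" for \<epsilon>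
      using that x(2) unfolding normalized_def by simp
  qed
  ultimately obtain W where W: "good_sets W" "\<And>k. big_initial (W k)"
    unfolding reaches_def by auto
  obtain n where "norm (\<Sum>i\<in>W n. x i) < 1 + 1"
    using W(1) unfolding good_sets_def by (meson order_refl zero_less_one)
  then show False using norm_gt_2_of_big_initial[OF good_setsD(2)[OF W(1)] W(2), of n] by simp
qed

end

lemma c0_subspace_of_pairlim_le_1:
  fixes e :: "nat \<Rightarrow> 'a::banach"
  assumes e: "basic_with K e"
    and le1: "\<And>x. block_basis e x \<Longrightarrow> normalized x \<Longrightarrow> \<exists>r L. strict_mono r \<and> pairlim (x \<circ> r) L \<and> L \<le> 1"
    and x: "block_basis e x" "normalized x"
  shows "\<exists>Y :: 'a set. subspace Y \<and> isomorphic_to_seq_space Y c0 c0_norm"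
proof -
  obtain L where L: "infinite L"
    and alt: "(\<forall>A\<subseteq>L. finite A \<longrightarrow> A \<notin> {A. norm (\<Sum>i\<in>A. x i) > 2 * K}) \<or>
      (\<forall>M\<subseteq>L. infinite M \<longrightarrow> (\<exists>n. M \<inter> {..<n} \<in> {A. norm (\<Sum>i\<in>A. x i) > 2 * K}))"
    using Galvin[of "{A. norm (\<Sum>i\<in>A. x i) > 2 * K}"] by blast
  obtain M where M: "M \<subseteq> L" "infinite M" "\<And>n. norm (\<Sum>i\<in>M \<inter> {..<n}. x i) \<le> 2 * K"
    using bounded_initial_sums_exist[OF e le1 x L] by blast
  have "\<not> (\<exists>n. M \<inter> {..<n} \<in> {A. norm (\<Sum>i\<in>A. x i) > 2 * K})"
    using M(3) by (simp add: not_less)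
  then have "\<forall>A\<subseteq>L. finite A \<longrightarrow> A \<notin> {A. norm (\<Sum>i\<in>A. x i) > 2 * K}"
    using alt M(1,2) by blast
  then have small: "norm (\<Sum>i\<in>A. x i) \<le> 2 * K" if "A \<subseteq> L" "finite A" for A
    using that by (simp add: not_less)
  define r where "r = enumerate L"
  have r: "strict_mono r" "\<And>i. r i \<in> L"
    unfolding r_def using L by (auto simp: strict_mono_def enumerate_mono enumerate_in_set)
  show ?thesis
  proof (rule c0_embeds)
    show "basic_with K (x \<circ> r)"
      by (rule basic_with_block_basis[OF e block_basis_subseq[OF x(1) r(1)]])
    show "normalized (x \<circ> r)" using x(2) unfolding normalized_def by simp
    fix A :: "nat set" assume "finite A"
    have "(\<Sum>i\<in>A. (x \<circ> r) i) = (\<Sum>i\<in>r ` A. x i)"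
      by (rule sum.reindex[symmetric]) (use strict_mono_imp_inj_on[OF r(1)] inj_on_subset in blast)
    also have "norm \<dots> \<le> 2 * K" using r(2) \<open>finite A\<close> by (intro small) auto
    finally show "norm (\<Sum>i\<in>A. (x \<circ> r) i) \<le> 2 * K" .
  qed
qed

section \<open>Pairs of norm 2 yield \<open>\<ell>\<^sub>1\<close>\<close>

text \<open>With nonnegative coefficients only, this says that convex combinations of the vectors
  over \<open>A\<close> have norm at least \<open>\<delta>\<close>. Signs are dealt with
  separately.\<close>

definition lower_ell1 :: "real \<Rightarrow> (nat \<Rightarrow> 'a::real_normed_vector) \<Rightarrow> nat set \<Rightarrow> bool" where
  "lower_ell1 \<delta> x A \<longleftrightarrow> (\<forall>c. (\<forall>i\<in>A. 0 \<le> c i) \<longrightarrow> \<delta> * (\<Sum>i\<in>A. c i) \<le> norm (\<Sum>i\<in>A. c i *\<^sub>R x i))"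

lemma lower_ell1_subset:
  assumes A: "lower_ell1 \<delta> x A" "finite A" "B \<subseteq> A"
  shows "lower_ell1 \<delta> x B"
  unfolding lower_ell1_def
proof (intro allI impI)
  fix c :: "nat \<Rightarrow> real" assume c: "\<forall>i\<in>B. 0 \<le> c i"
  define d where "d i = (if i \<in> B then c i else 0)" for i
  have "(\<Sum>i\<in>A. d i) = (\<Sum>i\<in>B. d i)" "(\<Sum>i\<in>A. d i *\<^sub>R x i) = (\<Sum>i\<in>B. d i *\<^sub>R x i)"
    using A by (intro sum.mono_neutral_right; simp add: d_def)+
  moreover have "\<delta> * (\<Sum>i\<in>A. d i) \<le> norm (\<Sum>i\<in>A. d i *\<^sub>R x i)"
    using A(1) c unfolding lower_ell1_def by (simp add: d_def)
  ultimately show "\<delta> * (\<Sum>i\<in>B. c i) \<le> norm (\<Sum>i\<in>B. c i *\<^sub>R x i)"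
    by (simp add: d_def)
qed

text \<open>Greedy decomposition: as long as the remaining mass exceeds \<open>\<eta>\<close>, its support violates the lower
  estimate, and a violating combination can be split off until one index is used up.\<close>

lemma norm_le_of_thin:
  fixes x :: "nat \<Rightarrow> 'a::real_normed_vector"
  assumes x: "\<And>i. norm (x i) \<le> 1" and \<delta>: "\<delta> \<ge> 0"
    and "finite S" "\<And>i. i \<in> S \<Longrightarrow> 0 \<le> w i" "\<And>A. A \<subseteq> S \<Longrightarrow> lower_ell1 \<delta> x A \<Longrightarrow> (\<Sum>i\<in>A. w i) \<le> \<eta>"
  shows "norm (\<Sum>i\<in>S. w i *\<^sub>R x i) \<le> \<delta> * (\<Sum>i\<in>S. w i) + \<eta>"
  using assms(3-5)
proof (induction "card S" arbitrary: S w rule: less_induct)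
  case less
  note fin = less.prems(1) and w = less.prems(2)
  show ?case
  proof (cases "(\<Sum>i\<in>S. w i) \<le> \<eta>")
    case True
    have "norm (\<Sum>i\<in>S. w i *\<^sub>R x i) \<le> (\<Sum>i\<in>S. w i)"
    proof (rule sum_norm_le)
      fix i assume "i \<in> S"
      then show "norm (w i *\<^sub>R x i) \<le> w i" using w x[of i] by (simp add: mult_left_le)
    qed
    moreover have "0 \<le> \<delta> * (\<Sum>i\<in>S. w i)" using \<delta> w by (intro mult_nonneg_nonneg sum_nonneg)
    ultimately show ?thesis using True by linarith
  next
    case False
    then have "\<not> lower_ell1 \<delta> x S" using less.prems(3)[of S] by blast
    then obtain c where c: "\<And>i. i \<in> S \<Longrightarrow> 0 \<le> c i" "norm (\<Sum>i\<in>S. c i *\<^sub>R x i) < \<delta> * (\<Sum>i\<in>S. c i)"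
      unfolding lower_ell1_def by (auto simp: not_le)
    define R where "R = {i \<in> S. c i > 0}"
    have "R \<noteq> {}"
    proof
      assume "R = {}"
      then have "c i = 0" if "i \<in> S" for i using c(1)[OF that] that unfolding R_def by force
      then have "(\<Sum>i\<in>S. c i) = 0" by simp
      then show False using c(2) by simp
    qed
    have finR: "finite R" unfolding R_def using fin by simp
    define t where "t = Min ((\<lambda>i. w i / c i) ` R)"
    have "t \<in> (\<lambda>i. w i / c i) ` R" unfolding t_def using finR \<open>R \<noteq> {}\<close> by (intro Min_in) auto
    then obtain j where j: "j \<in> R" "t = w j / c j" by blast
    have t0: "t \<ge> 0" using j w unfolding R_def by simp
    define v where "v i = w i - t * c i" for i
    have v: "0 \<le> v i" if "i \<in> S" for i
    proof (cases "i \<in> R")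
      case True
      then have "t \<le> w i / c i" unfolding t_def using finR by (intro Min_le) auto
      then show ?thesis using True unfolding v_def R_def by (simp add: field_simps)
    next
      case False
      then have "c i = 0" using c(1)[OF that] that unfolding R_def by force
      then show ?thesis using w[OF that] unfolding v_def by simp
    qed
    have vj: "v j = 0" using j unfolding v_def R_def by simp
    have jS: "j \<in> S" using j unfolding R_def by simp
    have "norm (\<Sum>i\<in>S - {j}. v i *\<^sub>R x i) \<le> \<delta> * (\<Sum>i\<in>S - {j}. v i) + \<eta>"
    proof (rule less.hyps)
      show "card (S - {j}) < card S" using fin jS by (rule card_Diff1_less)
      show "finite (S - {j})" using fin by simp
      show "0 \<le> v i" if "i \<in> S - {j}" for i using v that by simp
      fix A assume A: "A \<subseteq> S - {j}" "lower_ell1 \<delta> x A"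
      have "(\<Sum>i\<in>A. v i) \<le> (\<Sum>i\<in>A. w i)"
      proof (rule sum_mono)
        fix i assume "i \<in> A"
        then have "0 \<le> c i" using A(1) c(1) by auto
        then show "v i \<le> w i" unfolding v_def using t0 by simp
      qed
      also have "\<dots> \<le> \<eta>" using A by (intro less.prems(3)) auto
      finally show "(\<Sum>i\<in>A. v i) \<le> \<eta>" .
    qed
    moreover have "(\<Sum>i\<in>S - {j}. v i *\<^sub>R x i) = (\<Sum>i\<in>S. v i *\<^sub>R x i)" "(\<Sum>i\<in>S - {j}. v i) = (\<Sum>i\<in>S. v i)"
      using fin vj by (simp_all add: sum_diff1)
    moreover have "(\<Sum>i\<in>S. w i *\<^sub>R x i) = (\<Sum>i\<in>S. v i *\<^sub>R x i) + t *\<^sub>R (\<Sum>i\<in>S. c i *\<^sub>R x i)"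
      unfolding v_def scaleR_sum_right by (simp flip: sum.distrib add: scaleR_diff_left)
    moreover have "(\<Sum>i\<in>S. w i) = (\<Sum>i\<in>S. v i) + t * (\<Sum>i\<in>S. c i)"
      unfolding v_def sum_distrib_left by (simp flip: sum.distrib)
    moreover have "norm (t *\<^sub>R (\<Sum>i\<in>S. c i *\<^sub>R x i)) \<le> t * (\<delta> * (\<Sum>i\<in>S. c i))"
      using t0 c(2) by (simp add: mult_left_mono)
    ultimately show ?thesis
      using norm_triangle_ineq[of "\<Sum>i\<in>S. v i *\<^sub>R x i" "t *\<^sub>R (\<Sum>i\<in>S. c i *\<^sub>R x i)"]
      by (simp add: algebra_simps)
  qed
qed

section \<open>Convex weights and Ptak's lemma by repeated averaging\<close>

abbreviation supp :: "(nat \<Rightarrow> real) \<Rightarrow> nat set" where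
  "supp w \<equiv> {i. w i \<noteq> 0}"

definition prob_weight :: "(nat \<Rightarrow> real) \<Rightarrow> bool" where
  "prob_weight w \<longleftrightarrow> finite (supp w) \<and> (\<forall>i. 0 \<le> w i) \<and> (\<Sum>i\<in>supp w. w i) = 1"

lemma prob_weightD:
  assumes "prob_weight w"
  shows "finite (supp w)" "0 \<le> w i" "(\<Sum>i\<in>supp w. w i) = 1" "supp w \<noteq> {}"
proof -
  show "supp w \<noteq> {}"
  proof
    assume "supp w = {}"
    then show False using assms unfolding prob_weight_def by (simp del: Collect_empty_eq)
  qed
qed (use assms in \<open>auto simp: prob_weight_def\<close>)

lemma prob_weight_sum_le_1:
  assumes w: "prob_weight w" and A: "finite A"
  shows "(\<Sum>i\<in>A. w i) \<le> 1"
proof -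
  have "(\<Sum>i\<in>A. w i) = (\<Sum>i\<in>A \<inter> supp w. w i)"
    using A by (intro sum.mono_neutral_right) auto
  also have "\<dots> \<le> (\<Sum>i\<in>supp w. w i)"
    using prob_weightD[OF w] by (intro sum_mono2) auto
  finally show ?thesis using prob_weightD(3)[OF w] by simp
qed

definition half_sum :: "(nat \<Rightarrow> real) \<Rightarrow> (nat \<Rightarrow> real) \<Rightarrow> nat \<Rightarrow> real" where
  "half_sum u w i = (u i + w i) / 2"

lemma supp_half_sum:
  assumes "prob_weight u" "prob_weight w"
  shows "supp (half_sum u w) = supp u \<union> supp w"
  using prob_weightD(2)[OF assms(1)] prob_weightD(2)[OF assms(2)]
  by (auto simp: half_sum_def add_nonneg_eq_0_iff)

lemma sum_half_sum: "(\<Sum>i\<in>A. half_sum u w i) = ((\<Sum>i\<in>A. u i) + (\<Sum>i\<in>A. w i)) / 2"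
  unfolding half_sum_def by (simp add: sum.distrib flip: sum_divide_distrib)

lemma prob_weight_half_sum:
  assumes u: "prob_weight u" and w: "prob_weight w"
  shows "prob_weight (half_sum u w)"
  unfolding prob_weight_def supp_half_sum[OF assms]
proof (intro conjI allI)
  let ?S = "supp u \<union> supp w"
  have fin: "finite ?S" using prob_weightD(1)[OF u] prob_weightD(1)[OF w] by simp
  then show "finite ?S" .
  show "0 \<le> half_sum u w i" for i
    using prob_weightD(2)[OF u, of i] prob_weightD(2)[OF w, of i] unfolding half_sum_def by simp
  have "(\<Sum>i\<in>?S. u i) = (\<Sum>i\<in>supp u. u i)" "(\<Sum>i\<in>?S. w i) = (\<Sum>i\<in>supp w. w i)"
    using fin by (intro sum.mono_neutral_right; auto)+
  then show "(\<Sum>i\<in>?S. half_sum u w i) = 1"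
    unfolding sum_half_sum using prob_weightD(3)[OF u] prob_weightD(3)[OF w] by simp
qed

text \<open>The counterpart of \<open>set_joins\<close> for weights. No order of supports is
  imposed, because thinness passes to averages whatever the supports are.\<close>

inductive_set averages :: "(nat \<Rightarrow> nat \<Rightarrow> real) \<Rightarrow> (nat \<Rightarrow> real) set" for V where
  base: "V k \<in> averages V"
| half: "u \<in> averages V \<Longrightarrow> w \<in> averages V \<Longrightarrow> half_sum u w \<in> averages V"

lemma averages_mono:
  assumes "range W \<subseteq> averages V"
  shows "averages W \<subseteq> averages V"
proof
  fix u assume "u \<in> averages W"
  then show "u \<in> averages V"
    using assms by (induction rule: averages.induct) (auto intro: averages.half)
qed

lemma averages_before_supp:
  assumes "u \<in> averages V" "\<And>k. B \<lless> supp (V k)"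
  shows "B \<lless> supp u"
  using assms(1)
proof (induction rule: averages.induct)
  case (half u w)
  then show ?case unfolding before_def half_sum_def by fastforce
qed (rule assms(2))

context
  fixes e :: "nat \<Rightarrow> 'a::banach" and K :: real and x :: "nat \<Rightarrow> 'a" and \<delta> :: real
  assumes e: "basic_with K e"
    and eq2: "\<And>x. block_basis e x \<Longrightarrow> normalized x \<Longrightarrow> \<exists>r L. strict_mono r \<and> pairlim (x \<circ> r) L \<and> L = 2"
    and x: "block_basis e x" "normalized x"
    and \<delta>: "0 \<le> \<delta>" "\<delta> < 1"
begin

definition combine :: "(nat \<Rightarrow> real) \<Rightarrow> 'a" where
  "combine w = (\<Sum>i\<in>supp w. w i *\<^sub>R x i)"

lemma norm_combine_le_1:
  assumes "prob_weight w"
  shows "norm (combine w) \<le> 1"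
proof -
  have "norm (combine w) \<le> (\<Sum>i\<in>supp w. w i)"
    unfolding combine_def
  proof (rule sum_norm_le)
    show "norm (w i *\<^sub>R x i) \<le> w i" for i
      using prob_weightD(2)[OF assms, of i] x(2) unfolding normalized_def by simp
  qed
  then show ?thesis using prob_weightD(3)[OF assms] by simp
qed

lemma combine_half_sum:
  assumes u: "prob_weight u" and w: "prob_weight w"
  shows "combine (half_sum u w) = (1/2) *\<^sub>R (combine u + combine w)"
proof -
  let ?S = "supp u \<union> supp w"
  have fin: "finite ?S" using prob_weightD(1)[OF u] prob_weightD(1)[OF w] by simp
  have eqs: "combine u = (\<Sum>i\<in>?S. u i *\<^sub>R x i)" "combine w = (\<Sum>i\<in>?S. w i *\<^sub>R x i)"
    unfolding combine_def using fin by (intro sum.mono_neutral_left; auto)+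
  have "combine (half_sum u w) = (\<Sum>i\<in>?S. half_sum u w i *\<^sub>R x i)"
    unfolding combine_def supp_half_sum[OF assms] ..
  also have "\<dots> = (\<Sum>i\<in>?S. (1/2) *\<^sub>R (u i *\<^sub>R x i + w i *\<^sub>R x i))"
    by (intro sum.cong refl) (simp add: half_sum_def scaleR_add_left add_divide_distrib scaleR_add_right)
  also have "\<dots> = (1/2) *\<^sub>R (combine u + combine w)"
    unfolding eqs by (simp only: sum.distrib flip: scaleR_sum_right)
  finally show ?thesis .
qed

definition good_weights :: "(nat \<Rightarrow> nat \<Rightarrow> real) \<Rightarrow> bool" where
  "good_weights V \<longleftrightarrow> (\<forall>k. prob_weight (V k)) \<and> successive (\<lambda>k. supp (V k)) \<and>
     (\<lambda>k. norm (combine (V k))) \<longlonglongrightarrow> 1"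

lemma good_weightsD:
  assumes "good_weights V"
  shows "prob_weight (V k)" "successive (\<lambda>k. supp (V k))" "(\<lambda>k. norm (combine (V k))) \<longlonglongrightarrow> 1"
  using assms unfolding good_weights_def by auto

lemma averages_prob_weight:
  assumes "good_weights V" "u \<in> averages V"
  shows "prob_weight u"
  using assms(2) by induction (auto intro: good_weightsD(1)[OF assms(1)] prob_weight_half_sum)

text \<open>Norms tending to 1 and the pair limit 2 of the normalized vectors make pair sums have
  norm about 2, so half sums again have norms tending to 1.\<close>

lemma good_weights_pairs:
  assumes V: "good_weights V"
  shows "\<exists>r. strict_mono r \<and> good_weights (\<lambda>k. half_sum (V (r (2 * k))) (V (r (Suc (2 * k)))))"
proof -
  note pr = good_weightsD(1)[OF V] and sc = good_weightsD(2)[OF V]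
  have x_basic: "basic_with K x" by (rule basic_with_block_basis[OF e x(1)])
  define v where "v k = combine (V k)" for k
  have nz: "v k \<noteq> 0" for k
  proof
    assume v0: "v k = 0"
    obtain i where i: "i \<in> supp (V k)" using prob_weightD(4)[OF pr] by blast
    have "\<bar>V k i\<bar> \<le> 0"
      using basic_with_sum_ge[OF x_basic x(2) prob_weightD(1)[OF pr] i, of "V k"] v0
      unfolding v_def combine_def by simp
    then show False using i by simp
  qed
  have v: "block_basis e v"
    by (rule block_basis_blocks[OF x(1) sc, where d = V]) (simp add: v_def combine_def, rule nz)
  obtain r where r: "strict_mono r" "pairlim (v \<circ> r) (1 * 2)"
    using block_pairlim[where P = "\<lambda>L. L = 2", OF eq2 v good_weightsD(3)[OF V, folded v_def]] by auto
  let ?U = "\<lambda>k. half_sum (V (r (2 * k))) (V (r (Suc (2 * k))))"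
  have lt: "supp (V (r i)) \<lless> supp (V (r j))" if "i < j" for i j
    using successive_before[OF sc] strict_monoD[OF r(1) that] by blast
  have "good_weights ?U"
    unfolding good_weights_def supp_half_sum[OF pr pr]
  proof (intro conjI allI)
    show "prob_weight (?U k)" for k by (intro prob_weight_half_sum pr)
    show "successive (\<lambda>k. supp (V (r (2 * k))) \<union> supp (V (r (Suc (2 * k)))))"
    proof (rule successiveI)
      fix k i j assume "i \<in> supp (V (r (2 * k))) \<union> supp (V (r (Suc (2 * k))))"
        "j \<in> supp (V (r (2 * Suc k))) \<union> supp (V (r (Suc (2 * Suc k))))"
      moreover have "supp (V (r (2 * k))) \<union> supp (V (r (Suc (2 * k)))) \<lless>
          supp (V (r (2 * Suc k))) \<union> supp (V (r (Suc (2 * Suc k))))"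
        unfolding before_Un_left before_Un_right by (intro conjI lt) auto
      ultimately show "i < j" by (rule beforeD[rotated])
    qed (use prob_weightD(1)[OF pr] prob_weightD(4)[OF pr] in blast)+
    show "(\<lambda>k. norm (combine (?U k))) \<longlonglongrightarrow> 1"
    proof (rule LIMSEQ_I)
      fix \<epsilon> :: real assume "\<epsilon> > 0"
      then obtain n where n: "\<forall>i\<ge>n. \<forall>j>i. \<bar>norm ((v \<circ> r) i + (v \<circ> r) j) - 1 * 2\<bar> < \<epsilon>"
        using pairlimD[OF r(2)] by blast
      have "norm (norm (combine (?U k)) - 1) < \<epsilon>" if "k \<ge> n" for k
      proof -
        have "norm (combine (?U k)) = norm (v (r (2 * k)) + v (r (Suc (2 * k)))) / 2"
          unfolding combine_half_sum[OF pr pr] v_def by simp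
        moreover have "\<bar>norm (v (r (2 * k)) + v (r (Suc (2 * k)))) - 2\<bar> < \<epsilon>"
          using n[rule_format, of "2 * k" "Suc (2 * k)"] that by simp
        ultimately show ?thesis using \<open>\<epsilon> > 0\<close> unfolding real_norm_def by linarith
      qed
      then show "\<exists>n. \<forall>k\<ge>n. norm (norm (combine (?U k)) - 1) < \<epsilon>" by blast
    qed
  qed
  with r(1) show ?thesis by blast
qed

lemma good_weights_tail:
  assumes "good_weights V"
  shows "good_weights (\<lambda>k. V (k + N))"
  unfolding good_weights_def
proof (intro conjI allI)
  show "prob_weight (V (k + N))" for k by (rule good_weightsD(1)[OF assms])
  have "strict_mono (\<lambda>k. k + N)" by (simp add: strict_mono_def)
  from successive_subseq[OF good_weightsD(2)[OF assms] this]
  show "successive (\<lambda>k. supp (V (k + N)))" by (simp add: comp_def)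
  show "(\<lambda>k. norm (combine (V (k + N)))) \<longlonglongrightarrow> 1"
    by (rule LIMSEQ_ignore_initial_segment[OF good_weightsD(3)[OF assms]])
qed

text \<open>For \<open>s = {}\<close> this is the hypothesis of \<open>norm_le_of_thin\<close>. The
  version relative to \<open>s\<close> measures only the mass on the continuation, so it is vacuous
  once \<open>s\<close> contains a violation of the lower estimate.\<close>

definition thin :: "nat set \<Rightarrow> real \<Rightarrow> (nat \<Rightarrow> real) \<Rightarrow> bool" where
  "thin s \<eta> w \<longleftrightarrow> (\<forall>A. finite A \<longrightarrow> s \<lless> A \<longrightarrow> lower_ell1 \<delta> x (s \<union> A) \<longrightarrow> (\<Sum>i\<in>A. w i) \<le> \<eta>)"

lemma thin_half:
  assumes "thin s \<eta> u" "thin s \<eta> w"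
  shows "thin s \<eta> (half_sum u w)"
  unfolding thin_def sum_half_sum
proof (intro allI impI)
  fix A assume "finite A" "s \<lless> A" "lower_ell1 \<delta> x (s \<union> A)"
  then have "(\<Sum>i\<in>A. u i) \<le> \<eta>" "(\<Sum>i\<in>A. w i) \<le> \<eta>" using assms unfolding thin_def by blast+
  then show "((\<Sum>i\<in>A. u i) + (\<Sum>i\<in>A. w i)) / 2 \<le> \<eta>" by simp
qed

lemma thin_averages:
  assumes "u \<in> averages V" "\<And>k. thin s \<eta> (V k)"
  shows "thin s \<eta> u"
  using assms(1) by induction (simp_all add: assms(2) thin_half)

text \<open>The quantification over all good sequences \<open>V\<close>, with the result inside
  \<open>averages V\<close>, allows the property to be used for several sets in succession without
  losing what was gained before.\<close>

definition thinnable :: "nat set \<Rightarrow> bool" where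
  "thinnable s \<longleftrightarrow> (\<forall>\<eta>>0. \<forall>V. good_weights V \<longrightarrow>
     (\<exists>W. good_weights W \<and> range W \<subseteq> averages V \<and> (\<forall>k. thin s \<eta> (W k))))"

lemma thinnable_bar:
  assumes "finite s" "A \<subseteq> s" "\<not> lower_ell1 \<delta> x A"
  shows "thinnable s"
proof -
  have "thin s \<eta> w" for \<eta> w
    unfolding thin_def
  proof (intro allI impI)
    fix B assume "finite B" "lower_ell1 \<delta> x (s \<union> B)"
    then have "lower_ell1 \<delta> x A" using assms by (intro lower_ell1_subset[of \<delta> x "s \<union> B" A]) auto
    then show "(\<Sum>i\<in>B. w i) \<le> \<eta>" using assms(3) by blast
  qed
  then show ?thesis unfolding thinnable_def by (auto intro: averages.base)
qed

text \<open>The indices in \<open>S\<close> are treated one after the other; passing to averages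
  preserves the thinness already obtained.\<close>

lemma thin_finite_many:
  assumes IH: "\<And>k. s \<lless> {k} \<Longrightarrow> thinnable (s \<union> {k})" and S: "finite S" "\<And>k. k \<in> S \<Longrightarrow> s \<lless> {k}"
    and \<eta>: "\<eta> > 0" and U: "good_weights U"
  shows "\<exists>W. good_weights W \<and> range W \<subseteq> averages U \<and> (\<forall>k\<in>S. \<forall>j. thin (s \<union> {k}) \<eta> (W j))"
  using S
proof (induction S rule: finite_induct)
  case empty
  have "range U \<subseteq> averages U" by (auto intro: averages.base)
  then show ?case using U by blast
next
  case (insert k S)
  then obtain W where W: "good_weights W" "range W \<subseteq> averages U" "\<forall>k\<in>S. \<forall>j. thin (s \<union> {k}) \<eta> (W j)"
    by auto
  have "thinnable (s \<union> {k})" using insert.prems by (intro IH) simp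
  then obtain W' where W': "good_weights W'" "range W' \<subseteq> averages W" "\<forall>j. thin (s \<union> {k}) \<eta> (W' j)"
    using \<eta> W(1) unfolding thinnable_def by blast
  have "range W' \<subseteq> averages U" using W'(2) averages_mono[OF W(2)] by (rule order_trans)
  moreover have "thin (s \<union> {l}) \<eta> (W' j)" if "l \<in> insert k S" for l j
  proof (cases "l = k")
    case True
    then show ?thesis using W'(3) by simp
  next
    case False
    then have "thin (s \<union> {l}) \<eta> (W i)" for i using W(3) that by simp
    moreover have "W' j \<in> averages W" using W'(2) by blast
    ultimately show ?thesis by (rule thin_averages[rotated])
  qed
  ultimately show ?case using W'(1) by blast
qed

text \<open>The combinatorial core: if mass on continuations of \<open>s \<union> {k}\<close> is already small for every index
  \<open>k\<close> of an earlier member of the sequence, then averaging two members halves the mass on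
  continuations of \<open>s\<close>, since a continuation that meets the first member is thin on the second.\<close>

lemma thin_half_sum:
  assumes uw: "supp u \<lless> supp w" and s: "finite s"
    and u: "thin s (\<theta> + \<eta>) u" and w: "thin s (\<theta> + \<eta>) w"
    and later: "\<And>k. k \<in> supp u \<Longrightarrow> s \<lless> {k} \<Longrightarrow> thin (s \<union> {k}) \<eta> w" and pos: "\<eta> \<ge> 0"
  shows "thin s (\<theta> / 2 + \<eta>) (half_sum u w)"
  unfolding thin_def sum_half_sum
proof (intro allI impI)
  fix A assume A: "finite A" "s \<lless> A" "lower_ell1 \<delta> x (s \<union> A)"
  have uA: "(\<Sum>i\<in>A. u i) \<le> \<theta> + \<eta>" and wA: "(\<Sum>i\<in>A. w i) \<le> \<theta> + \<eta>"
    using u w A unfolding thin_def by blast+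
  show "((\<Sum>i\<in>A. u i) + (\<Sum>i\<in>A. w i)) / 2 \<le> \<theta> / 2 + \<eta>"
  proof (cases "A \<inter> supp u = {}")
    case True
    then have "(\<Sum>i\<in>A. u i) = 0" by (intro sum.neutral) blast
    then show ?thesis using wA pos by simp
  next
    case False
    then obtain k where k: "k \<in> A" "k \<in> supp u" by blast
    define B where "B = {i \<in> A. k < i}"
    have sk: "s \<lless> {k}" using A(2) k(1) unfolding before_def by blast
    have "s \<union> {k} \<lless> B" using A(2) unfolding before_def B_def by blast
    moreover have "lower_ell1 \<delta> x (s \<union> {k} \<union> B)"
      by (rule lower_ell1_subset[OF A(3)]) (use A(1) s k(1) in \<open>auto simp: B_def\<close>)
    moreover have "finite B" unfolding B_def using A(1) by simp
    ultimately have "(\<Sum>i\<in>B. w i) \<le> \<eta>" using later[OF k(2) sk] unfolding thin_def by blast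
    moreover have "(\<Sum>i\<in>A. w i) = (\<Sum>i\<in>B. w i)"
    proof (rule sum.mono_neutral_right[OF A(1)])
      show "B \<subseteq> A" unfolding B_def by blast
      show "\<forall>i\<in>A - B. w i = 0" using beforeD[OF uw k(2)] unfolding B_def by blast
    qed
    ultimately show ?thesis using uA by simp
  qed
qed

text \<open>In the diagonal sequence \<open>w\<close> every member is thin for
  \<open>s \<union> {k}\<close> for each admissible index \<open>k\<close> in the support of an
  earlier member. Under this condition a round of pairing halves the mass on continuations of
  \<open>s\<close>, up to the fixed error \<open>\<eta>\<close>: the bound runs through
  \<open>1 + \<eta>\<close>, \<open>1/2 + \<eta>\<close>, \<open>1/4 + \<eta>\<close> and so on,
  while the norms keep the limit 1.\<close>

lemma thinnable_step:
  assumes s: "finite s" and IH: "\<And>B. finite B \<Longrightarrow> B \<noteq> {} \<Longrightarrow> s \<lless> B \<Longrightarrow> thinnable (s \<union> B)"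
  shows "thinnable s"
  unfolding thinnable_def
proof (intro allI impI)
  fix \<epsilon> :: real and V assume \<epsilon>: "\<epsilon> > 0" and V: "good_weights V"
  \<comment> \<open>One half of \<open>\<epsilon>\<close> is the error that halving does not remove,
    the other half bounds \<open>(1/2)^m\<close> after enough rounds.\<close>
  define \<eta> where "\<eta> = \<epsilon> / 2"
  have \<eta>: "\<eta> > 0" unfolding \<eta>_def using \<epsilon> by simp
  have IH1: "thinnable (s \<union> {k})" if "s \<lless> {k}" for k using IH[of "{k}"] that by simp
  define Q where "Q = (\<lambda>n (w, U). good_weights U \<and> range U \<subseteq> averages V \<and> w \<in> averages V \<and>
      norm (combine w) > 1 - 1 / real (Suc n) \<and>
      (\<forall>j. supp w \<lless> supp (U j)) \<and> (\<forall>k\<in>supp w. s \<lless> {k} \<longrightarrow> (\<forall>j. thin (s \<union> {k}) \<eta> (U j))))"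
  have pick: "\<exists>w U'. Q n (w, U') \<and> w \<in> range U \<and> range U' \<subseteq> averages U"
    if U: "good_weights U" "range U \<subseteq> averages V" for U n
  proof -
    have "1 - 1 / real (Suc n) < 1" by simp
    from order_tendstoD(1)[OF good_weightsD(3)[OF U(1)] this]
    obtain m where m: "\<And>k. k \<ge> m \<Longrightarrow> norm (combine (U k)) > 1 - 1 / real (Suc n)"
      unfolding eventually_sequentially by blast
    define w where "w = U m"
    have fin: "finite (supp w)" unfolding w_def by (rule prob_weightD(1)[OF good_weightsD(1)[OF U(1)]])
    have tail: "good_weights (\<lambda>k. U (k + Suc m))" by (rule good_weights_tail[OF U(1)])
    have "\<exists>W. good_weights W \<and> range W \<subseteq> averages (\<lambda>k. U (k + Suc m)) \<and>
        (\<forall>k\<in>{k \<in> supp w. s \<lless> {k}}. \<forall>j. thin (s \<union> {k}) \<eta> (W j))"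
      by (rule thin_finite_many[OF IH1 _ _ \<eta> tail]) (use fin in auto)
    then obtain W where W: "good_weights W" "range W \<subseteq> averages (\<lambda>k. U (k + Suc m))"
      "\<And>k j. k \<in> supp w \<Longrightarrow> s \<lless> {k} \<Longrightarrow> thin (s \<union> {k}) \<eta> (W j)"
      by blast
    have "supp w \<lless> supp (W j)" for j
    proof (rule averages_before_supp)
      show "W j \<in> averages (\<lambda>k. U (k + Suc m))" using W(2) by blast
      show "supp w \<lless> supp (U (k + Suc m))" for k
        unfolding w_def by (rule successive_before[OF good_weightsD(2)[OF U(1)]]) simp
    qed
    moreover have WU: "range W \<subseteq> averages U"
      using W(2) averages_mono[of "\<lambda>k. U (k + Suc m)" U] averages.base[of U] by blast
    moreover have "range W \<subseteq> averages V" using WU averages_mono[OF U(2)] by (rule order_trans)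
    moreover have "norm (combine w) > 1 - 1 / real (Suc n)" unfolding w_def by (rule m) simp
    moreover have "w \<in> averages V" "w \<in> range U" using U(2) unfolding w_def by auto
    ultimately have "Q n (w, W)" unfolding Q_def using W(1,3) by simp
    then show ?thesis using WU \<open>w \<in> range U\<close> by blast
  qed
  have "\<exists>f. \<forall>n. Q n (f n) \<and> (fst (f (Suc n)) \<in> range (snd (f n)) \<and> range (snd (f (Suc n))) \<subseteq> averages (snd (f n)))"
  proof (rule dependent_nat_choice)
    have "range V \<subseteq> averages V" by (auto intro: averages.base)
    from pick[OF V this, of 0] show "\<exists>z. Q 0 z" by blast
    fix z and n :: nat assume "Q n z"
    then have "good_weights (snd z)" "range (snd z) \<subseteq> averages V"
      unfolding Q_def by (auto simp: case_prod_beta)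
    from pick[OF this, of "Suc n"]
    show "\<exists>z'. Q (Suc n) z' \<and> (fst z' \<in> range (snd z) \<and> range (snd z') \<subseteq> averages (snd z))"
      by (metis fst_conv snd_conv)
  qed
  then obtain f where F: "\<forall>n. Q n (f n) \<and> (fst (f (Suc n)) \<in> range (snd (f n)) \<and> range (snd (f (Suc n))) \<subseteq> averages (snd (f n)))" ..
  define w where "w n = fst (f n)" for n
  define U where "U n = snd (f n)" for n
  have Qn: "Q n (w n, U n)" for n using F by (simp add: w_def U_def)
  have w: "w n \<in> averages V" "norm (combine (w n)) > 1 - 1 / real (Suc n)" for n
    using Qn[of n] unfolding Q_def by simp_all
  have U: "supp (w n) \<lless> supp (U n j)" for n j
    using Qn[of n] unfolding Q_def by (simp del: mem_Collect_eq)
  have Uthin: "thin (s \<union> {k}) \<eta> (U n j)" if "k \<in> supp (w n)" "s \<lless> {k}" for k n j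
    using Qn[of n] that unfolding Q_def by simp
  have next_in: "w (Suc n) \<in> range (U n)" "range (U (Suc n)) \<subseteq> averages (U n)" for n
    using F by (simp_all add: w_def U_def)
  have nested: "range (U j) \<subseteq> averages (U i)" if "i \<le> j" for i j
    using that
  proof (induction j rule: dec_induct)
    case base
    then show ?case by (auto intro: averages.base)
  next
    case (step j)
    then show ?case using averages_mono[OF step.IH] next_in(2)[of j] by blast
  qed
  have later: "w j \<in> averages (U i)" if "i < j" for i j
  proof -
    have "w j \<in> range (U (j - 1))" "i \<le> j - 1" using next_in(1)[of "j - 1"] that by auto
    then show ?thesis using nested[of i "j - 1"] by blast
  qed
  have wp: "prob_weight (w n)" for n by (rule averages_prob_weight[OF V w(1)])
  have w_good: "good_weights w"
    unfolding good_weights_def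
  proof (intro conjI allI)
    show "prob_weight (w n)" for n by (rule wp)
    have "supp (w i) \<lless> supp (w j)" if "i < j" for i j
      by (rule averages_before_supp[OF later[OF that] U])
    then show "successive (\<lambda>k. supp (w k))"
      unfolding successive_def using prob_weightD(1)[OF wp] by (simp add: before_def)
    show "(\<lambda>n. norm (combine (w n))) \<longlonglongrightarrow> 1"
    proof (rule tendsto_sandwich)
      show "\<forall>\<^sub>F n in sequentially. 1 - 1 / real (Suc n) \<le> norm (combine (w n))"
        using w(2) by (intro always_eventually) (auto intro: less_imp_le)
      show "\<forall>\<^sub>F n in sequentially. norm (combine (w n)) \<le> 1"
        using norm_combine_le_1[OF wp] by (intro always_eventually) auto
      have "(\<lambda>n. 1 - 1 / real (Suc n)) \<longlonglongrightarrow> 1 - 0"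
        by (intro tendsto_diff tendsto_const LIMSEQ_Suc[OF lim_const_over_n])
      then show "(\<lambda>n. 1 - 1 / real (Suc n)) \<longlonglongrightarrow> 1" by simp
    qed simp
  qed
  \<comment> \<open>The condition relating earlier supports to later members is part of the
    invariant, since each round of halving needs it. Pairing preserves it: the support of an earlier
    half sum consists of two earlier supports, and a later half sum averages two later
    weights.\<close>
  have "\<exists>W. good_weights W \<and> range W \<subseteq> averages V \<and> (\<forall>j. thin s ((1/2)^m + \<eta>) (W j)) \<and>
      (\<forall>i j k. i < j \<longrightarrow> k \<in> supp (W i) \<longrightarrow> s \<lless> {k} \<longrightarrow> thin (s \<union> {k}) \<eta> (W j))" for m
  proof (induction m)
    case 0
    have "thin s ((1/2)^0 + \<eta>) (w j)" for j
      unfolding thin_def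
    proof (intro allI impI)
      fix A :: "nat set" assume "finite A"
      from prob_weight_sum_le_1[OF wp this, of j] \<eta>
      show "(\<Sum>i\<in>A. w j i) \<le> (1/2)^0 + \<eta>" by simp
    qed
    moreover have "thin (s \<union> {k}) \<eta> (w j)" if "i < j" "k \<in> supp (w i)" "s \<lless> {k}" for i j k
      by (rule thin_averages[OF later[OF that(1)] Uthin[OF that(2,3)]])
    ultimately show ?case using w_good w(1) by (intro exI[of _ w]) blast
  next
    case (Suc m)
    then obtain W where W: "good_weights W" "range W \<subseteq> averages V" "\<And>j. thin s ((1/2)^m + \<eta>) (W j)"
      "\<And>i j k. i < j \<Longrightarrow> k \<in> supp (W i) \<Longrightarrow> s \<lless> {k} \<Longrightarrow> thin (s \<union> {k}) \<eta> (W j)"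
      by blast
    obtain r where r: "strict_mono r" and g: "good_weights (\<lambda>k. half_sum (W (r (2 * k))) (W (r (Suc (2 * k)))))"
      using good_weights_pairs[OF W(1)] by blast
    let ?W = "\<lambda>k. half_sum (W (r (2 * k))) (W (r (Suc (2 * k))))"
    note pr = good_weightsD(1)[OF W(1)]
    have lt: "r (2 * k) < r (Suc (2 * k))" for k by (rule strict_monoD[OF r]) simp
    have "range ?W \<subseteq> averages V" using W(2) by (auto intro: averages.half)
    moreover have "thin s ((1/2)^Suc m + \<eta>) (?W j)" for j
    proof -
      have "thin s ((1/2)^m / 2 + \<eta>) (?W j)"
        by (rule thin_half_sum[OF successive_before[OF good_weightsD(2)[OF W(1)] lt] s W(3) W(3) W(4)[OF lt]])
          (use \<eta> in auto)
      then show ?thesis by simp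
    qed
    moreover have "thin (s \<union> {k}) \<eta> (?W j)" if ij: "i < j" and k: "k \<in> supp (?W i)" "s \<lless> {k}" for i j k
    proof -
      have "k \<in> supp (W (r (2 * i))) \<or> k \<in> supp (W (r (Suc (2 * i))))"
        using k(1) unfolding supp_half_sum[OF pr pr] by blast
      then obtain i' where i': "k \<in> supp (W (r i'))" "i' \<le> Suc (2 * i)" by auto
      have "r i' < r (2 * j)" "r i' < r (Suc (2 * j))"
        using i'(2) ij by (auto intro!: strict_monoD[OF r])
      then have "thin (s \<union> {k}) \<eta> (W (r (2 * j)))" "thin (s \<union> {k}) \<eta> (W (r (Suc (2 * j))))"
        using W(4)[OF _ i'(1) k(2)] by blast+
      then show ?thesis by (rule thin_half)
    qed
    ultimately show ?case using g by (intro exI[of _ ?W]) blast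
  qed
  moreover obtain m where "(1/2::real)^m < \<eta>" using real_arch_pow_inv[OF \<eta>, of "1/2"] by auto
  ultimately obtain W m where W: "good_weights W" "range W \<subseteq> averages V" "\<And>j. thin s ((1/2)^m + \<eta>) (W j)" "(1/2::real)^m < \<eta>"
    by blast
  have "thin s \<epsilon> (W j)" for j
    unfolding thin_def
  proof (intro allI impI)
    fix A assume "finite A" "s \<lless> A" "lower_ell1 \<delta> x (s \<union> A)"
    then have "(\<Sum>i\<in>A. W j i) \<le> (1/2)^m + \<eta>" using W(3)[of j] unfolding thin_def by blast
    then show "(\<Sum>i\<in>A. W j i) \<le> \<epsilon>" using W(4) unfolding \<eta>_def by simp
  qed
  then show "\<exists>W. good_weights W \<and> range W \<subseteq> averages V \<and> (\<forall>k. thin s \<epsilon> (W k))" using W(1,2) by blast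
qed

text \<open>Otherwise every infinite set contains a finite violation, hence meets the bar, and
  \<open>thinnable {}\<close> follows. Applied to unit masses with error
  \<open>(1 - \<delta>) / 2\<close>, it gives convex combinations of norm at most
  \<open>\<delta> + (1 - \<delta>) / 2 < 1\<close>, although their norms tend to 1.\<close>

lemma lower_ell1_subsequence:
  "\<exists>M. infinite M \<and> (\<forall>A\<subseteq>M. finite A \<longrightarrow> lower_ell1 \<delta> x A)"
proof (rule ccontr)
  assume neg: "\<not> ?thesis"
  have "thinnable {}"
  proof (rule bar_induct)
    fix M :: "nat set" assume "infinite M"
    then obtain A where A: "A \<subseteq> M" "finite A" "\<not> lower_ell1 \<delta> x A" using neg by blast
    obtain n where n: "A \<subseteq> {..<n}" using A(2) finite_nat_iff_bounded by blast
    have "thinnable (M \<inter> {..<m})" if "m \<ge> n" for m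
      by (rule thinnable_bar[OF _ _ A(3)]) (use A(1) n that in auto)
    then show "\<exists>n. \<forall>m\<ge>n. thinnable (M \<inter> {..<m})" by blast
  qed (rule thinnable_step)
  moreover define V where "V k i = (if i = k then 1 else 0 :: real)" for k i :: nat
  have suppV: "supp (V k) = {k}" for k unfolding V_def by auto
  have "good_weights V"
    unfolding good_weights_def prob_weight_def combine_def suppV
  proof (intro conjI allI)
    show "successive (\<lambda>k. {k})" by (rule successiveI) auto
    show "(\<lambda>k. norm (\<Sum>i\<in>{k}. V k i *\<^sub>R x i)) \<longlonglongrightarrow> 1"
      using x(2) unfolding normalized_def V_def by simp
  qed (simp_all add: V_def)
  moreover have "(1 - \<delta>) / 2 > 0" using \<delta> by simp
  ultimately obtain W where W: "good_weights W" "\<And>k. thin {} ((1 - \<delta>) / 2) (W k)"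
    unfolding thinnable_def by blast
  have "norm (combine (W k)) \<le> \<delta> + (1 - \<delta>) / 2" for k
  proof -
    note pr = prob_weightD[OF good_weightsD(1)[OF W(1)]]
    have "norm (combine (W k)) \<le> \<delta> * (\<Sum>i\<in>supp (W k). W k i) + (1 - \<delta>) / 2"
      unfolding combine_def
    proof (rule norm_le_of_thin)
      show "norm (x i) \<le> 1" for i using x(2) unfolding normalized_def by simp
      show "(\<Sum>i\<in>A. W k i) \<le> (1 - \<delta>) / 2" if "A \<subseteq> supp (W k)" "lower_ell1 \<delta> x A" for A
      proof -
        have "finite A" using finite_subset[OF that(1) pr(1)] .
        then show ?thesis using W(2)[of k] that(2) unfolding thin_def by (simp add: before_def)
      qed
    qed (use pr \<delta> in auto)
    then show ?thesis using pr(3) by simp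
  qed
  then have "1 \<le> \<delta> + (1 - \<delta>) / 2"
    using LIMSEQ_le_const2[OF good_weightsD(3)[OF W(1)]] by blast
  then have "2 \<le> 2 * \<delta> + (1 - \<delta>)" by (simp add: field_simps)
  then show False using \<delta> by linarith
qed

end

lemma ell1_embeds:
  fixes y :: "nat \<Rightarrow> 'a::banach"
  assumes y: "normalized y" and \<delta>: "\<delta> > 0"
    and lower: "\<And>a n. \<delta> * (\<Sum>k<n. \<bar>a k\<bar>) \<le> norm (\<Sum>k<n. a k *\<^sub>R y k)"
  shows "\<exists>Y :: 'a set. subspace Y \<and> isomorphic_to_seq_space Y ell1 ell1_norm"
proof -
  have ny: "norm (a n *\<^sub>R y n) = \<bar>a n\<bar>" for a n using y unfolding normalized_def by simp
  have abs_summ: "summable (\<lambda>n. norm (a n *\<^sub>R y n))" if "a \<in> ell1" for a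
    using that unfolding ell1_def ny by simp
  show ?thesis
  proof (rule seq_space_embeds[where y = y and C = 1 and D = "1 / \<delta>"])
    show "(\<lambda>_. 0) \<in> ell1" unfolding ell1_def by simp
    show "(\<lambda>n. a n + b n) \<in> ell1" if "a \<in> ell1" "b \<in> ell1" for a b
    proof -
      have "summable (\<lambda>n. \<bar>a n\<bar> + \<bar>b n\<bar>)" using that unfolding ell1_def by (simp add: summable_add)
      then have "summable (\<lambda>n. \<bar>a n + b n\<bar>)"
        by (rule summable_comparison_test'[of _ 0]) simp
      then show ?thesis unfolding ell1_def by simp
    qed
    show "(\<lambda>n. r * a n) \<in> ell1" if "a \<in> ell1" for r a
      using that summable_mult[of "\<lambda>n. \<bar>a n\<bar>" "\<bar>r\<bar>"] unfolding ell1_def by (simp add: abs_mult)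
    fix a assume a: "a \<in> ell1"
    then have sa: "summable (\<lambda>n. \<bar>a n\<bar>)" unfolding ell1_def by simp
    show summ: "summable (\<lambda>n. a n *\<^sub>R y n)"
      by (rule summable_norm_cancel[OF abs_summ[OF a]])
    show "\<bar>a i\<bar> \<le> ell1_norm a" for i
      unfolding ell1_norm_def using sum_le_suminf[OF sa, of "{i}"] by simp
    show "norm (\<Sum>n. a n *\<^sub>R y n) \<le> 1 * ell1_norm a"
      using summable_norm[OF abs_summ[OF a]] unfolding ell1_norm_def ny by simp
    have "\<delta> * ell1_norm a \<le> norm (\<Sum>n. a n *\<^sub>R y n)"
    proof (rule LIMSEQ_le)
      show "(\<lambda>n. \<delta> * (\<Sum>k<n. \<bar>a k\<bar>)) \<longlonglongrightarrow> \<delta> * ell1_norm a"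
        unfolding ell1_norm_def by (intro tendsto_mult_left summable_LIMSEQ sa)
      show "(\<lambda>n. norm (\<Sum>k<n. a k *\<^sub>R y k)) \<longlonglongrightarrow> norm (\<Sum>n. a n *\<^sub>R y n)"
        by (intro tendsto_norm summable_LIMSEQ summ)
    qed (use lower in blast)
    then show "ell1_norm a \<le> 1 / \<delta> * norm (\<Sum>n. a n *\<^sub>R y n)"
      using \<delta> by (simp add: field_simps)
  qed (use \<delta> in simp_all)
qed

section \<open>Almost 2-separated block bases and arbitrary signs\<close>

lemma basic_with_sum_nonzero:
  assumes x: "basic_with K x" and Z: "finite Z" "i \<in> Z" "a i \<noteq> 0"
  shows "(\<Sum>j\<in>Z. a j *\<^sub>R x j) \<noteq> 0"
proof
  assume z: "(\<Sum>j\<in>Z. a j *\<^sub>R x j) = 0"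
  define y where "y j = sgn (x j)" for j
  have "block_basis x x" using basic_with_nonzero[OF x] by (rule block_basis_self)
  from block_basis_normalize[OF this] have y: "basic_with K y" "normalized y"
    using basic_with_block_basis[OF x] unfolding y_def by blast+
  have "(a j * norm (x j)) *\<^sub>R y j = a j *\<^sub>R x j" for j
    using basic_with_nonzero[OF x, of j] by (simp add: y_def sgn_div_norm)
  then have "(\<Sum>j\<in>Z. (a j * norm (x j)) *\<^sub>R y j) = 0"
    using z by simp
  then have "\<bar>a i * norm (x i)\<bar> \<le> 0"
    using basic_with_sum_ge[OF y Z(1,2), of "\<lambda>j. a j * norm (x j)"] by simp
  then show False using Z(3) basic_with_nonzero[OF x, of i] by simp
qed

lemma sum_lessThan_6:
  fixes f :: "nat \<Rightarrow> 'b::comm_monoid_add"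
  shows "(\<Sum>i<6. f i) = f 0 + f 1 + f 2 + f 3 + f 4 + f 5"
  by (simp add: eval_nat_numeral)

lemma strict_mono_on_6:
  fixes k :: "nat \<Rightarrow> nat"
  assumes "k 0 < k 1" "k 1 < k 2" "k 2 < k 3" "k 3 < k 4" "k 4 < k 5"
  shows "strict_mono_on {..<6} k"
proof (rule strict_mono_onI)
  fix r s :: nat assume "r \<in> {..<6}" "s \<in> {..<6}" "r < s"
  then have "r \<in> {0,1,2,3,4,5}" "s \<in> {0,1,2,3,4,5}" by auto
  then show "k r < k s" using assms \<open>r < s\<close> by auto
qed

context
  fixes e :: "nat \<Rightarrow> 'a::banach" and K :: real
  assumes e: "basic_with K e"
    and eq2: "\<And>x. block_basis e x \<Longrightarrow> normalized x \<Longrightarrow> \<exists>r L. strict_mono r \<and> pairlim (x \<circ> r) L \<and> L = 2"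
begin

lemma pairlim_double:
  assumes "block_basis e v" "(\<lambda>i. norm (v i)) \<longlonglongrightarrow> c"
  shows "\<exists>r. strict_mono r \<and> pairlim (v \<circ> r) (2 * c)"
  using block_pairlim[where P = "\<lambda>L. L = 2", OF eq2 assms] by (auto simp: mult.commute)

text \<open>With \<open>c = \<parallel>s\<^sub>0 - s\<^sub>1\<parallel>\<close>, doubling twice makes the alternating sum of 8 and hence of 6 terms of the
  spreading model have norm at least \<open>4 c - c\<close>; removing its third and last terms, whose difference
  has norm \<open>c\<close>, leaves the difference of two far apart differences with norm at least \<open>2 c\<close>.\<close>

lemma separated_block_basis_exists:
  "\<exists>y. block_basis e y \<and> normalized y \<and> (\<forall>i j. i < j \<longrightarrow> norm (y i - y j) > 19/10)"
proof -
  have ee: "block_basis e e" using basic_with_nonzero[OF e] by (rule block_basis_self)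
  define x0 where "x0 i = sgn (e i)" for i
  have x0: "block_basis e x0" "normalized x0"
    using block_basis_normalize[OF ee] unfolding x0_def by blast+
  obtain r0 and s :: "nat \<Rightarrow> ell_infinity" where r0: "strict_mono r0" and sp: "spreading_model (x0 \<circ> r0) s"
    using spreading_model_exists[OF basic_with_block_basis[OF e x0(1)] x0(2)] by blast
  define X where "X = x0 \<circ> r0"
  have X: "block_basis e X" "normalized X" "basic_with K X" and sp: "spreading_model X s"
    using block_basis_subseq[OF x0(1) r0] x0(2) sp basic_with_block_basis[OF e]
    unfolding X_def by (auto simp: normalized_def)
  have K: "K \<ge> 1" by (rule basic_with_ge_1[OF e])
  define c where "c = norm (s 0 - s 1)"
  have two: "\<exists>N. \<forall>i\<ge>N. \<forall>j>i. \<bar>norm (X i - X j) - c\<bar> < \<epsilon>" if \<epsilon>: "\<epsilon> > 0" for \<epsilon>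
  proof -
    obtain N where N: "\<forall>(a :: nat \<Rightarrow> real) k. (\<forall>i<2. \<bar>a i\<bar> \<le> 1) \<longrightarrow> strict_mono_on {..<2} k \<longrightarrow> N \<le> k 0 \<longrightarrow>
        \<bar>norm (\<Sum>i<2. a i *\<^sub>R X (k i)) - norm (\<Sum>i<2. a i *\<^sub>R s i)\<bar> < \<epsilon>"
      using spreading_model_approx[OF sp _ \<epsilon>, of 2] by auto
    have "\<bar>norm (X i - X j) - c\<bar> < \<epsilon>" if "i \<ge> N" "j > i" for i j
    proof -
      have "strict_mono_on {..<2} (\<lambda>m::nat. if m = 0 then i else j)"
        using that by (auto simp: strict_mono_on_def)
      then show ?thesis
        using N[rule_format, of "\<lambda>m. if m = 0 then 1 else - 1" "\<lambda>m. if m = 0 then i else j"] that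
        unfolding c_def by (simp add: numeral_2_eq_2)
    qed
    then show ?thesis by blast
  qed
  define L6 where "L6 = norm (\<Sum>i<6. (- 1) ^ i *\<^sub>R s i)"
  define six where "six k = norm (X (k 0) - X (k 1) + X (k 2) - X (k 3) + X (k 4) - X (k (5::nat)))" for k
  have six: "\<exists>N. \<forall>k. strict_mono_on {..<6} k \<longrightarrow> N \<le> k 0 \<longrightarrow> \<bar>six k - L6\<bar> < \<epsilon>" if \<epsilon>: "\<epsilon> > 0" for \<epsilon>
  proof -
    obtain N where N: "\<forall>(a :: nat \<Rightarrow> real) k. (\<forall>i<6. \<bar>a i\<bar> \<le> 1) \<longrightarrow> strict_mono_on {..<6} k \<longrightarrow> N \<le> k 0 \<longrightarrow>
        \<bar>norm (\<Sum>i<6. a i *\<^sub>R X (k i)) - norm (\<Sum>i<6. a i *\<^sub>R s i)\<bar> < \<epsilon>"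
      using spreading_model_approx[OF sp _ \<epsilon>, of 6] by auto
    have "six k = norm (\<Sum>i<6. (- 1) ^ i *\<^sub>R X (k i))" for k
      unfolding six_def sum_lessThan_6 by simp
    then have "\<bar>six k - L6\<bar> < \<epsilon>" if "strict_mono_on {..<6} k" "N \<le> k 0" for k
      using N[rule_format, of "\<lambda>i. (- 1) ^ i" k] that unfolding L6_def by (simp add: power_abs)
    then show ?thesis by blast
  qed
  have c_pos: "c > 0"
  proof -
    define c0 where "c0 = 1 / (2 * K)"
    have c0: "c0 > 0" unfolding c0_def using K by simp
    obtain N where N: "\<forall>i\<ge>N. \<forall>j>i. \<bar>norm (X i - X j) - c\<bar> < c0" using two[OF c0] by blast
    have "(\<Sum>j\<in>{N, Suc N}. (if j = N then 1 else - 1) *\<^sub>R X j) = X N - X (Suc N)" by simp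
    then have "1 \<le> 2 * K * norm (X N - X (Suc N))"
      using basic_with_sum_ge[OF X(3,2), of "{N, Suc N}" N "\<lambda>j. if j = N then 1 else - 1"] by simp
    then have "c0 \<le> norm (X N - X (Suc N))" unfolding c0_def using K by (simp add: field_simps)
    then show ?thesis using N[rule_format, of N "Suc N"] by simp
  qed
  define u where "u k = X (2 * k) - X (Suc (2 * k))" for k
  have u: "block_basis e u"
  proof (rule block_basis_blocks[OF X(1), where S = "\<lambda>k. {2 * k, Suc (2 * k)}" and d = "\<lambda>_ j. if even j then 1 else - 1"])
    show "successive (\<lambda>k. {2 * k, Suc (2 * k)})" by (rule successiveI) auto
    show eq: "u k = (\<Sum>j\<in>{2 * k, Suc (2 * k)}. (if even j then 1 else - 1) *\<^sub>R X j)" for k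
      unfolding u_def by simp
    show "u k \<noteq> 0" for k
      unfolding eq by (rule basic_with_sum_nonzero[OF X(3), of _ "2 * k"]) auto
  qed
  have nu: "(\<lambda>k. norm (u k)) \<longlonglongrightarrow> c"
  proof (rule LIMSEQ_I)
    fix \<epsilon> :: real assume "\<epsilon> > 0"
    then obtain N where N: "\<forall>i\<ge>N. \<forall>j>i. \<bar>norm (X i - X j) - c\<bar> < \<epsilon>" using two by blast
    then have "norm (norm (u k) - c) < \<epsilon>" if "k \<ge> N" for k
      using that unfolding u_def by simp
    then show "\<exists>N. \<forall>k\<ge>N. norm (norm (u k) - c) < \<epsilon>" by blast
  qed
  obtain r1 where r1: "strict_mono r1" "pairlim (u \<circ> r1) (2 * c)" using pairlim_double[OF u nu] by blast
  define U where "U k = u (r1 (2 * k)) + u (r1 (Suc (2 * k)))" for k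
  have r1_lt: "r1 i < r1 j \<longleftrightarrow> i < j" for i j using r1(1) by (rule strict_mono_less)
  have U: "block_basis e U"
  proof (rule block_basis_blocks[OF u, where S = "\<lambda>k. {r1 (2 * k), r1 (Suc (2 * k))}" and d = "\<lambda>_ _. 1"])
    show "successive (\<lambda>k. {r1 (2 * k), r1 (Suc (2 * k))})"
      by (rule successiveI) (auto simp: r1_lt)
    show eq: "U k = (\<Sum>j\<in>{r1 (2 * k), r1 (Suc (2 * k))}. 1 *\<^sub>R u j)" for k
      unfolding U_def using r1_lt[of "2 * k" "Suc (2 * k)"] by simp
    show "U k \<noteq> 0" for k
      unfolding eq by (rule basic_with_sum_nonzero[OF basic_with_block_basis[OF e u], of _ "r1 (2 * k)"]) auto
  qed
  have nU: "(\<lambda>k. norm (U k)) \<longlonglongrightarrow> 2 * c"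
  proof (rule LIMSEQ_I)
    fix \<epsilon> :: real assume "\<epsilon> > 0"
    then obtain N where N: "\<forall>i\<ge>N. \<forall>j>i. \<bar>norm ((u \<circ> r1) i + (u \<circ> r1) j) - 2 * c\<bar> < \<epsilon>"
      using pairlimD[OF r1(2)] by blast
    then have "norm (norm (U k) - 2 * c) < \<epsilon>" if "k \<ge> N" for k
      using that unfolding U_def by simp
    then show "\<exists>N. \<forall>k\<ge>N. norm (norm (U k) - 2 * c) < \<epsilon>" by blast
  qed
  obtain r2 where r2: "strict_mono r2" "pairlim (U \<circ> r2) (2 * (2 * c))" using pairlim_double[OF U nU] by blast
  have L6: "L6 \<ge> 3 * c"
  proof (rule field_le_epsilon)
    fix \<epsilon> :: real assume "\<epsilon> > 0"
    then have \<epsilon>3: "\<epsilon> / 3 > 0" by simp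
    obtain N1 where N1: "\<forall>i\<ge>N1. \<forall>j>i. \<bar>norm ((U \<circ> r2) i + (U \<circ> r2) j) - 2 * (2 * c)\<bar> < \<epsilon> / 3"
      using pairlimD[OF r2(2) \<epsilon>3] by blast
    obtain N2 where N2: "\<forall>i\<ge>N2. \<forall>j>i. \<bar>norm (X i - X j) - c\<bar> < \<epsilon> / 3" using two[OF \<epsilon>3] by blast
    obtain N3 where N3: "\<forall>k. strict_mono_on {..<6} k \<longrightarrow> N3 \<le> k 0 \<longrightarrow> \<bar>six k - L6\<bar> < \<epsilon> / 3"
      using six[OF \<epsilon>3] by blast
    define i where "i = Max {N1, N2, N3}"
    have i: "i \<ge> N1" "i \<ge> N2" "i \<ge> N3" unfolding i_def by auto
    define p0 p1 p2 p3 where "p0 = r1 (2 * r2 i)" and "p1 = r1 (Suc (2 * r2 i))"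
      and "p2 = r1 (2 * r2 (Suc i))" and "p3 = r1 (Suc (2 * r2 (Suc i)))"
    have "r2 i < r2 (Suc i)" using r2(1) by (rule strict_monoD) simp
    then have p: "p0 < p1" "p1 < p2" "p2 < p3" unfolding p0_def p1_def p2_def p3_def r1_lt by auto
    have "i \<le> r2 i" "2 * r2 i \<le> p0" using seq_suble[OF r2(1)] seq_suble[OF r1(1)] unfolding p0_def by auto
    then have ip: "i \<le> p0" by simp
    have e4: "norm (u p0 + u p1 + (u p2 + u p3)) > 4 * c - \<epsilon> / 3"
      using N1[rule_format, OF i(1) lessI] unfolding U_def comp_def p0_def p1_def p2_def p3_def by linarith
    have "N2 \<le> 2 * p3" using i(2) ip p by linarith
    then have up3: "norm (u p3) < c + \<epsilon> / 3"
      using N2[rule_format, OF _ lessI, of "2 * p3"] unfolding u_def by linarith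
    \<comment> \<open>For these indices the alternating sum of six terms is
      \<open>u p0 + u p1 + u p2\<close>, the sum of four differences without its last one, whose
      norm is about \<open>c\<close>.\<close>
    define k where "k m = [2 * p0, Suc (2 * p0), 2 * p1, Suc (2 * p1), 2 * p2, Suc (2 * p2)] ! m" for m
    have "strict_mono_on {..<6} k" by (rule strict_mono_on_6) (use p in \<open>simp_all add: k_def eval_nat_numeral\<close>)
    moreover have "N3 \<le> k 0" using ip i(3) unfolding k_def by simp
    ultimately have "\<bar>six k - L6\<bar> < \<epsilon> / 3" using N3 by blast
    then have "six k < L6 + \<epsilon> / 3" by linarith
    moreover have "six k = norm (u p0 + u p1 + u p2)"
      unfolding six_def k_def u_def by (simp add: eval_nat_numeral algebra_simps)
    moreover have "norm (u p0 + u p1 + (u p2 + u p3)) \<le> norm (u p0 + u p1 + u p2) + norm (u p3)"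
      using norm_triangle_ineq[of "u p0 + u p1 + u p2" "u p3"] by (simp add: add.assoc)
    ultimately show "3 * c \<le> L6 + \<epsilon>" using e4 up3 by linarith
  qed
  \<comment> \<open>The estimate for \<open>z i - z j\<close> loses \<open>2 * \<epsilon>\<close>
    and replacing \<open>z\<close> by \<open>c\<close> times its normalization loses as much again;
    \<open>2 * c - 4 * \<epsilon>\<close> is \<open>c * (19/10)\<close>.\<close>
  define \<epsilon> where "\<epsilon> = c / 40"
  have \<epsilon>: "\<epsilon> > 0" unfolding \<epsilon>_def using c_pos by simp
  obtain N2 where N2: "\<forall>i\<ge>N2. \<forall>j>i. \<bar>norm (X i - X j) - c\<bar> < \<epsilon>" using two[OF \<epsilon>] by blast
  obtain N3 where N3: "\<forall>k. strict_mono_on {..<6} k \<longrightarrow> N3 \<le> k 0 \<longrightarrow> \<bar>six k - L6\<bar> < \<epsilon>" using six[OF \<epsilon>] by blast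
  define N where "N = max N2 N3"
  \<comment> \<open>Every second difference is skipped: \<open>z i\<close> uses the indices
    \<open>4 * (i + N)\<close> and its successor, and the next index stays free as the third term of
    the alternating sum.\<close>
  define z where "z i = u (2 * (i + N))" for i
  have z: "block_basis e z"
    using block_basis_subseq[OF u, of "\<lambda>i. 2 * (i + N)"] unfolding z_def by (simp add: strict_mono_def comp_def)
  have nz: "\<bar>norm (z i) - c\<bar> < \<epsilon>" for i
    using N2 unfolding z_def u_def N_def by simp
  have zz: "norm (z i - z j) > 2 * c - 2 * \<epsilon>" if ij: "i < j" for i j
  proof -
    define a b where "a = 4 * (i + N)" and "b = 4 * (j + N)"
    have ab: "a + 4 \<le> b" "a \<ge> N2" "a \<ge> N3" using ij unfolding a_def b_def N_def by auto
    define k where "k m = [a, a + 1, a + 2, b, b + 1, b + 2] ! m" for m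
    have "strict_mono_on {..<6} k" by (rule strict_mono_on_6) (use ab in \<open>simp_all add: k_def eval_nat_numeral\<close>)
    moreover have "N3 \<le> k 0" using ab unfolding k_def by simp
    ultimately have "\<bar>six k - L6\<bar> < \<epsilon>" using N3 by blast
    then have "six k > 3 * c - \<epsilon>" using L6 by linarith
    moreover have "six k = norm ((z i - z j) + (X (a + 2) - X (b + 2)))"
    proof -
      have zij: "z i = X a - X (a + 1)" "z j = X b - X (b + 1)"
        unfolding z_def u_def a_def b_def by (simp_all add: algebra_simps)
      show ?thesis unfolding six_def k_def zij by (simp add: eval_nat_numeral algebra_simps)
    qed
    moreover have "norm (X (a + 2) - X (b + 2)) < c + \<epsilon>"
      using N2[rule_format, of "a + 2" "b + 2"] ab by simp
    ultimately show ?thesis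
      using norm_triangle_ineq[of "z i - z j" "X (a + 2) - X (b + 2)"] by linarith
  qed
  define y where "y i = sgn (z i)" for i
  have y: "block_basis e y" "normalized y" using block_basis_normalize[OF z] unfolding y_def by blast+
  have "norm (y i - y j) > 19/10" if "i < j" for i j
  proof -
    have dec: "norm (z k - c *\<^sub>R y k) < \<epsilon>" for k
    proof -
      have "norm (z k) *\<^sub>R sgn (z k) = z k" using block_basis_nonzero[OF z] by (simp add: sgn_div_norm)
      then have "z k - c *\<^sub>R y k = (norm (z k) - c) *\<^sub>R y k" unfolding y_def by (simp add: scaleR_diff_left)
      then show ?thesis using nz[of k] y(2) unfolding normalized_def by simp
    qed
    have "z i - z j = c *\<^sub>R (y i - y j) + ((z i - c *\<^sub>R y i) - (z j - c *\<^sub>R y j))"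
      by (simp add: algebra_simps)
    then have "norm (z i - z j) = norm (c *\<^sub>R (y i - y j) + ((z i - c *\<^sub>R y i) - (z j - c *\<^sub>R y j)))"
      by (rule arg_cong)
    then have "norm (z i - z j) \<le> norm (c *\<^sub>R (y i - y j)) + (norm (z i - c *\<^sub>R y i) + norm (z j - c *\<^sub>R y j))"
      using norm_triangle_ineq[of "c *\<^sub>R (y i - y j)" "(z i - c *\<^sub>R y i) - (z j - c *\<^sub>R y j)"]
        norm_triangle_ineq4[of "z i - c *\<^sub>R y i" "z j - c *\<^sub>R y j"] by linarith
    then have "2 * c - 4 * \<epsilon> < c * norm (y i - y j)"
      using zz[OF that] dec[of i] dec[of j] c_pos unfolding norm_scaleR by linarith
    then have "c * (19/10) < c * norm (y i - y j)" unfolding \<epsilon>_def by simp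
    then show ?thesis using c_pos by simp
  qed
  with y show ?thesis by blast
qed

end

text \<open>Signs depend on the position within \<open>A\<close>, so inserting a point reverses all
  later ones. An estimate for all finite subsets of an infinite set thereby covers every choice of
  signs along a subsequence.\<close>

definition alternating :: "(nat \<Rightarrow> 'a::real_vector) \<Rightarrow> nat set \<Rightarrow> (nat \<Rightarrow> real) \<Rightarrow> 'a" where
  "alternating y A c = (\<Sum>i\<in>A. ((- 1) ^ card (A \<inter> {..<i}) * c i) *\<^sub>R y i)"

lemma alternating_insert:
  assumes A: "finite A" "A \<lless> {b}"
  shows "alternating y (insert b A) (c(b := t)) = alternating y A c + ((- 1) ^ card A * t) *\<^sub>R y b"
    and "(\<Sum>i\<in>insert b A. (c(b := t)) i) = (\<Sum>i\<in>A. c i) + t"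
proof -
  have b: "b \<notin> A" using A(2) unfolding before_def by blast
  have "insert b A \<inter> {..<b} = A" using A(2) unfolding before_def by auto
  moreover have "insert b A \<inter> {..<i} = A \<inter> {..<i}" if "i \<in> A" for i
    using beforeD[OF A(2) that] by auto
  ultimately show "alternating y (insert b A) (c(b := t)) = alternating y A c + ((- 1) ^ card A * t) *\<^sub>R y b"
    unfolding alternating_def using A(1) b
    by (simp add: add.commute) (intro sum.cong, auto)
  show "(\<Sum>i\<in>insert b A. (c(b := t)) i) = (\<Sum>i\<in>A. c i) + t"
    using A(1) b by (simp add: add.commute) (intro sum.cong, auto)
qed

text \<open>Arbitrary signs on the odd terms of \<open>l\<close> become alternating after inserting, where needed, the
  preceding even term with coefficient 0.\<close>

lemma signs_via_alternation:
  fixes l :: "nat \<Rightarrow> nat"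
  assumes l: "strict_mono l"
  shows "\<exists>A c. finite A \<and> A \<subseteq> l ` {..<2 * n} \<and> (\<forall>i. 0 \<le> c i) \<and> (\<Sum>i\<in>A. c i) = (\<Sum>k<n. \<bar>a k\<bar>) \<and>
    alternating y A c = (\<Sum>k<n. a k *\<^sub>R y (l (Suc (2 * k))))"
proof (induction n)
  case 0
  show ?case by (rule exI[of _ "{}"]) (auto simp: alternating_def intro: exI[of _ "\<lambda>_. 0"])
next
  case (Suc n)
  then obtain A c where A: "finite A" "A \<subseteq> l ` {..<2 * n}" "\<forall>i. 0 \<le> c i" "(\<Sum>i\<in>A. c i) = (\<Sum>k<n. \<bar>a k\<bar>)"
    "alternating y A c = (\<Sum>k<n. a k *\<^sub>R y (l (Suc (2 * k))))"
    by (elim exE conjE) (rule that)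
  have lt: "A \<lless> {l m}" if "m \<ge> 2 * n" for m
    unfolding before_def
  proof (intro ballI)
    fix i j assume "i \<in> A" "j \<in> {l m}"
    then obtain k where "i = l k" "k < 2 * n" "j = l m" using A(2) by blast
    then show "i < j" using strict_monoD[OF l, of k m] that by simp
  qed
  let ?q = "l (Suc (2 * n))" and ?f = "l (2 * n)"
  have sub: "l ` {..<2 * n} \<subseteq> l ` {..<2 * Suc n}" "?q \<in> l ` {..<2 * Suc n}" "?f \<in> l ` {..<2 * Suc n}" by auto
  show ?case
  proof (cases "(- 1) ^ card A * \<bar>a n\<bar> = a n")
    case True
    let ?A = "insert ?q A" and ?c = "c(?q := \<bar>a n\<bar>)"
    have "A \<lless> {?q}" by (rule lt) simp
    note ins = alternating_insert(1)[OF A(1) this, of y c "\<bar>a n\<bar>"] alternating_insert(2)[OF A(1) this, of c "\<bar>a n\<bar>"]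
    have "finite ?A \<and> ?A \<subseteq> l ` {..<2 * Suc n} \<and> (\<forall>i. 0 \<le> ?c i)" using A(1-3) sub by auto
    moreover have "(\<Sum>i\<in>?A. ?c i) = (\<Sum>k<Suc n. \<bar>a k\<bar>)" using ins A(4) by simp
    moreover have "alternating y ?A ?c = (\<Sum>k<Suc n. a k *\<^sub>R y (l (Suc (2 * k))))"
      unfolding ins(1) True A(5) by simp
    ultimately show ?thesis by blast
  next
    case False
    let ?A = "insert ?f A" and ?c = "c(?f := 0)"
    have Af: "A \<lless> {?f}" by (rule lt) simp
    have fA: "?f \<notin> A" using Af unfolding before_def by blast
    have fq: "?A \<lless> {?q}" using lt[of "Suc (2 * n)"] strict_monoD[OF l, of "2 * n" "Suc (2 * n)"]
      unfolding before_def by simp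
    have finA: "finite ?A" using A(1) by simp
    note ins1 = alternating_insert(1)[OF A(1) Af, of y c 0] alternating_insert(2)[OF A(1) Af, of c 0]
    note ins2 = alternating_insert(1)[OF finA fq, of y ?c "\<bar>a n\<bar>"] alternating_insert(2)[OF finA fq, of ?c "\<bar>a n\<bar>"]
    have sign: "(- 1) ^ card ?A * \<bar>a n\<bar> = a n"
      using False A(1) fA by (cases "even (card A)") (auto simp: abs_if split: if_splits)
    let ?B = "insert ?q ?A" and ?d = "?c(?q := \<bar>a n\<bar>)"
    have "finite ?B \<and> ?B \<subseteq> l ` {..<2 * Suc n} \<and> (\<forall>i. 0 \<le> ?d i)" using A(1-3) sub by auto
    moreover have "(\<Sum>i\<in>?B. ?d i) = (\<Sum>k<Suc n. \<bar>a k\<bar>)" unfolding ins2(2) ins1(2) A(4) by simp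
    moreover have "alternating y ?B ?d = (\<Sum>k<Suc n. a k *\<^sub>R y (l (Suc (2 * k))))"
      unfolding ins2(1) sign ins1(1) A(5) by simp
    ultimately show ?thesis by blast
  qed
qed

lemma sum_over_pairs:
  fixes g :: "nat \<Rightarrow> 'b::comm_monoid_add"
  assumes l: "strict_mono l" and T: "finite T"
  shows "(\<Sum>i\<in>(\<Union>k\<in>T. {l (2 * k), l (Suc (2 * k))}). g i) = (\<Sum>k\<in>T. g (l (2 * k)) + g (l (Suc (2 * k))))"
proof -
  have inj: "l i = l j \<longleftrightarrow> i = j" for i j by (rule strict_mono_eq[OF l])
  have "(\<Sum>i\<in>(\<Union>k\<in>T. {l (2 * k), l (Suc (2 * k))}). g i) = (\<Sum>k\<in>T. \<Sum>i\<in>{l (2 * k), l (Suc (2 * k))}. g i)"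
  proof (rule sum.UNION_disjoint[OF T])
    show "\<forall>i\<in>T. \<forall>j\<in>T. i \<noteq> j \<longrightarrow> {l (2 * i), l (Suc (2 * i))} \<inter> {l (2 * j), l (Suc (2 * j))} = {}"
      by (simp add: inj)
  qed simp
  also have "\<dots> = (\<Sum>k\<in>T. g (l (2 * k)) + g (l (Suc (2 * k))))"
    by (intro sum.cong refl) (simp add: inj)
  finally show ?thesis .
qed

text \<open>With \<open>m k\<close> the larger of the two coefficients, the combination differs from
  that of \<open>m k *\<^sub>R (u k - v k)\<close> by at most
  \<open>(m k - p k) + (m k - q k)\<close> in each term. The norm is thus at least the sum of
  \<open>p k + q k\<close> minus one fifth of the sum of \<open>m k\<close>, and since
  \<open>m k \<le> p k + q k\<close> at least four fifths of the former.\<close>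

lemma norm_difference_combination_ge:
  fixes u v :: "nat \<Rightarrow> 'a::real_normed_vector"
  assumes T: "\<And>k. norm (u k) = 1" "\<And>k. norm (v k) = 1" and pq: "\<And>k. 0 \<le> p k" "\<And>k. 0 \<le> q k"
    and lower: "\<And>a. (\<And>k. 0 \<le> a k) \<Longrightarrow> 9/5 * (\<Sum>k\<in>T. a k) \<le> norm (\<Sum>k\<in>T. a k *\<^sub>R (u k - v k))"
  shows "1/2 * (\<Sum>k\<in>T. p k + q k) \<le> norm (\<Sum>k\<in>T. p k *\<^sub>R u k - q k *\<^sub>R v k)"
proof -
  define m where "m k = max (p k) (q k)" for k
  have m: "0 \<le> m k" "p k \<le> m k" "q k \<le> m k" "m k \<le> p k + q k" for k
    using pq[of k] unfolding m_def by auto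
  let ?D = "\<Sum>k\<in>T. p k *\<^sub>R u k - q k *\<^sub>R v k"
  let ?R = "\<Sum>k\<in>T. (m k - p k) *\<^sub>R u k - (m k - q k) *\<^sub>R v k"
  have "(\<Sum>k\<in>T. m k *\<^sub>R (u k - v k)) = (\<Sum>k\<in>T. (p k *\<^sub>R u k - q k *\<^sub>R v k) + ((m k - p k) *\<^sub>R u k - (m k - q k) *\<^sub>R v k))"
    by (intro sum.cong refl) (simp add: algebra_simps)
  also have "\<dots> = ?D + ?R" by (rule sum.distrib)
  finally have eq: "(\<Sum>k\<in>T. m k *\<^sub>R (u k - v k)) = ?D + ?R" .
  have "norm (\<Sum>k\<in>T. m k *\<^sub>R (u k - v k)) \<le> norm ?D + norm ?R"
    unfolding eq by (rule norm_triangle_ineq)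
  moreover have "norm ?R \<le> (\<Sum>k\<in>T. (m k - p k) + (m k - q k))"
  proof (rule sum_norm_le)
    fix k
    have "norm ((m k - p k) *\<^sub>R u k - (m k - q k) *\<^sub>R v k) \<le> norm ((m k - p k) *\<^sub>R u k) + norm ((m k - q k) *\<^sub>R v k)"
      by (rule norm_triangle_ineq4)
    then show "norm ((m k - p k) *\<^sub>R u k - (m k - q k) *\<^sub>R v k) \<le> (m k - p k) + (m k - q k)"
      using T m[of k] by simp
  qed
  moreover have "(\<Sum>k\<in>T. (m k - p k) + (m k - q k)) = 2 * (\<Sum>k\<in>T. m k) - (\<Sum>k\<in>T. p k + q k)"
    unfolding sum.distrib sum_subtractf by simp
  moreover have "9/5 * (\<Sum>k\<in>T. m k) \<le> norm (\<Sum>k\<in>T. m k *\<^sub>R (u k - v k))" by (rule lower[OF m(1)])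
  moreover have "(\<Sum>k\<in>T. m k) \<le> (\<Sum>k\<in>T. p k + q k)" by (rule sum_mono[OF m(4)])
  moreover have "0 \<le> (\<Sum>k\<in>T. m k)" by (rule sum_nonneg[OF m(1)])
  ultimately show ?thesis by argo
qed

text \<open>The set is an initial segment of a union of pairs, so even members of pairs carry the
  sign plus and odd ones minus. A pair cut in two by \<open>n\<close> is completed with coefficient
  0, which \<open>norm_difference_combination_ge\<close> tolerates because it admits unequal
  coefficients.\<close>

lemma alternating_lower_bound:
  fixes y :: "nat \<Rightarrow> 'a::real_normed_vector" and l :: "nat \<Rightarrow> nat" and c :: "nat \<Rightarrow> real"
  assumes y: "normalized y" and l: "strict_mono l"
    and lower: "\<And>T a. finite T \<Longrightarrow> T \<subseteq> N \<Longrightarrow> (\<And>k. 0 \<le> a k) \<Longrightarrow>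
      9/5 * (\<Sum>k\<in>T. a k) \<le> norm (\<Sum>k\<in>T. a k *\<^sub>R (y (l (2 * k)) - y (l (Suc (2 * k)))))"
    and A: "A = (\<Union>k\<in>N. {l (2 * k), l (Suc (2 * k))}) \<inter> {..<n}" and c: "\<And>i. i \<in> A \<Longrightarrow> 0 \<le> c i"
  shows "1/2 * (\<Sum>i\<in>A. c i) \<le> norm (alternating y A c)"
proof -
  define P where "P T = (\<Union>k\<in>T. {l (2 * k), l (Suc (2 * k))})" for T
  have l_lt: "l i < l j \<longleftrightarrow> i < j" for i j by (rule strict_mono_less[OF l])
  have l_eq: "l i = l j \<longleftrightarrow> i = j" for i j by (rule strict_mono_eq[OF l])
  have A': "A = P N \<inter> {..<n}" unfolding A P_def ..
  define T where "T = {k \<in> N. l (2 * k) < n}"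
  have "k < n" if "k \<in> T" for k
    using that seq_suble[OF l, of "2 * k"] unfolding T_def by simp
  then have T: "finite T" "T \<subseteq> N" unfolding T_def by (auto intro: finite_subset[of _ "{..<n}"])
  have AT: "A \<subseteq> P T"
  proof
    fix i assume "i \<in> A"
    then obtain k where k: "k \<in> N" "i = l (2 * k) \<or> i = l (Suc (2 * k))" "i < n"
      unfolding A' P_def by blast
    then have "l (2 * k) < n" using l_lt[of "2 * k" "Suc (2 * k)"] by auto
    then show "i \<in> P T" unfolding P_def T_def using k by blast
  qed
  have finP: "finite (P T)" unfolding P_def using T(1) by simp
  define d where "d i = (if i \<in> A then c i else 0)" for i
  have d: "0 \<le> d i" for i unfolding d_def using c by simp
  define \<sigma> where "\<sigma> i = (- 1 :: real) ^ card (P N \<inter> {..<i})" for i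
  have below: "P N \<inter> {..<l (2 * k)} = P (N \<inter> {..<k})" for k
    unfolding P_def by (auto simp: l_lt)
  have even_card: "even (card (P (N \<inter> {..<k})))" for k
  proof -
    have "card (P (N \<inter> {..<k})) = (\<Sum>i\<in>P (N \<inter> {..<k}). 1)" by simp
    also have "\<dots> = (\<Sum>j\<in>N \<inter> {..<k}. 1 + 1)" unfolding P_def by (rule sum_over_pairs[OF l]) simp
    finally show ?thesis by simp
  qed
  have \<sigma>_even: "\<sigma> (l (2 * k)) = 1" for k
    unfolding \<sigma>_def below using even_card by simp
  have \<sigma>_odd: "\<sigma> (l (Suc (2 * k))) = - 1" if "k \<in> N" for k
  proof -
    have "P N \<inter> {..<l (Suc (2 * k))} = insert (l (2 * k)) (P N \<inter> {..<l (2 * k)})"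
      unfolding P_def using that by (auto simp: l_lt less_Suc_eq)
    then have "card (P N \<inter> {..<l (Suc (2 * k))}) = Suc (card (P N \<inter> {..<l (2 * k)}))" by simp
    then show ?thesis using \<sigma>_even[of k] unfolding \<sigma>_def by simp
  qed
  have "alternating y A c = (\<Sum>i\<in>A. (\<sigma> i * d i) *\<^sub>R y i)"
    unfolding alternating_def
  proof (rule sum.cong[OF refl])
    fix i assume i: "i \<in> A"
    then have "A \<inter> {..<i} = P N \<inter> {..<i}" unfolding A' by auto
    then show "((- 1) ^ card (A \<inter> {..<i}) * c i) *\<^sub>R y i = (\<sigma> i * d i) *\<^sub>R y i"
      using i unfolding \<sigma>_def d_def by simp
  qed
  also have "\<dots> = (\<Sum>i\<in>P T. (\<sigma> i * d i) *\<^sub>R y i)"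
    using finP AT by (intro sum.mono_neutral_left) (auto simp: d_def)
  also have "\<dots> = (\<Sum>k\<in>T. d (l (2 * k)) *\<^sub>R y (l (2 * k)) - d (l (Suc (2 * k))) *\<^sub>R y (l (Suc (2 * k))))"
    unfolding P_def sum_over_pairs[OF l T(1)]
    by (intro sum.cong refl) (use T(2) \<sigma>_odd in \<open>auto simp: \<sigma>_even\<close>)
  finally have alt: "alternating y A c =
    (\<Sum>k\<in>T. d (l (2 * k)) *\<^sub>R y (l (2 * k)) - d (l (Suc (2 * k))) *\<^sub>R y (l (Suc (2 * k))))" .
  have "(\<Sum>i\<in>A. c i) = (\<Sum>i\<in>A. d i)" unfolding d_def by simp
  also have "\<dots> = (\<Sum>i\<in>P T. d i)"
    using finP AT by (intro sum.mono_neutral_left) (auto simp: d_def)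
  also have "\<dots> = (\<Sum>k\<in>T. d (l (2 * k)) + d (l (Suc (2 * k))))"
    unfolding P_def by (rule sum_over_pairs[OF l T(1)])
  finally have "(\<Sum>i\<in>A. c i) = (\<Sum>k\<in>T. d (l (2 * k)) + d (l (Suc (2 * k))))" .
  then show ?thesis
    unfolding alt using y d lower[OF T]
    by (simp only:) (intro norm_difference_combination_ge, simp_all add: normalized_def)
qed

text \<open>One infinite \<open>M\<close> all of whose initial segments satisfy the alternating
  estimate excludes the second alternative of Galvin's lemma. The first gives the estimate on all
  finite subsets of \<open>L\<close>, from which \<open>signs_via_alternation\<close> obtains all
  signs on the odd terms.\<close>

lemma ell1_subspace_of_pairlim_eq_2:
  fixes e :: "nat \<Rightarrow> 'a::banach"
  assumes e: "basic_with K e"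
    and eq2: "\<And>x. block_basis e x \<Longrightarrow> normalized x \<Longrightarrow> \<exists>r L. strict_mono r \<and> pairlim (x \<circ> r) L \<and> L = 2"
  shows "\<exists>Y :: 'a set. subspace Y \<and> isomorphic_to_seq_space Y ell1 ell1_norm"
proof -
  obtain y where y: "block_basis e y" "normalized y" and sep: "\<And>i j. i < j \<Longrightarrow> norm (y i - y j) > 19/10"
    using separated_block_basis_exists[OF e eq2] by blast
  define alt where "alt A \<longleftrightarrow> (\<forall>c. (\<forall>i\<in>A. 0 \<le> c i) \<longrightarrow> 1/2 * (\<Sum>i\<in>A. c i) \<le> norm (alternating y A c))" for A
  obtain L where L: "infinite L" and L_alt: "(\<forall>A\<subseteq>L. finite A \<longrightarrow> A \<notin> {A. \<not> alt A}) \<or>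
      (\<forall>M\<subseteq>L. infinite M \<longrightarrow> (\<exists>n. M \<inter> {..<n} \<in> {A. \<not> alt A}))"
    using Galvin[of "{A. \<not> alt A}"] by blast
  define l where "l = enumerate L"
  have l: "strict_mono l" "\<And>i. l i \<in> L"
    unfolding l_def using L by (auto simp: strict_mono_def enumerate_mono enumerate_in_set)
  have "\<exists>M\<subseteq>L. infinite M \<and> (\<forall>n. alt (M \<inter> {..<n}))"
  proof -
    define z where "z k = y (l (2 * k)) - y (l (Suc (2 * k)))" for k
    have l_lt: "l i < l j \<longleftrightarrow> i < j" for i j by (rule strict_mono_less[OF l(1)])
    have nz: "norm (z k) > 19/10" for k
      unfolding z_def by (rule sep) (simp add: l_lt)
    then have z0: "z k \<noteq> 0" for k by (metis less_numeral_extra(3) norm_zero order_less_trans divide_pos_pos zero_less_numeral)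
    have z: "block_basis e z"
    proof (rule block_basis_blocks[OF y(1), where S = "\<lambda>k. {l (2 * k), l (Suc (2 * k))}"
          and d = "\<lambda>k j. if j = l (2 * k) then 1 else - 1"])
      show "successive (\<lambda>k. {l (2 * k), l (Suc (2 * k))})"
        by (rule successiveI) (auto simp: l_lt)
      show "z k = (\<Sum>j\<in>{l (2 * k), l (Suc (2 * k))}. (if j = l (2 * k) then 1 else - 1) *\<^sub>R y j)" for k
        unfolding z_def using l_lt[of "2 * k" "Suc (2 * k)"] by simp
    qed (rule z0)
    \<comment> \<open>The separation 19/10 times the convex lower estimate 19/20 is 361/200,
      slightly more than the required 9/5.\<close>
    obtain N where N: "infinite N" "\<And>A. A \<subseteq> N \<Longrightarrow> finite A \<Longrightarrow> lower_ell1 (19/20) (\<lambda>i. sgn (z i)) A"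
      using lower_ell1_subsequence[OF e eq2 block_basis_normalize[OF z], of "19/20"] by auto
    have lower: "9/5 * (\<Sum>k\<in>T. a k) \<le> norm (\<Sum>k\<in>T. a k *\<^sub>R (y (l (2 * k)) - y (l (Suc (2 * k)))))"
      if T: "finite T" "T \<subseteq> N" and a: "\<And>k. 0 \<le> a k" for T and a :: "nat \<Rightarrow> real"
    proof -
      have "19/10 * (\<Sum>k\<in>T. a k) \<le> (\<Sum>k\<in>T. a k * norm (z k))"
        unfolding sum_distrib_left
      proof (rule sum_mono)
        fix k
        show "19/10 * a k \<le> a k * norm (z k)"
          using mult_left_mono[OF less_imp_le[OF nz[of k]] a[of k]] by (simp add: mult.commute)
      qed
      moreover have "(\<Sum>k\<in>T. (a k * norm (z k)) *\<^sub>R sgn (z k)) = (\<Sum>k\<in>T. a k *\<^sub>R z k)"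
        using z0 by (intro sum.cong refl) (simp add: sgn_div_norm)
      then have "19/20 * (\<Sum>k\<in>T. a k * norm (z k)) \<le> norm (\<Sum>k\<in>T. a k *\<^sub>R z k)"
        using N(2)[OF T(2,1)] a unfolding lower_ell1_def by (metis mult_nonneg_nonneg norm_ge_zero)
      moreover have "0 \<le> (\<Sum>k\<in>T. a k)" by (rule sum_nonneg[OF a])
      ultimately have "9/5 * (\<Sum>k\<in>T. a k) \<le> norm (\<Sum>k\<in>T. a k *\<^sub>R z k)" by argo
      then show ?thesis unfolding z_def .
    qed
    define M where "M = (\<Union>k\<in>N. {l (2 * k), l (Suc (2 * k))})"
    have "M \<subseteq> L" unfolding M_def using l(2) by auto
    moreover have "infinite M"
    proof
      assume "finite M"
      moreover have "(\<lambda>k. l (2 * k)) ` N \<subseteq> M" unfolding M_def by blast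
      ultimately have "finite ((\<lambda>k. l (2 * k)) ` N)" by (rule finite_subset[rotated])
      moreover have "inj_on (\<lambda>k. l (2 * k)) N"
        by (rule inj_onI) (simp add: strict_mono_eq[OF l(1)])
      ultimately show False using N(1) by (simp add: finite_image_iff)
    qed
    moreover have "alt (M \<inter> {..<n})" for n
      unfolding alt_def M_def
    proof (intro allI impI)
      fix c :: "nat \<Rightarrow> real"
      let ?A = "(\<Union>k\<in>N. {l (2 * k), l (Suc (2 * k))}) \<inter> {..<n}"
      assume c: "\<forall>i\<in>?A. 0 \<le> c i"
      show "1/2 * (\<Sum>i\<in>?A. c i) \<le> norm (alternating y ?A c)"
        by (rule alternating_lower_bound[OF y(2) l(1) lower refl]) (use c in simp_all)
    qed
    ultimately show ?thesis by blast
  qed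
  then obtain M where M: "M \<subseteq> L" "infinite M" "\<And>n. alt (M \<inter> {..<n})" by blast
  have "\<not> (\<exists>n. M \<inter> {..<n} \<in> {A. \<not> alt A})" using M(3) by simp
  then have all_alt: "\<forall>A\<subseteq>L. finite A \<longrightarrow> A \<notin> {A. \<not> alt A}" using L_alt M(1,2) by blast
  have odd: "strict_mono (\<lambda>k. l (Suc (2 * k)))" using l(1) unfolding strict_mono_def by simp
  show ?thesis
  proof (rule ell1_embeds[where y = "\<lambda>k. y (l (Suc (2 * k)))" and \<delta> = "1/2"])
    show "normalized (\<lambda>k. y (l (Suc (2 * k))))" using y(2) unfolding normalized_def by simp
    fix a :: "nat \<Rightarrow> real" and n
    obtain A c where A: "finite A" "A \<subseteq> l ` {..<2 * n}" "\<forall>i. 0 \<le> c i" "(\<Sum>i\<in>A. c i) = (\<Sum>k<n. \<bar>a k\<bar>)"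
      "alternating y A c = (\<Sum>k<n. a k *\<^sub>R y (l (Suc (2 * k))))"
      using signs_via_alternation[OF l(1), of n a y] by (elim exE conjE) (rule that)
    have "A \<subseteq> L" using A(2) l(2) by blast
    then have "alt A" using all_alt A(1) by blast
    then show "1/2 * (\<Sum>k<n. \<bar>a k\<bar>) \<le> norm (\<Sum>k<n. a k *\<^sub>R y (l (Suc (2 * k))))"
      using A(3) unfolding alt_def A(4,5)[symmetric] by blast
  qed simp
qed

theorem mainTheorem2:
  fixes e :: "nat \<Rightarrow> 'a::banach"
  assumes "schauder_basis e"
    and "\<not> (\<exists>Y :: 'a set. subspace Y \<and> isomorphic_to_seq_space Y ell1 ell1_norm)"
    and "\<not> (\<exists>Y :: 'a set. subspace Y \<and> isomorphic_to_seq_space Y c0 c0_norm)"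
  shows "\<exists>(x :: nat \<Rightarrow> 'a) (s :: nat \<Rightarrow> ell_infinity).
           block_basis e x \<and> normalized x \<and> spreading_model x s \<and>
           1 < norm (s 0 + s 1) \<and> norm (s 0 + s 1) < 2"
proof (rule ccontr)
  assume neg: "\<not> ?thesis"
  obtain K where e: "basic_with K e" using schauder_basis_basic_with[OF assms(1)] by blast
  have gap: "\<exists>r L. strict_mono r \<and> pairlim (x \<circ> r) L \<and> (L \<le> 1 \<or> L = 2)"
    if x: "block_basis e x" "normalized x" for x :: "nat \<Rightarrow> 'a"
  proof -
    obtain r and s :: "nat \<Rightarrow> ell_infinity" where r: "strict_mono r" and s: "spreading_model (x \<circ> r) s"
      using spreading_model_exists[OF basic_with_block_basis[OF e x(1)] x(2)] by blast
    let ?L = "norm (s 0 + s 1)"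
    have xr: "block_basis e (x \<circ> r)" "normalized (x \<circ> r)"
      using block_basis_subseq[OF x(1) r] x(2) unfolding normalized_def by simp_all
    have L: "pairlim (x \<circ> r) ?L" by (rule pairlim_spreading_model[OF s])
    have "?L \<le> 2"
    proof (rule field_le_epsilon)
      fix \<epsilon> :: real assume "\<epsilon> > 0"
      then obtain n where "\<forall>i\<ge>n. \<forall>j>i. \<bar>norm ((x \<circ> r) i + (x \<circ> r) j) - ?L\<bar> < \<epsilon>"
        using pairlimD[OF L] by blast
      from this[rule_format, OF order_refl lessI]
      have "?L < norm ((x \<circ> r) n + (x \<circ> r) (Suc n)) + \<epsilon>" by linarith
      also have "norm ((x \<circ> r) n + (x \<circ> r) (Suc n)) \<le> 2"
        using norm_triangle_ineq[of "(x \<circ> r) n" "(x \<circ> r) (Suc n)"] xr(2) unfolding normalized_def by simp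
      finally show "?L \<le> 2 + \<epsilon>" by simp
    qed
    moreover have "\<not> (1 < ?L \<and> ?L < 2)" using neg xr s by blast
    ultimately have "?L \<le> 1 \<or> ?L = 2" by linarith
    with r L show ?thesis by blast
  qed
  from pairlim_dichotomy[OF e gap] show False
  proof
    assume "\<forall>x. block_basis e x \<longrightarrow> normalized x \<longrightarrow> (\<exists>r. strict_mono r \<and> pairlim (x \<circ> r) 2)"
    then show False using ell1_subspace_of_pairlim_eq_2[OF e] assms(2) by blast
  next
    assume le1: "\<forall>x. block_basis e x \<longrightarrow> normalized x \<longrightarrow> (\<exists>r L. strict_mono r \<and> pairlim (x \<circ> r) L \<and> L \<le> 1)"
    have "block_basis e e" using basic_with_nonzero[OF e] by (rule block_basis_self)
    then show False using c0_subspace_of_pairlim_le_1[OF e _ block_basis_normalize] le1 assms(3) by blast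
  qed
qed

end
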